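(* Let $\mathbb{S}^3$ carry the round metric. Any nonvanishing curl eigenfield on $\mathbb{S}^3$ has even eigenvalue $\lambda=2m$ with $m\in\{\pm1,\pm2,\dots\}$. Moreover, for each integer $m$ with $|m|\ge 2$ there exists a nonvanishing curl eigenfield $V_m$ on $\mathbb{S}^3$ with eigenvalue $2m$ whose associated contact structure is overtwisted, and the homotopy class of the corresponding contact plane field has Hopf invariant $$\frac{\operatorname{sign}(m)(-1)^{m+1}-1}{2}.$$
   Context: All objects are smooth. On an oriented Riemannian 3-manifold $(M,g)$ with volume form $\mathrm{vol}_g$, the curl of a vector field $V$ with metric-dual 1-form $\alpha=V^\flat$ is the vector field $\operatorname{curl}V$ with $i_{\operatorname{curl}V}\mathrm{vol}_g=d\alpha$. A curl eigenfield with eigenvalue $\lambda$ is a vector field $V\not\equiv 0$ with $\operatorname{curl}V=\lambda V$ for a real constant $\lambda\neq0$ (equivalently $\ast d\alpha=\lambda\alpha$). If $V$ is nonvanishing (has no zeros), then $\alpha\wedge d\alpha=\lambda|\alpha|^2\mathrm{vol}_g\ne0$, so $\alpha$ is a contact form, and the contact structure associated with $V$ is the plane field $\ker\alpha$. A contact structure is overtwisted if there is an embedded disk that is tangent to the contact planes along its boundary; otherwise it is tight. $\mathbb{S}^3=\{(z_1,z_2)\in\mathbb{C}^2:|z_1|^2+|z_2|^2=1\}$ has the round (unit sphere) metric, $z_j=x_j+iy_j$. The standard orthonormal global frame is $R=-y_1\partial_{x_1}+x_1\partial_{y_1}-y_2\partial_{x_2}+x_2\partial_{y_2}$, $X_1=-x_2\partial_{x_1}+y_2\partial_{y_1}+x_1\partial_{x_2}-y_1\partial_{y_2}$,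 $X_2=-y_2\partial_{x_1}-x_2\partial_{y_1}+y_1\partial_{x_2}+x_1\partial_{y_2}$, and $\mathbb{S}^3$ is oriented so that $\{R,X_1,X_2\}$ is positive (so $\operatorname{curl}R=2R$). Hopf invariant: a nonvanishing vector field $V=fR+f_1X_1+f_2X_2$ on $\mathbb{S}^3$ has the associated map $\varphi_V=(f,f_1,f_2)/\sqrt{f^2+f_1^2+f_2^2}:\mathbb{S}^3\to\mathbb{S}^2$. The Hopf invariant of (the homotopy class of the contact plane field associated with) $V$ is the Hopf invariant of $\varphi_V$, given by Whitehead's formula $\frac{1}{16\pi^2}\int_{\mathbb{S}^3}\mathcal{A}\wedge d\mathcal{A}$, where $d\mathcal{A}=\varphi_V^*\Omega$ and $\Omega=x\,dy\wedge dz+y\,dz\wedge dx+z\,dx\wedge dy$ is the area form of $\mathbb{S}^2$. *)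

theory Defs
  imports "HOL-Analysis.Analysis"
begin

section \<open>Smooth maps\<close>

primrec continuously_differentiable_times ::
  "nat \<Rightarrow> 'a::euclidean_space set \<Rightarrow> ('a \<Rightarrow> 'b::real_normed_vector) \<Rightarrow> bool"
where
  "continuously_differentiable_times 0 U f \<longleftrightarrow> continuous_on U f"
| "continuously_differentiable_times (Suc k) U f \<longleftrightarrow>
     (\<forall>x\<in>U. f differentiable (at x)) \<and>
     (\<forall>v. continuously_differentiable_times k U (\<lambda>x. frechet_derivative f (at x) v))"

text \<open>On a set that is not open, smooth means: restriction of a smooth map on an open set.\<close>

definition smooth_along ::
  "'a::euclidean_space set \<Rightarrow> ('a \<Rightarrow> 'b::real_normed_vector) \<Rightarrow> bool"
where
  "smooth_along S f \<longleftrightarrow>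
     (\<exists>U F. open U \<and> S \<subseteq> U \<and> (\<forall>k. continuously_differentiable_times k U F)
            \<and> (\<forall>x\<in>S. F x = f x))"


section \<open>The round 3-sphere and its standard frame\<close>

text \<open>The coordinates 1, 2, 3, 4 of \<^typ>\<open>real^4\<close> are $x_1, y_1, x_2, y_2$. The round metric
  is the restriction of the inner product. Objects on the sphere are functions on
  \<^typ>\<open>real^4\<close> of which only the values at points of the sphere (and on tangent
  vectors) matter.\<close>

abbreviation S3 :: "(real^4) set" where
  "S3 \<equiv> sphere 0 1"

definition tangent_S3 :: "real^4 \<Rightarrow> (real^4) set" where
  "tangent_S3 p = {u. u \<bullet> p = 0}"

definition frame_R :: "real^4 \<Rightarrow> real^4" where
  "frame_R p = vector [- p$2, p$1, - p$4, p$3]"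

definition frame_X1 :: "real^4 \<Rightarrow> real^4" where
  "frame_X1 p = vector [- p$3, p$4, p$1, - p$2]"

definition frame_X2 :: "real^4 \<Rightarrow> real^4" where
  "frame_X2 p = vector [- p$4, - p$3, p$2, p$1]"

text \<open>Coefficients of a tangent vector at \<open>p\<close> in the orthonormal frame.\<close>

definition frame_coords :: "real^4 \<Rightarrow> real^4 \<Rightarrow> real^3" where
  "frame_coords p u = vector [u \<bullet> frame_R p, u \<bullet> frame_X1 p, u \<bullet> frame_X2 p]"

text \<open>The volume form of the round metric for which the frame is positive.\<close>

definition vol_S3 :: "real^4 \<Rightarrow> real^4 \<Rightarrow> real^4 \<Rightarrow> real^4 \<Rightarrow> real" where
  "vol_S3 p u v w =
     det (vector [frame_coords p u, frame_coords p v, frame_coords p w] :: real^3^3)"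


section \<open>Differential calculus on the sphere\<close>

text \<open>The differential at \<open>p\<close> of a map \<open>f\<close> on the sphere, in the tangent direction \<open>u\<close>,
  computed from the radially constant extension of \<open>f\<close>.\<close>

definition deriv_S3 :: "(real^4 \<Rightarrow> 'b::real_normed_vector) \<Rightarrow> real^4 \<Rightarrow> real^4 \<Rightarrow> 'b" where
  "deriv_S3 f p u = frechet_derivative (\<lambda>x. f (x /\<^sub>R norm x)) (at p) u"

text \<open>A 1-form on the sphere is represented by a field of linear functionals on \<^typ>\<open>real^4\<close>,
  restricted to tangent vectors. Its radially constant extension is a 1-form near the
  sphere whose pullback to the sphere is the given one, so the exterior derivative
  on the sphere is the restriction of the Euclidean one, with
  $d\alpha(u,v) = (D_u\alpha)(v) - (D_v\alpha)(u)$. It depends only on the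
  restriction of the 1-form to tangent vectors.\<close>

definition ext_deriv ::
  "(real^4 \<Rightarrow> ((real^4) \<Rightarrow>\<^sub>L real)) \<Rightarrow> real^4 \<Rightarrow> real^4 \<Rightarrow> real^4 \<Rightarrow> real"
where
  "ext_deriv \<alpha> p u v =
     blinfun_apply (deriv_S3 \<alpha> p u) v - blinfun_apply (deriv_S3 \<alpha> p v) u"

definition wedge12 ::
  "(real^4 \<Rightarrow> ((real^4) \<Rightarrow>\<^sub>L real)) \<Rightarrow> (real^4 \<Rightarrow> real^4 \<Rightarrow> real^4 \<Rightarrow> real)
    \<Rightarrow> real^4 \<Rightarrow> real^4 \<Rightarrow> real^4 \<Rightarrow> real^4 \<Rightarrow> real"
where
  "wedge12 \<alpha> \<omega> p u v w =
     blinfun_apply (\<alpha> p) u * \<omega> p v w + blinfun_apply (\<alpha> p) v * \<omega> p w u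
       + blinfun_apply (\<alpha> p) w * \<omega> p u v"

definition flat :: "(real^4 \<Rightarrow> real^4) \<Rightarrow> real^4 \<Rightarrow> ((real^4) \<Rightarrow>\<^sub>L real)" where
  "flat V p = blinfun_inner_right (V p)"


section \<open>Curl eigenfields\<close>

definition smooth_vector_field :: "(real^4 \<Rightarrow> real^4) \<Rightarrow> bool" where
  "smooth_vector_field V \<longleftrightarrow> smooth_along S3 V \<and> (\<forall>p\<in>S3. V p \<in> tangent_S3 p)"

definition curl_S3 :: "(real^4 \<Rightarrow> real^4) \<Rightarrow> real^4 \<Rightarrow> real^4" where
  "curl_S3 V p =
     (THE w. w \<in> tangent_S3 p \<and>
        (\<forall>u\<in>tangent_S3 p. \<forall>v\<in>tangent_S3 p. vol_S3 p w u v = ext_deriv (flat V) p u v))"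

definition curl_eigenfield :: "(real^4 \<Rightarrow> real^4) \<Rightarrow> real \<Rightarrow> bool" where
  "curl_eigenfield V lam \<longleftrightarrow>
     smooth_vector_field V \<and> (\<exists>p\<in>S3. V p \<noteq> 0) \<and> lam \<noteq> 0 \<and>
     (\<forall>p\<in>S3. curl_S3 V p = lam *\<^sub>R V p)"

definition nonvanishing :: "(real^4 \<Rightarrow> real^4) \<Rightarrow> bool" where
  "nonvanishing V \<longleftrightarrow> (\<forall>p\<in>S3. V p \<noteq> 0)"


section \<open>Contact structures\<close>

definition contact_form :: "(real^4 \<Rightarrow> ((real^4) \<Rightarrow>\<^sub>L real)) \<Rightarrow> bool" where
  "contact_form \<alpha> \<longleftrightarrow>
     smooth_along S3 \<alpha> \<and>
     (\<forall>p\<in>S3. wedge12 \<alpha> (ext_deriv \<alpha>) p (frame_R p) (frame_X1 p) (frame_X2 p) \<noteq> 0)"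

definition kernel_planes :: "(real^4 \<Rightarrow> ((real^4) \<Rightarrow>\<^sub>L real)) \<Rightarrow> real^4 \<Rightarrow> (real^4) set" where
  "kernel_planes \<alpha> p = {u \<in> tangent_S3 p. blinfun_apply (\<alpha> p) u = 0}"

definition contact_structure :: "(real^4 \<Rightarrow> (real^4) set) \<Rightarrow> bool" where
  "contact_structure \<xi> \<longleftrightarrow> (\<exists>\<alpha>. contact_form \<alpha> \<and> (\<forall>p\<in>S3. \<xi> p = kernel_planes \<alpha> p))"

text \<open>A smoothly embedded closed disk whose tangent plane is the contact plane at each point of
  its boundary. The planes are subspaces of the tangent spaces of the sphere.\<close>

definition overtwisted_disk :: "(real^4 \<Rightarrow> (real^4) set) \<Rightarrow> (real^2 \<Rightarrow> real^4) \<Rightarrow> bool" where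
  "overtwisted_disk \<xi> F \<longleftrightarrow>
     (\<exists>U. open U \<and> cball 0 1 \<subseteq> U \<and> (\<forall>k. continuously_differentiable_times k U F)) \<and>
     F ` cball 0 1 \<subseteq> S3 \<and> inj_on F (cball 0 1) \<and>
     (\<forall>z\<in>cball 0 1. inj (frechet_derivative F (at z))) \<and>
     (\<forall>z\<in>sphere 0 1. range (frechet_derivative F (at z)) = \<xi> (F z))"

definition overtwisted :: "(real^4 \<Rightarrow> (real^4) set) \<Rightarrow> bool" where
  "overtwisted \<xi> \<longleftrightarrow> contact_structure \<xi> \<and> (\<exists>F. overtwisted_disk \<xi> F)"

definition associated_contact_structure :: "(real^4 \<Rightarrow> real^4) \<Rightarrow> real^4 \<Rightarrow> (real^4) set" where
  "associated_contact_structure V = kernel_planes (flat V)"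


section \<open>The Hopf invariant\<close>

text \<open>Integration of a 3-form over the oriented sphere through the parametrization
  $(a,s,b) \mapsto (\cos s\,e^{ia}, \sin s\,e^{ib})$, which on the interior of the box is an
  orientation-preserving diffeomorphism onto the complement of a null set.\<close>

definition toroidal :: "real \<times> real \<times> real \<Rightarrow> real^4" where
  "toroidal = (\<lambda>(a, s, b). vector [cos s * cos a, cos s * sin a, sin s * cos b, sin s * sin b])"

definition integral_S3 :: "(real^4 \<Rightarrow> real^4 \<Rightarrow> real^4 \<Rightarrow> real^4 \<Rightarrow> real) \<Rightarrow> real" where
  "integral_S3 \<omega> =
     integral (cbox (0, 0, 0) (2 * pi, pi / 2, 2 * pi))
       (\<lambda>q. \<omega> (toroidal q)
              (frechet_derivative toroidal (at q) (1, 0, 0))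
              (frechet_derivative toroidal (at q) (0, 1, 0))
              (frechet_derivative toroidal (at q) (0, 0, 1)))"

definition area_S2 :: "real^3 \<Rightarrow> real^3 \<Rightarrow> real^3 \<Rightarrow> real" where
  "area_S2 q a b =
     q$1 * (a$2 * b$3 - a$3 * b$2) + q$2 * (a$3 * b$1 - a$1 * b$3)
       + q$3 * (a$1 * b$2 - a$2 * b$1)"

definition pullback_area :: "(real^4 \<Rightarrow> real^3) \<Rightarrow> real^4 \<Rightarrow> real^4 \<Rightarrow> real^4 \<Rightarrow> real" where
  "pullback_area \<phi> p u v = area_S2 (\<phi> p) (deriv_S3 \<phi> p u) (deriv_S3 \<phi> p v)"

definition area_primitive ::
  "(real^4 \<Rightarrow> real^3) \<Rightarrow> (real^4 \<Rightarrow> ((real^4) \<Rightarrow>\<^sub>L real)) \<Rightarrow> bool"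
where
  "area_primitive \<phi> A \<longleftrightarrow>
     smooth_along S3 A \<and>
     (\<forall>p\<in>S3. \<forall>u\<in>tangent_S3 p. \<forall>v\<in>tangent_S3 p. ext_deriv A p u v = pullback_area \<phi> p u v)"

definition hopf_invariant :: "(real^4 \<Rightarrow> real^3) \<Rightarrow> real" where
  "hopf_invariant \<phi> =
     (THE h. \<exists>A. area_primitive \<phi> A \<and>
        h = 1 / (16 * pi\<^sup>2) * integral_S3 (wedge12 A (ext_deriv A)))"

definition associated_map :: "(real^4 \<Rightarrow> real^4) \<Rightarrow> real^4 \<Rightarrow> real^3" where
  "associated_map V p = frame_coords p (V p) /\<^sub>R norm (frame_coords p (V p))"

end

(* Even eigenvalues. Fix a point p and a unit tangent vector e, and integrate the eigenform
   equation over the geodesic spheres around p. The mean over the sphere of radius r of the Cartesian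
   component of V along e, multiplied by sin r, then solves y'' = - lambda^2 y and vanishes at both
   poles. Hence lambda is an integer k, and V(-p) = (-1)^(k+1) V(p) in R^4. For odd k the components of V
   in the standard frame, which is odd, define an odd map from the 3-sphere to R^3, and a zero exists by
   the Borsuk-Ulam theorem.

   Existence. A torus-invariant field P(t) d/da + Q(t) d/db, with t = |z1|^2 and a, b the arguments of
   z1, z2, has curl 2m V exactly if m Q = (t P)' and m P = - ((1-t) Q)'. The solution regular at t = 0
   is P = 2F1(1-n, 1+n; 2; t), n = |m|, a polynomial. For n >= 2 it has a root in (0,1), by Rolle's
   theorem applied to t (1-t) (m Q - P), and an orbit of d/da over the root bounds an overtwisted disk.
   The associated map is (F(t), g(t) Im(z1 z2), - g(t) Re(z1 z2)), so the pulled back area form is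
   - dF /\ (da + db), and Whitehead's integral depends only on F(0) = sgn Q(0) and F(1) = sgn P(1):
   it equals - (F(1) - F(0))^2 / 4. *)

theory Submission
  imports Defs "HOL-Homology.Homology"
begin

text \<open>The oscillator reflects a Laplace equation: in R^4 the components of a curl eigenfield
  are eigenfunctions of the spherical Laplacian with eigenvalue lambda^2 - 1, hence spherical
  harmonics of degree |lambda| - 1, which explains both the integrality and the sign under p -> -p.
  Here only the first-order curl equation is used, integrated over the azimuth and then against
  trigonometric weights over the polar angle, so second derivatives of the field never occur.

  The parity of the degree is compared along nested equators, so the odd map must first be made to
  preserve all of them.

  \<open>hopf_invariant\<close> is a definite description over all primitives. One primitive has to
  be exhibited, smooth also on the two core circles where an angle is undefined, and all primitives
  have to give the same integral. The first rests on F - F(0) and F - F(1) being divisible by t and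
  1 - t. The second rests on averaging over tori: the equation for dA, and the vanishing of one
  angular component on each core circle, determine the difference of the averages.\<close>

lemma vector_4 [simp]:
  "(vector [x, y, z, w] :: 'a::zero^4) $ 1 = x"
  "(vector [x, y, z, w] :: 'a^4) $ 2 = y"
  "(vector [x, y, z, w] :: 'a^4) $ 3 = z"
  "(vector [x, y, z, w] :: 'a^4) $ 4 = w"
  unfolding vector_def by simp_all

lemma vector_4_axis:
  "(vector [x, y, z, w] :: real^4) = x *\<^sub>R axis 1 1 + y *\<^sub>R axis 2 1 + z *\<^sub>R axis 3 1 + w *\<^sub>R axis 4 1"
  by (simp add: vec_eq_iff forall_4 axis_def)

lemma vector_3_axis:
  "(vector [x, y, z] :: real^3) = x *\<^sub>R axis 1 1 + y *\<^sub>R axis 2 1 + z *\<^sub>R axis 3 1"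
  by (simp add: vec_eq_iff forall_3 axis_def)

lemma continuous_on_vector_4 [continuous_intros]:
  assumes "continuous_on S f" "continuous_on S g" "continuous_on S h" "continuous_on S k"
  shows "continuous_on S (\<lambda>x. vector [f x, g x, h x, k x] :: real^4)"
  unfolding vector_4_axis by (intro continuous_intros assms)

lemma has_derivative_vector_4 [derivative_intros]:
  assumes "(f has_derivative f') F" "(g has_derivative g') F"
    "(h has_derivative h') F" "(k has_derivative k') F"
  shows "((\<lambda>x. vector [f x, g x, h x, k x] :: real^4) has_derivative
           (\<lambda>v. vector [f' v, g' v, h' v, k' v])) F"
  unfolding vector_4_axis by (intro derivative_intros assms)

lemma has_derivative_vector_3 [derivative_intros]:
  assumes "(f has_derivative f') F" "(g has_derivative g') F" "(h has_derivative h') F"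
  shows "((\<lambda>x. vector [f x, g x, h x] :: real^3) has_derivative
           (\<lambda>v. vector [f' v, g' v, h' v])) F"
  unfolding vector_3_axis by (intro derivative_intros assms)


section \<open>Calculus on the sphere\<close>

lemma has_derivative_radial_projection:
  fixes p :: "'a::real_inner"
  assumes "norm p = 1"
  shows "((\<lambda>x. x /\<^sub>R norm x) has_derivative (\<lambda>v. v - (v \<bullet> p) *\<^sub>R p)) (at p)"
proof -
  have "p \<noteq> 0" using assms by auto
  then have "((\<lambda>x. x /\<^sub>R norm x) has_derivative
     (\<lambda>v. inverse (norm p) *\<^sub>R v + (- (inverse (norm p) * (v \<bullet> sgn p) * inverse (norm p))) *\<^sub>R p)) (at p)"
    by (auto intro!: derivative_eq_intros has_derivative_norm)
  then show ?thesis using assms by (simp add: sgn_div_norm)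
qed

lemma has_derivative_radial_extension:
  fixes p :: "'a::real_inner" and f F :: "'a \<Rightarrow> 'b::real_normed_vector"
  assumes p: "norm p = 1" and F: "(F has_derivative F') (at p)"
    and eq: "\<And>x. norm x = 1 \<Longrightarrow> F x = f x"
  shows "((\<lambda>x. f (x /\<^sub>R norm x)) has_derivative (\<lambda>v. F' (v - (v \<bullet> p) *\<^sub>R p))) (at p)"
proof -
  have "((\<lambda>x. F (x /\<^sub>R norm x)) has_derivative (\<lambda>v. F' (v - (v \<bullet> p) *\<^sub>R p))) (at p)"
    using has_derivative_compose[OF has_derivative_radial_projection[OF p], of F F'] F p by simp
  then show ?thesis
  proof (rule has_derivative_transform_within_open[of _ _ _ _ "- {0}"])
    show "p \<in> - {0}" using p by auto
    show "F (x /\<^sub>R norm x) = f (x /\<^sub>R norm x)" if "x \<in> - {0}" for x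
      using that by (intro eq) auto
  qed auto
qed

text \<open>Makes \<open>deriv_S3\<close> computable. The differential of x -> x / |x| at a point of
  the sphere is the orthogonal projection onto the tangent space, so on tangent vectors any
  differentiable extension may replace the radially constant one.\<close>

lemma deriv_S3_eq:
  assumes "p \<in> S3" "u \<bullet> p = 0" "(F has_derivative F') (at p)" "\<And>x. x \<in> S3 \<Longrightarrow> F x = f x"
  shows "deriv_S3 f p u = F' u"
proof -
  have h: "((\<lambda>x. f (x /\<^sub>R norm x)) has_derivative (\<lambda>v. F' (v - (v \<bullet> p) *\<^sub>R p))) (at p)"
    using assms(1,4) by (intro has_derivative_radial_extension[OF _ assms(3)]) auto
  have "deriv_S3 f p u = F' (u - (u \<bullet> p) *\<^sub>R p)"
    unfolding deriv_S3_def frechet_derivative_at[OF h, symmetric] ..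
  then show ?thesis using assms(2) by simp
qed

text \<open>The parameter integrals below move both the point and the direction of differentiation,
  so joint continuity is wanted, while \<open>continuously_differentiable_times\<close> speaks of
  fixed directions. Expanding the direction in the basis bridges the two.\<close>

lemma smooth_along_C1:
  fixes f :: "'a::euclidean_space \<Rightarrow> 'b::real_normed_vector"
  assumes "smooth_along S f"
  obtains U F D where "open U" "S \<subseteq> U" "\<And>x. x \<in> S \<Longrightarrow> F x = f x"
    "\<And>x. x \<in> U \<Longrightarrow> (F has_derivative D x) (at x)"
    "continuous_on {z. fst z \<in> U} (\<lambda>z. D (fst z) (snd z))"
proof -
  obtain U F where U: "open U" "S \<subseteq> U" "\<forall>k. continuously_differentiable_times k U F" "\<forall>x\<in>S. F x = f x"
    using assms unfolding smooth_along_def by blast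
  define D where "D = (\<lambda>x. frechet_derivative F (at x))"
  have "continuously_differentiable_times (Suc 0) U F" using U(3) by blast
  then have F: "\<forall>x\<in>U. F differentiable (at x)" and c: "\<And>v. continuous_on U (\<lambda>x. D x v)"
    by (simp_all add: D_def)
  have d: "(F has_derivative D x) (at x)" if "x \<in> U" for x
    using F that unfolding D_def by (simp add: frechet_derivative_works)
  have lin: "D x v = (\<Sum>i\<in>Basis. (v \<bullet> i) *\<^sub>R D x i)" if "x \<in> U" for x v
  proof -
    interpret linear "D x" using d[OF that] by (rule has_derivative_linear)
    have "D x v = D x (\<Sum>i\<in>Basis. (v \<bullet> i) *\<^sub>R i)" by (simp add: euclidean_representation)
    then show ?thesis by (simp add: sum scale)
  qed
  have "continuous_on {z. fst z \<in> U} (\<lambda>z. \<Sum>i\<in>Basis. (snd z \<bullet> i) *\<^sub>R D (fst z) i)"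
    by (intro continuous_intros continuous_on_compose2[OF c]) auto
  then have "continuous_on {z. fst z \<in> U} (\<lambda>z. D (fst z) (snd z))"
    by (rule continuous_on_eq) (simp add: lin)
  then show ?thesis using that U d by blast
qed

lemma ext_deriv_eq:
  assumes "p \<in> S3" "u \<bullet> p = 0" "v \<bullet> p = 0" "(F has_derivative F') (at p)"
    "\<And>x. x \<in> S3 \<Longrightarrow> F x = A x"
  shows "ext_deriv A p u v = blinfun_apply (F' u) v - blinfun_apply (F' v) u"
  using deriv_S3_eq[of p u F F' A] deriv_S3_eq[of p v F F' A] assms by (simp add: ext_deriv_def)

lemma flat_apply [simp]: "blinfun_apply (flat V p) u = V p \<bullet> u"
  by (simp add: flat_def)

lemma ext_deriv_flat_eq:
  assumes "p \<in> S3" "u \<bullet> p = 0" "v \<bullet> p = 0" "(F has_derivative F') (at p)"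
    "\<And>x. x \<in> S3 \<Longrightarrow> F x = V x"
  shows "ext_deriv (flat V) p u v = F' u \<bullet> v - F' v \<bullet> u"
proof -
  have "((\<lambda>x. blinfun_inner_right (F x)) has_derivative (\<lambda>v. blinfun_inner_right (F' v))) (at p)"
    by (rule bounded_linear.has_derivative[OF bounded_linear_blinfun_inner_right assms(4)])
  then show ?thesis
    using ext_deriv_eq[of p u v "\<lambda>x. blinfun_inner_right (F x)" _ "flat V"] assms
    by (simp add: flat_def)
qed

section \<open>The standard frame\<close>

lemma inner_4: "(x :: real^4) \<bullet> y = x$1 * y$1 + x$2 * y$2 + x$3 * y$3 + x$4 * y$4"
  by (simp add: inner_vec_def sum_4)

lemma inner_3: "(x :: real^3) \<bullet> y = x$1 * y$1 + x$2 * y$2 + x$3 * y$3"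
  by (simp add: inner_vec_def sum_3)

lemma S3_inner: "p \<in> S3 \<Longrightarrow> p \<bullet> p = 1"
  by (simp add: norm_eq_1)

lemma frame_minus: "frame_R (- p) = - frame_R p" "frame_X1 (- p) = - frame_X1 p" "frame_X2 (- p) = - frame_X2 p"
  by (simp_all add: frame_R_def frame_X1_def frame_X2_def vec_eq_iff forall_4)

lemma frame_add: "frame_R (p + q) = frame_R p + frame_R q" "frame_X1 (p + q) = frame_X1 p + frame_X1 q"
  "frame_X2 (p + q) = frame_X2 p + frame_X2 q"
  by (simp_all add: frame_R_def frame_X1_def frame_X2_def vec_eq_iff forall_4)

lemma frame_scaleR: "frame_R (c *\<^sub>R p) = c *\<^sub>R frame_R p" "frame_X1 (c *\<^sub>R p) = c *\<^sub>R frame_X1 p"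
  "frame_X2 (c *\<^sub>R p) = c *\<^sub>R frame_X2 p"
  by (simp_all add: frame_R_def frame_X1_def frame_X2_def vec_eq_iff forall_4)

text \<open>The multiplication table of the quaternion units: the three frame fields are linear
  complex structures on R^4 that anticommute pairwise.\<close>

lemma frame_frame:
  "frame_R (frame_R p) = - p" "frame_R (frame_X1 p) = frame_X2 p" "frame_R (frame_X2 p) = - frame_X1 p"
  "frame_X1 (frame_R p) = - frame_X2 p" "frame_X1 (frame_X1 p) = - p" "frame_X1 (frame_X2 p) = frame_R p"
  "frame_X2 (frame_R p) = frame_X1 p" "frame_X2 (frame_X1 p) = - frame_R p" "frame_X2 (frame_X2 p) = - p"
  by (simp_all add: frame_R_def frame_X1_def frame_X2_def vec_eq_iff forall_4)

lemma frame_inner: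
  "frame_R p \<bullet> p = 0" "frame_X1 p \<bullet> p = 0" "frame_X2 p \<bullet> p = 0"
  "p \<bullet> frame_R p = 0" "p \<bullet> frame_X1 p = 0" "p \<bullet> frame_X2 p = 0"
  "frame_R p \<bullet> frame_X1 p = 0" "frame_X1 p \<bullet> frame_R p = 0"
  "frame_R p \<bullet> frame_X2 p = 0" "frame_X2 p \<bullet> frame_R p = 0"
  "frame_X1 p \<bullet> frame_X2 p = 0" "frame_X2 p \<bullet> frame_X1 p = 0"
  "frame_R p \<bullet> frame_R p = p \<bullet> p" "frame_X1 p \<bullet> frame_X1 p = p \<bullet> p"
  "frame_X2 p \<bullet> frame_X2 p = p \<bullet> p"
  by (simp_all add: frame_R_def frame_X1_def frame_X2_def inner_4)

text \<open>The point \<open>p\<close> and its three frame vectors are orthogonal and have equal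
  length, so this is the expansion of \<open>u\<close> in an orthogonal basis, cleared of
  denominators.\<close>

lemma frame_expansion_R4:
  "(p \<bullet> p) *\<^sub>R u = (u \<bullet> frame_R p) *\<^sub>R frame_R p + (u \<bullet> frame_X1 p) *\<^sub>R frame_X1 p
     + (u \<bullet> frame_X2 p) *\<^sub>R frame_X2 p + (u \<bullet> p) *\<^sub>R p"
  by (simp add: frame_R_def frame_X1_def frame_X2_def inner_4 vec_eq_iff forall_4) Groebner_Basis.algebra

lemma frame_expansion:
  assumes "p \<in> S3" "u \<bullet> p = 0"
  shows "u = (u \<bullet> frame_R p) *\<^sub>R frame_R p + (u \<bullet> frame_X1 p) *\<^sub>R frame_X1 p
     + (u \<bullet> frame_X2 p) *\<^sub>R frame_X2 p"
  using frame_expansion_R4[of p u] assms(2) S3_inner[OF assms(1)] by simp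

lemma vol_S3_cross: "vol_S3 p u v w = frame_coords p u \<bullet> cross3 (frame_coords p v) (frame_coords p w)"
  by (simp add: vol_S3_def dot_cross_det)

lemma frame_coords_frame:
  assumes "p \<in> S3"
  shows "frame_coords p (frame_R p) = vector [1, 0, 0]" "frame_coords p (frame_X1 p) = vector [0, 1, 0]"
    "frame_coords p (frame_X2 p) = vector [0, 0, 1]"
  using S3_inner[OF assms] by (simp_all add: frame_coords_def frame_inner vec_eq_iff forall_3)

text \<open>An alternating 2-form on a three-dimensional space is determined by its values on the
  three cyclic pairs of a basis; for the contraction of the volume form with \<open>w\<close> these
  values are the frame components of \<open>w\<close>.\<close>

lemma alternating_eq_vol_S3:
  assumes p: "p \<in> S3"
    and add1: "\<And>x y z. \<omega> (x + y) z = \<omega> x z + \<omega> y z" and scale1: "\<And>c x z. \<omega> (c *\<^sub>R x) z = c * \<omega> x z"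
    and alt: "\<And>x y. \<omega> y x = - \<omega> x y"
    and tan: "w \<bullet> p = 0" "u \<bullet> p = 0" "v \<bullet> p = 0"
    and eq: "\<omega> (frame_X1 p) (frame_X2 p) = w \<bullet> frame_R p"
      "\<omega> (frame_X2 p) (frame_R p) = w \<bullet> frame_X1 p"
      "\<omega> (frame_R p) (frame_X1 p) = w \<bullet> frame_X2 p"
  shows "\<omega> u v = vol_S3 p w u v"
proof -
  have add2: "\<omega> z (x + y) = \<omega> z x + \<omega> z y" for x y z using add1 alt by (metis minus_add_distrib)
  have scale2: "\<omega> z (c *\<^sub>R x) = c * \<omega> z x" for c x z using scale1 alt by (metis mult_minus_right)
  have self: "\<omega> x x = 0" for x using alt[of x x] by simp
  have eq': "\<omega> (frame_X2 p) (frame_X1 p) = - (w \<bullet> frame_R p)"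
      "\<omega> (frame_R p) (frame_X2 p) = - (w \<bullet> frame_X1 p)"
      "\<omega> (frame_X1 p) (frame_R p) = - (w \<bullet> frame_X2 p)"
    using eq alt by metis+
  define u1 u2 u3 v1 v2 v3 where "u1 = u \<bullet> frame_R p" and "u2 = u \<bullet> frame_X1 p" and "u3 = u \<bullet> frame_X2 p"
    and "v1 = v \<bullet> frame_R p" and "v2 = v \<bullet> frame_X1 p" and "v3 = v \<bullet> frame_X2 p"
  note d = u1_def u2_def u3_def v1_def v2_def v3_def
  have "\<omega> u v = \<omega> (u1 *\<^sub>R frame_R p + u2 *\<^sub>R frame_X1 p + u3 *\<^sub>R frame_X2 p)
      (v1 *\<^sub>R frame_R p + v2 *\<^sub>R frame_X1 p + v3 *\<^sub>R frame_X2 p)"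
    using frame_expansion[OF p tan(2)] frame_expansion[OF p tan(3)] by (simp flip: d)
  also have "\<dots> = vol_S3 p w u v"
    by (simp add: add1 add2 scale1 scale2 self eq eq' vol_S3_cross frame_coords_def inner_3 cross3_def
        flip: d) (simp add: algebra_simps)
  finally show ?thesis .
qed

lemma vol_S3_frame:
  assumes "p \<in> S3"
  shows "vol_S3 p w (frame_X1 p) (frame_X2 p) = w \<bullet> frame_R p"
    "vol_S3 p w (frame_X2 p) (frame_R p) = w \<bullet> frame_X1 p"
    "vol_S3 p w (frame_R p) (frame_X1 p) = w \<bullet> frame_X2 p"
  by (simp_all add: vol_S3_cross frame_coords_frame[OF assms] inner_3 cross3_def)
    (simp_all add: frame_coords_def)

lemma frame_tangent [simp]:
  "frame_R p \<in> tangent_S3 p" "frame_X1 p \<in> tangent_S3 p" "frame_X2 p \<in> tangent_S3 p"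
  by (simp_all add: tangent_S3_def frame_inner)

lemma curl_S3_unique:
  assumes p: "p \<in> S3" and w: "w \<in> tangent_S3 p"
    "\<And>u v. u \<in> tangent_S3 p \<Longrightarrow> v \<in> tangent_S3 p \<Longrightarrow> vol_S3 p w u v = ext_deriv (flat V) p u v"
  shows "curl_S3 V p = w"
  unfolding curl_S3_def
proof (rule the_equality)
  fix z assume z: "z \<in> tangent_S3 p \<and>
    (\<forall>u\<in>tangent_S3 p. \<forall>v\<in>tangent_S3 p. vol_S3 p z u v = ext_deriv (flat V) p u v)"
  then have "vol_S3 p z u v = vol_S3 p w u v" if "u \<in> tangent_S3 p" "v \<in> tangent_S3 p" for u v
    using w that by simp
  then have "z \<bullet> frame_R p = w \<bullet> frame_R p" "z \<bullet> frame_X1 p = w \<bullet> frame_X1 p"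
    "z \<bullet> frame_X2 p = w \<bullet> frame_X2 p"
    using vol_S3_frame[OF p] frame_tangent by metis+
  then show "z = w"
    using frame_expansion[OF p, of z] frame_expansion[OF p, of w] z w(1) by (simp add: tangent_S3_def)
qed (use w in auto)

text \<open>Turns the definite description of the curl into three scalar equations for the
  derivative of an arbitrary extension.\<close>

lemma curl_S3_frame:
  assumes p: "p \<in> S3" and F: "(F has_derivative F') (at p)" "\<And>x. x \<in> S3 \<Longrightarrow> F x = V x"
    and w: "w \<bullet> p = 0"
      "F' (frame_X1 p) \<bullet> frame_X2 p - F' (frame_X2 p) \<bullet> frame_X1 p = w \<bullet> frame_R p"
      "F' (frame_X2 p) \<bullet> frame_R p - F' (frame_R p) \<bullet> frame_X2 p = w \<bullet> frame_X1 p"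
      "F' (frame_R p) \<bullet> frame_X1 p - F' (frame_X1 p) \<bullet> frame_R p = w \<bullet> frame_X2 p"
  shows "curl_S3 V p = w"
proof (rule curl_S3_unique[OF p])
  show "w \<in> tangent_S3 p" using w by (simp add: tangent_S3_def)
  interpret linear F' using F(1) by (rule has_derivative_linear)
  fix u v assume "u \<in> tangent_S3 p" "v \<in> tangent_S3 p"
  then have uv: "u \<bullet> p = 0" "v \<bullet> p = 0" by (auto simp: tangent_S3_def)
  have "F' u \<bullet> v - F' v \<bullet> u = vol_S3 p w u v"
    by (rule alternating_eq_vol_S3[OF p, where \<omega> = "\<lambda>u v. F' u \<bullet> v - F' v \<bullet> u"])
      (use w uv in \<open>auto simp: add scale inner_add_left inner_add_right algebra_simps\<close>)
  then show "vol_S3 p w u v = ext_deriv (flat V) p u v"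
    using ext_deriv_flat_eq[OF p uv F] by simp
qed

text \<open>Every 2-form on an oriented three-dimensional space is a contraction of the volume form,
  so the description in \<open>curl_S3\<close> denotes wherever an extension is differentiable. The
  witness \<open>w\<close> has the values of the 2-form on the cyclic frame pairs as
  components.\<close>

lemma ext_deriv_flat_curl:
  assumes p: "p \<in> S3" and F: "(F has_derivative F') (at p)" "\<And>x. x \<in> S3 \<Longrightarrow> F x = V x"
    and uv: "u \<bullet> p = 0" "v \<bullet> p = 0"
  shows "F' u \<bullet> v - F' v \<bullet> u = vol_S3 p (curl_S3 V p) u v"
proof -
  define c where "c = (\<lambda>u v. F' u \<bullet> v - F' v \<bullet> u)"
  define w where "w = c (frame_X1 p) (frame_X2 p) *\<^sub>R frame_R p + c (frame_X2 p) (frame_R p) *\<^sub>R frame_X1 p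
    + c (frame_R p) (frame_X1 p) *\<^sub>R frame_X2 p"
  have w: "w \<bullet> p = 0" "c (frame_X1 p) (frame_X2 p) = w \<bullet> frame_R p"
      "c (frame_X2 p) (frame_R p) = w \<bullet> frame_X1 p" "c (frame_R p) (frame_X1 p) = w \<bullet> frame_X2 p"
    using S3_inner[OF p] by (simp_all add: w_def inner_add_left frame_inner)
  have "curl_S3 V p = w"
    using w by (intro curl_S3_frame[OF p F]) (simp_all add: c_def)
  moreover interpret linear F' using F(1) by (rule has_derivative_linear)
  have "c u v = vol_S3 p w u v"
    by (rule alternating_eq_vol_S3[OF p, where \<omega> = c])
      (use w uv in \<open>auto simp: c_def add scale inner_add_left inner_add_right algebra_simps\<close>)
  ultimately show ?thesis by (simp add: c_def)
qed

section \<open>Spherical averages of curl eigenfields\<close>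

lemma continuous_on_curry3:
  assumes "continuous_on UNIV (\<lambda>(x, y, z). f x y z)"
    "continuous_on A u" "continuous_on A v" "continuous_on A w"
  shows "continuous_on A (\<lambda>t. f (u t) (v t) (w t))"
proof -
  have "continuous_on A (\<lambda>t. (\<lambda>(x, y, z). f x y z) (u t, v t, w t))"
    by (rule continuous_on_compose2[OF assms(1)]) (auto intro!: continuous_intros assms)
  then show ?thesis by simp
qed

lemma continuous_on_curry2:
  assumes "continuous_on UNIV (\<lambda>(x, y). f x y)" "continuous_on A u" "continuous_on A v"
  shows "continuous_on A (\<lambda>t. f (u t) (v t))"
proof -
  have "continuous_on A (\<lambda>t. (\<lambda>(x, y). f x y) (u t, v t))"
    by (rule continuous_on_compose2[OF assms(1)]) (auto intro!: continuous_intros assms)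
  then show ?thesis by simp
qed

lemma continuous_on_integral_param:
  fixes f :: "'a::topological_space \<Rightarrow> real \<Rightarrow> real"
  assumes "continuous_on UNIV (\<lambda>(x, t). f x t)"
  shows "continuous_on UNIV (\<lambda>x. integral {c..d} (f x))"
  using integral_continuous_on_param[of UNIV c d f] continuous_on_subset[OF assms subset_UNIV] by simp

lemma continuous_on_integral_param2:
  fixes f :: "'a::topological_space \<Rightarrow> 'b::topological_space \<Rightarrow> real \<Rightarrow> real"
  assumes "continuous_on UNIV (\<lambda>(x, y, t). f x y t)"
  shows "continuous_on UNIV (\<lambda>(x, y). integral {c..d} (f x y))"
proof -
  have "continuous_on UNIV (\<lambda>(z, t). f (fst z) (snd z) t)"
    unfolding case_prod_unfold by (intro continuous_on_curry3[OF assms] continuous_intros)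
  from continuous_on_integral_param[OF this] show ?thesis by (simp add: case_prod_unfold)
qed

lemma DERIV_integral_param:
  fixes f :: "real \<Rightarrow> real \<Rightarrow> real"
  assumes d: "\<And>x t. ((\<lambda>x. f x t) has_real_derivative f' x t) (at x)"
    and c: "continuous_on UNIV (\<lambda>(x, t). f x t)" and c': "continuous_on UNIV (\<lambda>(x, t). f' x t)"
  shows "((\<lambda>x. integral {a..b} (f x)) has_real_derivative integral {a..b} (f' x)) (at x)"
proof -
  have "f x integrable_on cbox a b" for x
    by (intro integrable_continuous continuous_on_curry2[OF c, of _ "\<lambda>_. x" "\<lambda>t. t"] continuous_intros)
  then show ?thesis
    using leibniz_rule_field_derivative[of UNIV a b f f' x] d continuous_on_subset[OF c' subset_UNIV]
    by simp
qed

lemma integral_DERIV: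
  fixes g :: "real \<Rightarrow> real"
  assumes "a \<le> b" "\<And>t. (g has_real_derivative g' t) (at t)"
  shows "integral {a..b} g' = g b - g a"
  by (rule integral_unique, rule fundamental_theorem_of_calculus[OF assms(1)])
    (use assms(2) in \<open>auto simp: has_real_derivative_iff_has_vector_derivative
      intro: has_vector_derivative_at_within\<close>)

lemma integral_add_cont:
  fixes f g :: "real \<Rightarrow> real"
  assumes "continuous_on UNIV f" "continuous_on UNIV g"
  shows "integral {a..b} (\<lambda>x. f x + g x) = integral {a..b} f + integral {a..b} g"
  by (intro integral_add integrable_continuous_real continuous_on_subset[OF assms(1)]
      continuous_on_subset[OF assms(2)]) auto

lemma integral_diff_cont:
  fixes f g :: "real \<Rightarrow> real"
  assumes "continuous_on UNIV f" "continuous_on UNIV g"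
  shows "integral {a..b} (\<lambda>x. f x - g x) = integral {a..b} f - integral {a..b} g"
  by (intro integral_diff integrable_continuous_real continuous_on_subset[OF assms(1)]
      continuous_on_subset[OF assms(2)]) auto

text \<open>With \<open>m = cos r * a r - b r\<close>, the mean of a Cartesian component of the field over the geodesic
  sphere of radius \<open>r\<close>, the equations say that \<open>sin r * m\<close> solves the oscillator equation
  with frequency \<open>lam\<close>.\<close>

lemma oscillator_between_poles:
  fixes a b B C :: "real \<Rightarrow> real"
  assumes lam: "lam \<noteq> 0"
    and ca: "continuous_on UNIV a" and cb: "continuous_on UNIV b"
    and B: "\<And>r. B r = sin r * b r" and C: "\<And>r. C r = lam * (sin r)\<^sup>2 * a r"
    and dB: "\<And>r. (B has_real_derivative lam * C r - 2 * a r) (at r)"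
    and dC: "\<And>r. (C has_real_derivative - lam * B r) (at r)"
  shows "(a pi + b pi) * sin (lam * pi) = 0 \<and> (a pi + b pi) * cos (lam * pi) = a 0 - b 0"
proof -
  \<comment> \<open>\<open>S\<close> is \<open>sin r\<close> times the mean, and \<open>W\<close> is
    its derivative in closed form. Since \<open>a\<close> and \<open>b\<close> are only known to be
    continuous, both are rewritten through the differentiable \<open>B\<close> and \<open>C\<close>
    on the open interval before differentiating.\<close>
  define S where "S = (\<lambda>r. sin r * (cos r * a r - b r))"
  define W where "W = (\<lambda>r. a r - cos r * b r - lam * C r)"
  have sin0: "sin r \<noteq> 0" if "r \<in> {0<..<pi}" for r using sin_gt_zero that by force
  have a_eq: "a r = C r / (lam * (sin r)\<^sup>2)" and b_eq: "b r = B r / sin r" if "r \<in> {0<..<pi}" for r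
    using sin0[OF that] lam by (simp_all add: B C)
  have dS: "(S has_real_derivative W r) (at r)" if r: "r \<in> {0<..<pi}" for r
  proof -
    have "((\<lambda>r. cos r * C r / (lam * sin r) - B r) has_real_derivative
        ((- sin r * C r + cos r * (- lam * B r)) * (lam * sin r) - cos r * C r * (lam * cos r)) / (lam * sin r)\<^sup>2
          - (lam * C r - 2 * a r)) (at r)"
      using sin0[OF r] lam
      by (auto intro!: derivative_eq_intros dB dC simp: power2_eq_square)
    moreover have "((- sin r * C r + cos r * (- lam * B r)) * (lam * sin r) - cos r * C r * (lam * cos r)) / (lam * sin r)\<^sup>2
          - (lam * C r - 2 * a r) = W r"
    proof -
      have alg: "(- s * x + c * (- l * y)) * (l * s) - c * x * (l * c)
        = - l * x * (s\<^sup>2 + c\<^sup>2) - l\<^sup>2 * s * c * y" for s c x y l :: real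
        by (simp add: algebra_simps power2_eq_square)
      have "(- sin r * C r + cos r * (- lam * B r)) * (lam * sin r) - cos r * C r * (lam * cos r)
        = - lam * C r * ((sin r)\<^sup>2 + (cos r)\<^sup>2) - lam\<^sup>2 * sin r * cos r * B r"
        by (rule alg)
      also have "\<dots> = (lam * sin r)\<^sup>2 * (- a r - cos r * b r)"
        by (simp add: B C algebra_simps power2_eq_square)
      finally show ?thesis using sin0[OF r] lam by (simp add: W_def)
    qed
    ultimately have "((\<lambda>r. cos r * C r / (lam * sin r) - B r) has_real_derivative W r) (at r)" by simp
    then show ?thesis
      by (rule has_field_derivative_transform_within_open[of _ _ _ "{0<..<pi}"])
        (use r sin0 lam in \<open>auto simp: S_def a_eq b_eq field_simps power2_eq_square\<close>)
  qed
  have dW: "(W has_real_derivative - lam\<^sup>2 * S r) (at r)" if r: "r \<in> {0<..<pi}" for r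
  proof -
    have "((\<lambda>r. C r / (lam * (sin r)\<^sup>2) - cos r * B r / sin r - lam * C r) has_real_derivative
        ((- lam * B r) * (lam * (sin r)\<^sup>2) - C r * (lam * (2 * sin r * cos r))) / (lam * (sin r)\<^sup>2)\<^sup>2
         - ((- sin r * B r + cos r * (lam * C r - 2 * a r)) * sin r - cos r * B r * cos r) / (sin r)\<^sup>2
         - lam * (- lam * B r)) (at r)"
      using sin0[OF r] lam
      by (auto intro!: derivative_eq_intros dB dC simp: power2_eq_square mult_ac)
    moreover have "((- lam * B r) * (lam * (sin r)\<^sup>2) - C r * (lam * (2 * sin r * cos r))) / (lam * (sin r)\<^sup>2)\<^sup>2
         - ((- sin r * B r + cos r * (lam * C r - 2 * a r)) * sin r - cos r * B r * cos r) / (sin r)\<^sup>2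
         - lam * (- lam * B r) = - lam\<^sup>2 * S r"
    proof -
      have 1: "((- lam * B r) * (lam * (sin r)\<^sup>2) - C r * (lam * (2 * sin r * cos r))) / (lam * (sin r)\<^sup>2)\<^sup>2
        = - b r / sin r - 2 * cos r * a r / sin r"
        using sin0[OF r] lam by (simp add: B C field_simps power2_eq_square)
      have alg: "(- s * x + c * y) * s - c * x * c = - x * (s\<^sup>2 + c\<^sup>2) + s * c * y" for s c x y :: real
        by (simp add: algebra_simps power2_eq_square)
      have "(- sin r * B r + cos r * (lam * C r - 2 * a r)) * sin r - cos r * B r * cos r
        = - B r * ((sin r)\<^sup>2 + (cos r)\<^sup>2) + sin r * cos r * (lam * C r - 2 * a r)"
        by (rule alg)
      also have "\<dots> = (sin r)\<^sup>2 * (- b r / sin r + cos r * (lam * C r - 2 * a r) / sin r)"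
        using sin0[OF r] by (simp add: B field_simps power2_eq_square)
      finally have 2: "((- sin r * B r + cos r * (lam * C r - 2 * a r)) * sin r - cos r * B r * cos r) / (sin r)\<^sup>2
        = - b r / sin r + cos r * (lam * C r - 2 * a r) / sin r"
        using sin0[OF r] by simp
      show ?thesis unfolding 1 2 using sin0[OF r] by (simp add: B C S_def field_simps power2_eq_square)
    qed
    ultimately have "((\<lambda>r. C r / (lam * (sin r)\<^sup>2) - cos r * B r / sin r - lam * C r)
      has_real_derivative - lam\<^sup>2 * S r) (at r)" by simp
    then show ?thesis
      by (rule has_field_derivative_transform_within_open[of _ _ _ "{0<..<pi}"])
        (use r sin0 lam in \<open>auto simp: W_def a_eq b_eq field_simps power2_eq_square\<close>)
  qed
  have C_eq: "C = (\<lambda>r. lam * (sin r)\<^sup>2 * a r)" using C by auto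
  have cont: "continuous_on {0..pi} S" "continuous_on {0..pi} W"
    unfolding S_def W_def C_eq
    by (intro continuous_intros continuous_on_subset[OF ca subset_UNIV] continuous_on_subset[OF cb subset_UNIV])+
  \<comment> \<open>The vector with coordinates \<open>lam * S r\<close> and \<open>W r\<close>
    turns with angular speed \<open>lam\<close>, and \<open>P\<close>, \<open>Q\<close> are its
    coordinates in the co-rotating frame, hence constant. At both ends \<open>S\<close> vanishes,
    while \<open>W\<close> is \<open>a 0 - b 0\<close> at 0 and \<open>a pi + b pi\<close> at
    \<open>pi\<close>.\<close>
  define P where "P = (\<lambda>r. lam * S r * cos (lam * r) - W r * sin (lam * r))"
  define Q where "Q = (\<lambda>r. lam * S r * sin (lam * r) + W r * cos (lam * r))"
  have "P pi = P 0"
  proof (rule DERIV_isconst_end[of 0 pi P])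
    show "DERIV P r :> 0" if "0 < r" "r < pi" for r
      unfolding P_def using dS[of r] dW[of r] that
      by (auto intro!: derivative_eq_intros simp: power2_eq_square algebra_simps)
  qed (auto simp: P_def intro!: continuous_intros cont)
  moreover have "Q pi = Q 0"
  proof (rule DERIV_isconst_end[of 0 pi Q])
    show "DERIV Q r :> 0" if "0 < r" "r < pi" for r
      unfolding Q_def using dS[of r] dW[of r] that
      by (auto intro!: derivative_eq_intros simp: power2_eq_square algebra_simps)
  qed (auto simp: Q_def intro!: continuous_intros cont)
  ultimately show ?thesis
    by (simp_all add: P_def Q_def S_def W_def C)
qed

text \<open>The form with components \<open>vr\<close>, \<open>sin r * vt\<close>, \<open>sin r * sin t * vb\<close> in geodesic polar coordinates
  \<open>r\<close>, \<open>t\<close> (polar angle), \<open>z\<close> (azimuth), subject to the eigenvalue equation of the curl.\<close>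

lemma polar_eigenform:
  fixes vr vt vb :: "real \<Rightarrow> real \<Rightarrow> real \<Rightarrow> real"
  assumes lam: "lam \<noteq> 0"
    and c: "continuous_on UNIV (\<lambda>(r, t, z). vr r t z)" "continuous_on UNIV (\<lambda>(r, t, z). vt r t z)"
      "continuous_on UNIV (\<lambda>(r, t, z). vb r t z)"
    and d: "\<And>r t z. ((\<lambda>r. sin r * vt r t z) has_real_derivative at_r r t z) (at r)"
      "\<And>r t z. ((\<lambda>t. vr r t z) has_real_derivative ar_t r t z) (at t)"
      "\<And>r t z. ((\<lambda>r. sin r * sin t * vb r t z) has_real_derivative ab_r r t z) (at r)"
      "\<And>r t z. ((\<lambda>z. vr r t z) has_real_derivative ar_b r t z) (at z)"
      "\<And>r t z. ((\<lambda>t. sin r * sin t * vb r t z) has_real_derivative ab_t r t z) (at t)"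
      "\<And>r t z. ((\<lambda>z. sin r * vt r t z) has_real_derivative at_b r t z) (at z)"
    and cd: "continuous_on UNIV (\<lambda>(r, t, z). at_r r t z)" "continuous_on UNIV (\<lambda>(r, t, z). ar_t r t z)"
      "continuous_on UNIV (\<lambda>(r, t, z). ab_r r t z)" "continuous_on UNIV (\<lambda>(r, t, z). ar_b r t z)"
      "continuous_on UNIV (\<lambda>(r, t, z). ab_t r t z)" "continuous_on UNIV (\<lambda>(r, t, z). at_b r t z)"
    and eq: "\<And>r t z. ab_t r t z - at_b r t z = lam * (sin r)\<^sup>2 * sin t * vr r t z"
      "\<And>r t z. ar_b r t z - ab_r r t z = lam * sin r * sin t * vt r t z"
      "\<And>r t z. at_r r t z - ar_t r t z = lam * sin r * vb r t z"
    and per: "\<And>r t. vr r t (2 * pi) = vr r t 0" "\<And>r t. vt r t (2 * pi) = vt r t 0"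
  defines "a \<equiv> \<lambda>r. integral {0..pi} (\<lambda>t. sin t * cos t * integral {0..2*pi} (vr r t))"
    and "b \<equiv> \<lambda>r. integral {0..pi} (\<lambda>t. (sin t)\<^sup>2 * integral {0..2*pi} (vt r t))"
  shows "(a pi + b pi) * sin (lam * pi) = 0 \<and> (a pi + b pi) * cos (lam * pi) = a 0 - b 0"
proof -
  define Vr Vt Vb where "Vr = (\<lambda>r t. integral {0..2*pi} (vr r t))"
    and "Vt = (\<lambda>r t. integral {0..2*pi} (vt r t))" and "Vb = (\<lambda>r t. integral {0..2*pi} (vb r t))"
  note V_def = Vr_def Vt_def Vb_def
  have cV: "continuous_on UNIV (\<lambda>(r, t). Vr r t)" "continuous_on UNIV (\<lambda>(r, t). Vt r t)"
    "continuous_on UNIV (\<lambda>(r, t). Vb r t)"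
    unfolding V_def by (intro continuous_on_integral_param2 c)+
  note cV' = cV[THEN continuous_on_curry2]
  note c' = c[THEN continuous_on_curry3] and cd' = cd[THEN continuous_on_curry3]
  \<comment> \<open>Periodicity in the azimuth removes the terms that are derivatives in
    \<open>z\<close>; equations in \<open>r\<close> and \<open>t\<close> remain.\<close>
  have zero: "integral {0..2*pi} (ar_b r t) = 0" "integral {0..2*pi} (at_b r t) = 0" for r t
    using integral_DERIV[OF _ d(4), of 0 "2*pi" r t] integral_DERIV[OF _ d(6), of 0 "2*pi" r t] per
    by simp_all
  have dT: "((\<lambda>t. sin r * sin t * Vb r t) has_real_derivative lam * (sin r)\<^sup>2 * sin t * Vr r t) (at t)" for r t
  proof -
    have "((\<lambda>t. integral {0..2*pi} (\<lambda>z. sin r * sin t * vb r t z)) has_real_derivative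
       integral {0..2*pi} (ab_t r t)) (at t)"
      unfolding case_prod_unfold
      by (rule DERIV_integral_param[OF d(5)])
        (unfold case_prod_unfold, (intro continuous_intros c' cd')+)
    moreover have "integral {0..2*pi} (ab_t r t) =
       integral {0..2*pi} (\<lambda>z. at_b r t z + lam * (sin r)\<^sup>2 * sin t * vr r t z)"
      using eq(1) by (intro integral_cong) (simp add: algebra_simps)
    moreover have "\<dots> = integral {0..2*pi} (at_b r t) + lam * (sin r)\<^sup>2 * sin t * Vr r t"
      unfolding V_def
      by (subst integral_add_cont) (auto intro!: continuous_intros c' cd')
    ultimately show ?thesis by (simp add: V_def zero)
  qed
  have dR: "((\<lambda>r. sin r * sin t * Vb r t) has_real_derivative - lam * sin r * sin t * Vt r t) (at r)" for r t
  proof -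
    have "((\<lambda>r. integral {0..2*pi} (\<lambda>z. sin r * sin t * vb r t z)) has_real_derivative
       integral {0..2*pi} (ab_r r t)) (at r)"
      by (rule DERIV_integral_param[OF d(3)])
        (unfold case_prod_unfold, (intro continuous_intros c' cd')+)
    moreover have "integral {0..2*pi} (ab_r r t) =
       integral {0..2*pi} (\<lambda>z. ar_b r t z - lam * sin r * sin t * vt r t z)"
      using eq(2)[of r t] by (intro integral_cong) (simp add: algebra_simps)
    moreover have "\<dots> = integral {0..2*pi} (ar_b r t) - lam * sin r * sin t * Vt r t"
      unfolding V_def
      by (subst integral_diff_cont) (auto intro!: continuous_intros c' cd')
    ultimately show ?thesis by (simp add: V_def zero)
  qed
  define At_r where "At_r = (\<lambda>r t. integral {0..2*pi} (at_r r t))"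
  define Ar_t where "Ar_t = (\<lambda>r t. integral {0..2*pi} (ar_t r t))"
  have cA: "continuous_on UNIV (\<lambda>(r, t). At_r r t)" "continuous_on UNIV (\<lambda>(r, t). Ar_t r t)"
    unfolding At_r_def Ar_t_def by (intro continuous_on_integral_param2 cd)+
  note cA' = cA[THEN continuous_on_curry2]
  have dVt: "((\<lambda>r. sin r * Vt r t) has_real_derivative At_r r t) (at r)" for r t
  proof -
    have "((\<lambda>r. integral {0..2*pi} (\<lambda>z. sin r * vt r t z)) has_real_derivative At_r r t) (at r)"
      unfolding At_r_def
      by (rule DERIV_integral_param[OF d(1)])
        (unfold case_prod_unfold, (intro continuous_intros c' cd')+)
    then show ?thesis by (simp add: V_def)
  qed
  have dVr: "((\<lambda>t. Vr r t) has_real_derivative Ar_t r t) (at t)" for r t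
    unfolding At_r_def Ar_t_def V_def
    by (rule DERIV_integral_param[OF d(2)])
      (unfold case_prod_unfold, (intro continuous_intros c' cd')+)
  have At_r: "At_r r t = Ar_t r t + lam * sin r * Vb r t" for r t
  proof -
    have "At_r r t = integral {0..2*pi} (\<lambda>z. ar_t r t z + lam * sin r * vb r t z)"
      unfolding At_r_def using eq(3) by (intro integral_cong) (simp add: algebra_simps)
    also have "\<dots> = Ar_t r t + lam * sin r * Vb r t"
      unfolding V_def Ar_t_def
      by (subst integral_add_cont) (auto intro!: continuous_intros c' cd')
    finally show ?thesis .
  qed
  \<comment> \<open>These weights allow the polar angle to be integrated out by parts. The outcome
    is a closed first-order system: \<open>B\<close> is \<open>sin r\<close> times \<open>b\<close>,
    \<open>C\<close> is a multiple of \<open>a\<close>, and their derivatives involve only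
    \<open>a\<close>, \<open>B\<close> and \<open>C\<close>.\<close>
  define B where "B = (\<lambda>r. integral {0..pi} (\<lambda>t. (sin t)\<^sup>2 * (sin r * Vt r t)))"
  define C where "C = (\<lambda>r. integral {0..pi} (\<lambda>t. sin t * (sin r * sin t * Vb r t)))"
  have a: "a = (\<lambda>r. integral {0..pi} (\<lambda>t. sin t * cos t * Vr r t))"
    and b: "b = (\<lambda>r. integral {0..pi} (\<lambda>t. (sin t)\<^sup>2 * Vt r t))"
    by (simp_all add: a_def b_def V_def)
  have B_eq: "B r = sin r * b r" for r
    by (simp add: B_def b mult.left_commute flip: integral_mult_right)
  have C_eq: "C r = lam * (sin r)\<^sup>2 * a r" for r
  proof -
    \<comment> \<open>The integrand is the derivative of
      \<open>cos t * (sin r * sin t * Vb r t)\<close>, which vanishes at both ends.\<close>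
    have "integral {0..pi} (\<lambda>t. - sin t * (sin r * sin t * Vb r t) + cos t * (lam * (sin r)\<^sup>2 * sin t * Vr r t))
       = cos pi * (sin r * sin pi * Vb r pi) - cos 0 * (sin r * sin 0 * Vb r 0)"
      by (rule integral_DERIV, simp, rule DERIV_cong[OF DERIV_mult[OF DERIV_cos dT]]) simp
    also have "\<dots> = 0" by simp
    also have "integral {0..pi} (\<lambda>t. - sin t * (sin r * sin t * Vb r t) + cos t * (lam * (sin r)\<^sup>2 * sin t * Vr r t))
      = integral {0..pi} (\<lambda>t. - sin t * (sin r * sin t * Vb r t)) + integral {0..pi} (\<lambda>t. (lam * (sin r)\<^sup>2) * (sin t * cos t * Vr r t))"
      by (subst integral_add_cont[symmetric]) (auto intro!: continuous_intros cV' simp: mult_ac)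
    also have "\<dots> = - C r + lam * (sin r)\<^sup>2 * a r"
      by (simp add: C_def a)
    finally show ?thesis by simp
  qed
  have dC: "(C has_real_derivative - lam * B r) (at r)" for r
  proof -
    have "(C has_real_derivative integral {0..pi} (\<lambda>t. sin t * (- lam * sin r * sin t * Vt r t))) (at r)"
      unfolding C_def
    proof (rule DERIV_integral_param)
      show "((\<lambda>r. sin t * (sin r * sin t * Vb r t)) has_real_derivative
          sin t * (- lam * sin r * sin t * Vt r t)) (at r)" for r t
        by (intro DERIV_cmult dR)
    qed (unfold case_prod_unfold, (intro continuous_intros cV')+)
    moreover have "integral {0..pi} (\<lambda>t. sin t * (- lam * sin r * sin t * Vt r t)) = - lam * B r"
      unfolding B_def by (simp add: power2_eq_square mult_ac flip: integral_mult_right)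
    ultimately show ?thesis by simp
  qed
  have dB: "(B has_real_derivative lam * C r - 2 * a r) (at r)" for r
  proof -
    have "(B has_real_derivative integral {0..pi} (\<lambda>t. (sin t)\<^sup>2 * At_r r t)) (at r)"
      unfolding B_def
    proof (rule DERIV_integral_param)
      show "((\<lambda>r. (sin t)\<^sup>2 * (sin r * Vt r t)) has_real_derivative (sin t)\<^sup>2 * At_r r t) (at r)" for r t
        by (intro DERIV_cmult dVt)
    qed (unfold case_prod_unfold, (intro continuous_intros cV' cA')+)
    moreover have "integral {0..pi} (\<lambda>t. (sin t)\<^sup>2 * At_r r t) = lam * C r - 2 * a r"
    proof -
      \<comment> \<open>The integrand is the derivative of \<open>(sin t)\<^sup>2 * Vr r t\<close>;
        this is the source of the term \<open>- 2 * a r\<close>.\<close>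
      have "integral {0..pi} (\<lambda>t. 2 * sin t * cos t * Vr r t + (sin t)\<^sup>2 * Ar_t r t)
         = (sin pi)\<^sup>2 * Vr r pi - (sin 0)\<^sup>2 * Vr r 0"
        by (rule integral_DERIV) (auto intro!: derivative_eq_intros dVr simp: power2_eq_square)
      also have "\<dots> = 0" by simp
      finally have 1: "integral {0..pi} (\<lambda>t. 2 * (sin t * cos t * Vr r t)) + integral {0..pi} (\<lambda>t. (sin t)\<^sup>2 * Ar_t r t) = 0"
        by (subst integral_add_cont[symmetric]) (auto intro!: continuous_intros cV' cA' simp: mult_ac)
      have "integral {0..pi} (\<lambda>t. (sin t)\<^sup>2 * At_r r t)
         = integral {0..pi} (\<lambda>t. (sin t)\<^sup>2 * Ar_t r t + lam * (sin t * (sin r * sin t * Vb r t)))"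
        by (intro integral_cong) (simp add: At_r algebra_simps power2_eq_square)
      also have "\<dots> = integral {0..pi} (\<lambda>t. (sin t)\<^sup>2 * Ar_t r t) + lam * C r"
        unfolding C_def by (subst integral_add_cont) (auto intro!: continuous_intros cV' cA')
      finally show ?thesis using 1 by (simp add: a)
    qed
    ultimately show ?thesis by simp
  qed
  have cab: "continuous_on UNIV a" "continuous_on UNIV b"
    unfolding a b
    by (intro continuous_on_integral_param; unfold case_prod_unfold; intro continuous_intros cV')+
  show ?thesis
    using oscillator_between_poles[OF lam cab B_eq C_eq dB dC] by auto
qed


section \<open>Geodesic polar coordinates and the values of an eigenfield at antipodal
  points\<close>

lemma DERIV_inner_along_curve:
  fixes G :: "'a::real_normed_vector \<Rightarrow> 'b::real_inner"
  assumes "(c has_vector_derivative c') (at t)" "(G has_derivative D) (at (c t))"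
    "(w has_vector_derivative w') (at t)"
  shows "((\<lambda>t. G (c t) \<bullet> w t) has_real_derivative D c' \<bullet> w t + G (c t) \<bullet> w') (at t)"
proof -
  interpret linear D using assms(2) by (rule has_derivative_linear)
  have "((\<lambda>t. G (c t)) has_derivative (\<lambda>h. D (h *\<^sub>R c'))) (at t)"
    using has_derivative_compose[OF assms(1)[unfolded has_vector_derivative_def] assms(2)] .
  from has_derivative_inner[OF this assms(3)[unfolded has_vector_derivative_def]]
  show ?thesis
    by (auto simp: has_field_derivative_def scale algebra_simps elim!: has_derivative_eq_rhs)
qed

lemma frame_coords_inner:
  assumes "p \<in> S3" "w \<bullet> p = 0"
  shows "frame_coords p w \<bullet> frame_coords p z = w \<bullet> z"
proof -
  have "w \<bullet> z = ((w \<bullet> frame_R p) *\<^sub>R frame_R p + (w \<bullet> frame_X1 p) *\<^sub>R frame_X1 p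
     + (w \<bullet> frame_X2 p) *\<^sub>R frame_X2 p) \<bullet> z"
    using frame_expansion[OF assms] by simp
  then have "w \<bullet> z = (w \<bullet> frame_R p) * (frame_R p \<bullet> z) + (w \<bullet> frame_X1 p) * (frame_X1 p \<bullet> z)
     + (w \<bullet> frame_X2 p) * (frame_X2 p \<bullet> z)"
    by (simp only: inner_add_left inner_scaleR_left)
  then show ?thesis
    unfolding inner_3 frame_coords_def vector_3 by (simp only: inner_commute[of z])
qed

lemma vol_S3_cyclic: "vol_S3 p u v w = vol_S3 p v w u"
  unfolding vol_S3_cross inner_3 cross3_def by (simp add: algebra_simps)

lemma vol_S3_scale:
  "vol_S3 p (c *\<^sub>R u) v w = c * vol_S3 p u v w"
  "vol_S3 p u (c *\<^sub>R v) w = c * vol_S3 p u v w"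
  "vol_S3 p u v (c *\<^sub>R w) = c * vol_S3 p u v w"
  unfolding vol_S3_cross inner_3 cross3_def frame_coords_def by (simp_all add: algebra_simps)

text \<open>The cross product of the orthonormal \<open>b\<close> and \<open>c\<close> has length 1
  and inner product 1 with the unit vector \<open>a\<close>, so it equals \<open>a\<close> by the
  equality case of Cauchy-Schwarz.\<close>

lemma vol_S3_orthonormal:
  assumes p: "p \<in> S3" and tan: "w \<bullet> p = 0" "a \<bullet> p = 0" "b \<bullet> p = 0" "c \<bullet> p = 0"
    and on: "a \<bullet> a = 1" "b \<bullet> b = 1" "c \<bullet> c = 1" "b \<bullet> c = 0" and vol: "vol_S3 p a b c = 1"
  shows "vol_S3 p w b c = w \<bullet> a"
proof -
  let ?a = "frame_coords p a" and ?b = "frame_coords p b" and ?c = "frame_coords p c"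
  have "(norm (cross3 ?b ?c))\<^sup>2 = 1"
    using norm_cross_dot[of ?b ?c] on frame_coords_inner[OF p tan(3)] frame_coords_inner[OF p tan(4)]
    by (simp add: power_mult_distrib power2_norm_eq_inner)
  then have "(?a - cross3 ?b ?c) \<bullet> (?a - cross3 ?b ?c) = 0"
    using vol on frame_coords_inner[OF p tan(2)]
    by (simp add: vol_S3_cross inner_diff_left inner_diff_right inner_commute power2_norm_eq_inner)
  then have "?a = cross3 ?b ?c" by simp
  then show ?thesis
    using frame_coords_inner[OF p tan(1)] by (metis vol_S3_cross)
qed

lemma integral_first_harmonic:
  "integral {0..2*pi} (\<lambda>z. c + (d * cos z + k * sin z)) = 2 * pi * (c :: real)"
proof -
  have "integral {0..2*pi} (\<lambda>z. c + (d * cos z + k * sin z)) =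
      (c * (2*pi) + (d * sin (2*pi) - k * cos (2*pi))) - (c * 0 + (d * sin 0 - k * cos 0))"
    by (rule integral_DERIV) (auto intro!: derivative_eq_intros)
  then show ?thesis by simp
qed

lemma integral_cos2_sin: "integral {0..pi} (\<lambda>t. sin t * cos t * (k * cos t)) = 2 / 3 * (k :: real)"
proof -
  have "integral {0..pi} (\<lambda>t. sin t * cos t * (k * cos t)) = - k * (cos pi)^3 / 3 - (- k * (cos 0)^3 / 3)"
    by (rule integral_DERIV) (auto intro!: derivative_eq_intros simp: power2_eq_square)
  then show ?thesis by simp
qed

lemma integral_sin3: "integral {0..pi} (\<lambda>t. (sin t)\<^sup>2 * (k * sin t)) = 4 / 3 * (k :: real)"
proof -
  have "integral {0..pi} (\<lambda>t. (sin t)\<^sup>2 * (k * sin t)) =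
      k * ((cos pi)^3 / 3 - cos pi) - k * ((cos 0)^3 / 3 - cos 0)"
    by (rule integral_DERIV) (auto intro!: derivative_eq_intros simp: sin_squared_eq algebra_simps)
  then show ?thesis by simp
qed

context
  fixes p e u v :: "real^4"
begin

text \<open>For orthonormal \<open>p\<close>, \<open>e\<close>, \<open>u\<close>, \<open>v\<close>,
  the point \<open>polar r t z\<close> lies at distance \<open>r\<close> from \<open>p\<close> in
  the direction \<open>polar_q t z\<close>, written in spherical coordinates with axis
  \<open>e\<close>. The vectors \<open>polar_r\<close>, \<open>polar_t\<close>,
  \<open>polar_z\<close> are the normalized coordinate vectors; the derivatives of
  \<open>polar\<close> carry the factors 1, \<open>sin r\<close> and
  \<open>sin r * sin t\<close>.\<close>

definition polar_q :: "real \<Rightarrow> real \<Rightarrow> real^4" where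
  "polar_q t z = cos t *\<^sub>R e + sin t *\<^sub>R (cos z *\<^sub>R u + sin z *\<^sub>R v)"

definition polar :: "real \<Rightarrow> real \<Rightarrow> real \<Rightarrow> real^4" where
  "polar r t z = cos r *\<^sub>R p + sin r *\<^sub>R polar_q t z"

definition polar_r :: "real \<Rightarrow> real \<Rightarrow> real \<Rightarrow> real^4" where
  "polar_r r t z = - sin r *\<^sub>R p + cos r *\<^sub>R polar_q t z"

definition polar_t :: "real \<Rightarrow> real \<Rightarrow> real^4" where
  "polar_t t z = - sin t *\<^sub>R e + cos t *\<^sub>R (cos z *\<^sub>R u + sin z *\<^sub>R v)"

definition polar_z :: "real \<Rightarrow> real^4" where
  "polar_z z = - sin z *\<^sub>R u + cos z *\<^sub>R v"

lemmas polar_defs = polar_q_def polar_def polar_r_def polar_t_def polar_z_def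

text \<open>At \<open>r = 0\<close> and \<open>r = pi\<close> the geodesic spheres shrink to
  \<open>p\<close> and \<open>- p\<close>, so the oscillator identity compares the values of the
  field at these two points. Orthonormality and \<open>vol\<close> identify the contractions of the
  volume form with the components of the field.\<close>

lemma polar_eigenfield:
  assumes V: "curl_eigenfield V lam"
    and on: "p \<bullet> p = 1" "e \<bullet> e = 1" "u \<bullet> u = 1" "v \<bullet> v = 1" "e \<bullet> p = 0" "u \<bullet> p = 0" "v \<bullet> p = 0"
      "e \<bullet> u = 0" "e \<bullet> v = 0" "u \<bullet> v = 0"
    and vol: "\<And>r t z. vol_S3 (polar r t z) (polar_r r t z) (polar_t t z) (polar_z z) = 1"
  shows "(V (- p) \<bullet> e) * sin (lam * pi) = 0" "- (V (- p) \<bullet> e) * cos (lam * pi) = V p \<bullet> e"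
proof -
  have lam: "lam \<noteq> 0" and Vt: "\<And>x. x \<in> S3 \<Longrightarrow> V x \<bullet> x = 0"
    and curl: "\<And>x. x \<in> S3 \<Longrightarrow> curl_S3 V x = lam *\<^sub>R V x" and sm: "smooth_along S3 V"
    using V by (auto simp: curl_eigenfield_def smooth_vector_field_def tangent_S3_def)
  obtain U G D where U: "open U" "S3 \<subseteq> U" and G: "\<And>x. x \<in> S3 \<Longrightarrow> G x = V x"
    and D: "\<And>x. x \<in> U \<Longrightarrow> (G has_derivative D x) (at x)"
    and contD: "continuous_on {z. fst z \<in> U} (\<lambda>z. D (fst z) (snd z))"
    using smooth_along_C1[OF sm] by blast
  have on': "p \<bullet> e = 0" "p \<bullet> u = 0" "p \<bullet> v = 0" "u \<bullet> e = 0" "v \<bullet> e = 0" "v \<bullet> u = 0"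
    using on by (simp_all add: inner_commute)
  let ?X = polar and ?n = polar_r and ?t = polar_t and ?b = polar_z
  have trig: "(sin x)\<^sup>2 + (cos x)\<^sup>2 = 1" for x :: real by simp
  have trig': "cos z * (c * cos z) + sin z * (c * sin z) = c" for c z :: real
    using trig[of z] by Groebner_Basis.algebra
  have ortho: "?X r t z \<bullet> ?X r t z = 1" "?n r t z \<bullet> ?n r t z = 1" "?t t z \<bullet> ?t t z = 1" "?b z \<bullet> ?b z = 1"
    "?n r t z \<bullet> ?X r t z = 0" "?t t z \<bullet> ?X r t z = 0" "?b z \<bullet> ?X r t z = 0"
    "?n r t z \<bullet> ?t t z = 0" "?n r t z \<bullet> ?b z = 0" "?t t z \<bullet> ?b z = 0"
    "?t t z \<bullet> ?n r t z = 0" "?b z \<bullet> ?n r t z = 0" "?b z \<bullet> ?t t z = 0" for r t z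
    unfolding polar_defs inner_add_left inner_add_right inner_scaleR_left inner_scaleR_right on on'
    using trig[of r] trig[of t] trig[of z]
    by (simp_all only: mult_zero_right mult_zero_left add_0 add_0_right mult_1_right minus_zero trig')
      (Groebner_Basis.algebra | (simp add: algebra_simps; fail))+
  have XS: "?X r t z \<in> S3" for r t z using ortho(1)[of r t z] by (simp add: norm_eq_1)
  have XU: "?X r t z \<in> U" for r t z using XS U by blast
  have vec: "((\<lambda>r. ?X r t z) has_vector_derivative ?n r t z) (at r)"
    "((\<lambda>t. ?X r t z) has_vector_derivative sin r *\<^sub>R ?t t z) (at t)"
    "((\<lambda>z. ?X r t z) has_vector_derivative (sin r * sin t) *\<^sub>R ?b z) (at z)"
    "((\<lambda>t. ?n r t z) has_vector_derivative cos r *\<^sub>R ?t t z) (at t)"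
    "((\<lambda>z. ?n r t z) has_vector_derivative (cos r * sin t) *\<^sub>R ?b z) (at z)"
    "((\<lambda>z. sin r *\<^sub>R ?t t z) has_vector_derivative (sin r * cos t) *\<^sub>R ?b z) (at z)"
    "((\<lambda>r. sin r *\<^sub>R ?t t z) has_vector_derivative cos r *\<^sub>R ?t t z) (at r)"
    "((\<lambda>r. (sin r * sin t) *\<^sub>R ?b z) has_vector_derivative (cos r * sin t) *\<^sub>R ?b z) (at r)"
    "((\<lambda>t. (sin r * sin t) *\<^sub>R ?b z) has_vector_derivative (sin r * cos t) *\<^sub>R ?b z) (at t)" for r t z
    unfolding polar_defs has_vector_derivative_def
    by (auto intro!: derivative_eq_intros simp: fun_eq_iff algebra_simps)
  have dG: "((\<lambda>t. G (c t) \<bullet> w t) has_real_derivative D (?X r t z) c' \<bullet> w s + G (?X r t z) \<bullet> w') (at s)"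
    if "(c has_vector_derivative c') (at s)" "c s = ?X r t z" "(w has_vector_derivative w') (at s)"
    for c c' w w' s r t z
    using DERIV_inner_along_curve[OF that(1) _ that(3), of G] D[OF XU[of r t z]] unfolding that(2) .
  have contX: "continuous_on A (\<lambda>x. ?X (f x) (g x) (h x))" "continuous_on A (\<lambda>x. ?n (f x) (g x) (h x))"
    if "continuous_on A f" "continuous_on A g" "continuous_on A h"
    for A :: "(real \<times> real \<times> real) set" and f g h
    unfolding polar_defs by (intro continuous_intros that)+
  have contt: "continuous_on A (\<lambda>x. ?t (g x) (h x))" if "continuous_on A g" "continuous_on A h"
    for A :: "(real \<times> real \<times> real) set" and g h
    unfolding polar_defs by (intro continuous_intros that)+
  have contb: "continuous_on A (\<lambda>x. ?b (h x))" if "continuous_on A h"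
    for A :: "(real \<times> real \<times> real) set" and h
    unfolding polar_defs by (intro continuous_intros that)+
  have contG: "continuous_on A (\<lambda>x. G (f x))" if "continuous_on A f" "f ` A \<subseteq> U"
    for A :: "(real \<times> real \<times> real) set" and f
    by (rule continuous_on_compose2[OF _ that])
      (auto intro!: continuous_at_imp_continuous_on has_derivative_continuous[OF D])
  have contDG: "continuous_on A (\<lambda>x. D (f x) (g x))"
    if "continuous_on A f" "continuous_on A g" "f ` A \<subseteq> U"
    for A :: "(real \<times> real \<times> real) set" and f g
  proof -
    have "continuous_on A (\<lambda>x. (\<lambda>z. D (fst z) (snd z)) (f x, g x))"
      by (rule continuous_on_compose2[OF contD]) (use that in \<open>auto intro!: continuous_intros\<close>)
    then show ?thesis by simp
  qed
  note cts = continuous_intros contX contt contb contG contDG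
  have img: "(\<lambda>x. ?X (f x) (g x) (h x)) ` A \<subseteq> U" for A :: "(real \<times> real \<times> real) set" and f g h
    using XU by auto
  have curlG: "D (?X r t z) y \<bullet> w - D (?X r t z) w \<bullet> y = lam * vol_S3 (?X r t z) (V (?X r t z)) y w"
    if "y \<bullet> ?X r t z = 0" "w \<bullet> ?X r t z = 0" for r t z y w
    using ext_deriv_flat_curl[OF XS D[OF XU] G that] curl[OF XS] by (simp add: vol_S3_scale)
  have vol': "vol_S3 (?X r t z) (?t t z) (?b z) (?n r t z) = 1"
    "vol_S3 (?X r t z) (?b z) (?n r t z) (?t t z) = 1" for r t z
    using vol[of r t z] vol_S3_cyclic by metis+
  have vols: "vol_S3 (?X r t z) (V (?X r t z)) (?t t z) (?b z) = G (?X r t z) \<bullet> ?n r t z"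
    "vol_S3 (?X r t z) (V (?X r t z)) (?b z) (?n r t z) = G (?X r t z) \<bullet> ?t t z"
    "vol_S3 (?X r t z) (V (?X r t z)) (?n r t z) (?t t z) = G (?X r t z) \<bullet> ?b z" for r t z
    unfolding G[OF XS] by (intro vol_S3_orthonormal XS Vt ortho vol vol')+
  let ?a = "\<lambda>r. integral {0..pi} (\<lambda>t. sin t * cos t * integral {0..2*pi} (\<lambda>z. G (?X r t z) \<bullet> ?n r t z))"
  let ?B = "\<lambda>r. integral {0..pi} (\<lambda>t. (sin t)\<^sup>2 * integral {0..2*pi} (\<lambda>z. G (?X r t z) \<bullet> ?t t z))"
  have *: "(?a pi + ?B pi) * sin (lam * pi) = 0 \<and> (?a pi + ?B pi) * cos (lam * pi) = ?a 0 - ?B 0"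
  proof (rule polar_eigenform[OF lam, where
        vb = "\<lambda>r t z. G (?X r t z) \<bullet> ?b z"
        and at_r = "\<lambda>r t z. D (?X r t z) (?n r t z) \<bullet> (sin r *\<^sub>R ?t t z) + G (?X r t z) \<bullet> (cos r *\<^sub>R ?t t z)"
        and ar_t = "\<lambda>r t z. D (?X r t z) (sin r *\<^sub>R ?t t z) \<bullet> ?n r t z + G (?X r t z) \<bullet> (cos r *\<^sub>R ?t t z)"
        and ab_r = "\<lambda>r t z. D (?X r t z) (?n r t z) \<bullet> ((sin r * sin t) *\<^sub>R ?b z) + G (?X r t z) \<bullet> ((cos r * sin t) *\<^sub>R ?b z)"
        and ar_b = "\<lambda>r t z. D (?X r t z) ((sin r * sin t) *\<^sub>R ?b z) \<bullet> ?n r t z + G (?X r t z) \<bullet> ((cos r * sin t) *\<^sub>R ?b z)"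
        and ab_t = "\<lambda>r t z. D (?X r t z) (sin r *\<^sub>R ?t t z) \<bullet> ((sin r * sin t) *\<^sub>R ?b z) + G (?X r t z) \<bullet> ((sin r * cos t) *\<^sub>R ?b z)"
        and at_b = "\<lambda>r t z. D (?X r t z) ((sin r * sin t) *\<^sub>R ?b z) \<bullet> (sin r *\<^sub>R ?t t z) + G (?X r t z) \<bullet> ((sin r * cos t) *\<^sub>R ?b z)"])
    fix r t z
    note v = vec[where r=r and t=t and z=z]
    show "((\<lambda>r. sin r * (G (?X r t z) \<bullet> ?t t z)) has_real_derivative
       D (?X r t z) (?n r t z) \<bullet> (sin r *\<^sub>R ?t t z) + G (?X r t z) \<bullet> (cos r *\<^sub>R ?t t z)) (at r)"
      using dG[OF v(1) refl v(7)] by simp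
    show "((\<lambda>r. sin r * sin t * (G (?X r t z) \<bullet> ?b z)) has_real_derivative
       D (?X r t z) (?n r t z) \<bullet> ((sin r * sin t) *\<^sub>R ?b z) + G (?X r t z) \<bullet> ((cos r * sin t) *\<^sub>R ?b z)) (at r)"
      using dG[OF v(1) refl v(8)] by simp
    show "((\<lambda>t. sin r * sin t * (G (?X r t z) \<bullet> ?b z)) has_real_derivative
       D (?X r t z) (sin r *\<^sub>R ?t t z) \<bullet> ((sin r * sin t) *\<^sub>R ?b z) + G (?X r t z) \<bullet> ((sin r * cos t) *\<^sub>R ?b z)) (at t)"
      using dG[OF v(2) refl v(9)] by simp
    show "((\<lambda>z. sin r * (G (?X r t z) \<bullet> ?t t z)) has_real_derivative
       D (?X r t z) ((sin r * sin t) *\<^sub>R ?b z) \<bullet> (sin r *\<^sub>R ?t t z) + G (?X r t z) \<bullet> ((sin r * cos t) *\<^sub>R ?b z)) (at z)"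
      using dG[OF v(3) refl v(6)] by simp
    \<comment> \<open>In this and the next two equations the terms with \<open>G\<close>
      undifferentiated contain the same mixed second derivative of the parametrization and cancel.
      What remains is the curl equation on two coordinate vectors.\<close>
    show "D (?X r t z) (sin r *\<^sub>R ?t t z) \<bullet> ((sin r * sin t) *\<^sub>R ?b z) + G (?X r t z) \<bullet> ((sin r * cos t) *\<^sub>R ?b z)
       - (D (?X r t z) ((sin r * sin t) *\<^sub>R ?b z) \<bullet> (sin r *\<^sub>R ?t t z) + G (?X r t z) \<bullet> ((sin r * cos t) *\<^sub>R ?b z))
       = lam * (sin r)\<^sup>2 * sin t * (G (?X r t z) \<bullet> ?n r t z)"
      using curlG[of "sin r *\<^sub>R ?t t z" r t z "(sin r * sin t) *\<^sub>R ?b z"] ortho vols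
      by (simp add: vol_S3_scale power2_eq_square mult_ac)
    show "D (?X r t z) ((sin r * sin t) *\<^sub>R ?b z) \<bullet> ?n r t z + G (?X r t z) \<bullet> ((cos r * sin t) *\<^sub>R ?b z)
       - (D (?X r t z) (?n r t z) \<bullet> ((sin r * sin t) *\<^sub>R ?b z) + G (?X r t z) \<bullet> ((cos r * sin t) *\<^sub>R ?b z))
       = lam * sin r * sin t * (G (?X r t z) \<bullet> ?t t z)"
      using curlG[of "(sin r * sin t) *\<^sub>R ?b z" r t z "?n r t z"] ortho vols
      by (simp add: vol_S3_scale power2_eq_square mult_ac)
    show "D (?X r t z) (?n r t z) \<bullet> (sin r *\<^sub>R ?t t z) + G (?X r t z) \<bullet> (cos r *\<^sub>R ?t t z)
       - (D (?X r t z) (sin r *\<^sub>R ?t t z) \<bullet> ?n r t z + G (?X r t z) \<bullet> (cos r *\<^sub>R ?t t z))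
       = lam * sin r * (G (?X r t z) \<bullet> ?b z)"
      using curlG[of "?n r t z" r t z "sin r *\<^sub>R ?t t z"] ortho vols
      by (simp add: vol_S3_scale power2_eq_square mult_ac)
    show "G (?X r t (2*pi)) \<bullet> ?n r t (2*pi) = G (?X r t 0) \<bullet> ?n r t 0"
      "G (?X r t (2*pi)) \<bullet> ?t t (2*pi) = G (?X r t 0) \<bullet> ?t t 0"
      by (simp_all add: polar_defs)
    show "((\<lambda>t. G (?X r t z) \<bullet> ?n r t z) has_real_derivative
       D (?X r t z) (sin r *\<^sub>R ?t t z) \<bullet> ?n r t z + G (?X r t z) \<bullet> (cos r *\<^sub>R ?t t z)) (at t)"
      using dG[OF v(2) refl v(4)] by simp
    show "((\<lambda>z. G (?X r t z) \<bullet> ?n r t z) has_real_derivative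
       D (?X r t z) ((sin r * sin t) *\<^sub>R ?b z) \<bullet> ?n r t z + G (?X r t z) \<bullet> ((cos r * sin t) *\<^sub>R ?b z)) (at z)"
      using dG[OF v(3) refl v(5)] by simp
  qed (unfold case_prod_unfold, (intro cts img)+)
  have trig_integral: "integral {0..2*pi} (\<lambda>z. y \<bullet> (c *\<^sub>R e + d *\<^sub>R (cos z *\<^sub>R u + sin z *\<^sub>R v)))
     = 2 * pi * (c * (y \<bullet> e))" for y c d
    using integral_first_harmonic[of "c * (y \<bullet> e)" "d * (y \<bullet> u)" "d * (y \<bullet> v)"]
    by (simp add: inner_add_right algebra_simps)
  have pS: "p \<in> S3" "- p \<in> S3" using on(1) by (simp_all add: norm_eq_1)
  have poles: "?X 0 t z = p" "?X pi t z = - p" "?n 0 t z = polar_q t z" "?n pi t z = - polar_q t z" for t z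
    by (simp_all add: polar_def polar_r_def)
  have q_int: "integral {0..2*pi} (\<lambda>z. y \<bullet> polar_q t z) = 2 * pi * (y \<bullet> e) * cos t"
    and t_int: "integral {0..2*pi} (\<lambda>z. y \<bullet> polar_t t z) = - (2 * pi * (y \<bullet> e)) * sin t" for y t
    unfolding polar_q_def polar_t_def trig_integral by simp_all
  have qn_int: "integral {0..2*pi} (\<lambda>z. y \<bullet> - polar_q t z) = - (2 * pi * (y \<bullet> e)) * cos t" for y t
    unfolding inner_minus_right integral_neg q_int by simp
  \<comment> \<open>At a pole the field is constant over the directions, so only its component along
    \<open>e\<close> survives. From 2/3 + 4/3 = 2, \<open>a 0 - b 0\<close> is
    \<open>4 * pi * (V p \<bullet> e)\<close> and \<open>a pi + b pi\<close> is
    \<open>- 4 * pi * (V (- p) \<bullet> e)\<close>.\<close>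
  have a0: "?a 0 = 2 / 3 * (2 * pi * (V p \<bullet> e))" and api: "?a pi = 2 / 3 * - (2 * pi * (V (- p) \<bullet> e))"
    unfolding poles G[OF pS(1)] G[OF pS(2)] q_int qn_int integral_cos2_sin by (rule refl)+
  have b0: "?B 0 = 4 / 3 * - (2 * pi * (V p \<bullet> e))" and bpi: "?B pi = 4 / 3 * - (2 * pi * (V (- p) \<bullet> e))"
    unfolding poles G[OF pS(1)] G[OF pS(2)] t_int integral_sin3 by (rule refl)+
  have "4 * pi * ((V (- p) \<bullet> e) * sin (lam * pi)) = 0"
    using conjunct1[OF *] unfolding api bpi by (simp add: algebra_simps)
  then show "(V (- p) \<bullet> e) * sin (lam * pi) = 0" by simp
  have "4 * pi * (- (V (- p) \<bullet> e) * cos (lam * pi)) = 4 * pi * (V p \<bullet> e)"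
    using conjunct2[OF *] unfolding api bpi a0 b0 by (simp add: algebra_simps)
  then show "- (V (- p) \<bullet> e) * cos (lam * pi) = V p \<bullet> e"
    by (simp only: mult_cancel_left) simp
qed

end


lemma frame_trig_simps:
  assumes "p \<in> S3"
  shows "p \<bullet> p = 1" "frame_R p \<bullet> frame_R p = 1" "frame_X1 p \<bullet> frame_X1 p = 1" "frame_X2 p \<bullet> frame_X2 p = 1"
  using S3_inner[OF assms] by (simp_all add: frame_inner)

text \<open>The frame vectors in cyclic order are positive, and polar coordinates built on them keep
  this orientation. Once the quaternion table has eliminated iterated frame maps, only sin^2 + cos^2
  = 1 for the three angles is left to use.\<close>

lemma polar_vol:
  assumes p: "p \<in> S3"
    and euv: "(e, u, v) \<in> {(frame_R p, frame_X1 p, frame_X2 p), (frame_X1 p, frame_X2 p, frame_R p),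
      (frame_X2 p, frame_R p, frame_X1 p)}"
  shows "vol_S3 (polar p e u v r t z) (polar_r p e u v r t z) (polar_t e u v t z) (polar_z u v z) = 1"
proof -
  note unf = polar_def polar_r_def polar_t_def polar_z_def polar_q_def vol_S3_cross frame_coords_def
    inner_3 cross3_def vector_3 frame_add frame_scaleR frame_minus frame_frame
    inner_add_left inner_add_right inner_scaleR_left inner_scaleR_right inner_minus_left inner_minus_right
    frame_inner frame_trig_simps[OF p]
  have trig: "(sin x)\<^sup>2 + (cos x)\<^sup>2 = 1" for x :: real by simp
  consider "e = frame_R p" "u = frame_X1 p" "v = frame_X2 p" | "e = frame_X1 p" "u = frame_X2 p" "v = frame_R p"
    | "e = frame_X2 p" "u = frame_R p" "v = frame_X1 p" using euv by auto
  then show ?thesis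
  proof cases
    case 1
    show ?thesis unfolding 1 using trig[of r] trig[of t] trig[of z]
      by (simp only: unf mult_zero_right mult_zero_left add_0 add_0_right mult_1_right minus_zero) Groebner_Basis.algebra
  next
    case 2
    show ?thesis unfolding 2 using trig[of r] trig[of t] trig[of z]
      by (simp only: unf mult_zero_right mult_zero_left add_0 add_0_right mult_1_right minus_zero) Groebner_Basis.algebra
  next
    case 3
    show ?thesis unfolding 3 using trig[of r] trig[of t] trig[of z]
      by (simp only: unf mult_zero_right mult_zero_left add_0 add_0_right mult_1_right minus_zero) Groebner_Basis.algebra
  qed
qed

text \<open>Three directions suffice, as the frame at \<open>p\<close> spans the tangent space at
  \<open>- p\<close> as well.\<close>

lemma curl_eigenfield_antipode:
  assumes V: "curl_eigenfield V lam" and p: "p \<in> S3"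
    and e: "e \<in> {frame_R p, frame_X1 p, frame_X2 p}"
  shows "(V (- p) \<bullet> e) * sin (lam * pi) = 0" "- (V (- p) \<bullet> e) * cos (lam * pi) = V p \<bullet> e"
proof -
  obtain u v where euv: "(e, u, v) \<in> {(frame_R p, frame_X1 p, frame_X2 p), (frame_X1 p, frame_X2 p, frame_R p),
      (frame_X2 p, frame_R p, frame_X1 p)}"
    using e by blast
  have "(V (- p) \<bullet> e) * sin (lam * pi) = 0 \<and> - (V (- p) \<bullet> e) * cos (lam * pi) = V p \<bullet> e"
    by (intro conjI; rule polar_eigenfield[OF V _ _ _ _ _ _ _ _ _ _ polar_vol[OF p euv]])
      (use euv in \<open>auto simp: frame_inner S3_inner[OF p]\<close>)
  then show "(V (- p) \<bullet> e) * sin (lam * pi) = 0" "- (V (- p) \<bullet> e) * cos (lam * pi) = V p \<bullet> e" by auto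
qed

lemma curl_eigenfield_integer:
  assumes V: "curl_eigenfield V lam"
  obtains k :: int where "lam = of_int k"
    "\<And>p. p \<in> S3 \<Longrightarrow> odd k \<Longrightarrow> frame_coords p (V (- p)) = frame_coords p (V p)"
proof -
  have t: "V p \<bullet> p = 0" if "p \<in> S3" for p
    using V that by (auto simp: curl_eigenfield_def smooth_vector_field_def tangent_S3_def)
  obtain p where p: "p \<in> S3" "V p \<noteq> 0" using V by (auto simp: curl_eigenfield_def)
  then have mp: "- p \<in> S3" by simp
  have "\<exists>e\<in>{frame_R (- p), frame_X1 (- p), frame_X2 (- p)}. V p \<bullet> e \<noteq> 0"
  proof (rule ccontr)
    assume "\<not> ?thesis"
    then have "V p = 0" using frame_expansion[OF p(1) t[OF p(1)]] by (simp add: frame_minus)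
    then show False using p by simp
  qed
  \<comment> \<open>Applied at \<open>- p\<close>, so that the factor in front of the sine is a
    nonzero component of \<open>V p\<close>.\<close>
  then have "sin (lam * pi) = 0" using curl_eigenfield_antipode(1)[OF V mp] by force
  then obtain k :: int where "lam * pi = of_int k * pi" using sin_zero_iff_int2 by blast
  then have k: "lam = of_int k" by simp
  moreover have "frame_coords p (V (- p)) = frame_coords p (V p)" if "p \<in> S3" "odd k" for p
  proof -
    have "cos (lam * pi) = - 1"
      using cos_npi_int[of k] that(2) k by (simp add: mult.commute)
    then have "V (- p) \<bullet> e = V p \<bullet> e" if "e \<in> {frame_R p, frame_X1 p, frame_X2 p}" for e
      using curl_eigenfield_antipode(2)[OF V \<open>p \<in> S3\<close> that] by simp
    then show ?thesis by (simp add: frame_coords_def)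
  qed
  ultimately show ?thesis using that by blast
qed

section \<open>A Borsuk-Ulam theorem\<close>

text \<open>An odd self-map of the two-point sphere is the identity or the swap, and the swap is the
  reflection in the coordinate 0, of degree -1.\<close>

lemma odd_degree_0:
  assumes cf: "continuous_map (nsphere 0) (nsphere 0) f"
    and odd: "\<And>u. u \<in> topspace (nsphere 0) \<Longrightarrow> f (\<lambda>i. - u i) = (\<lambda>i. - f u i)"
  shows "odd (Brouwer_degree2 0 f)"
proof -
  define a :: "nat \<Rightarrow> real" where "a = (\<lambda>i. if i = 0 then 1 else 0)"
  have top: "topspace (nsphere 0) = {a, (\<lambda>i. - a i)}"
  proof -
    have "x \<in> topspace (nsphere 0) \<longleftrightarrow> x = a \<or> x = (\<lambda>i. - a i)" for x :: "nat \<Rightarrow> real"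
    proof
      assume "x \<in> topspace (nsphere 0)"
      then have *: "(x 0)\<^sup>2 = 1" "\<forall>i>0. x i = 0" by (simp_all add: nsphere)
      then have "x 0 = 1 \<or> x 0 = -1" by (simp add: power2_eq_1_iff)
      with * show "x = a \<or> x = (\<lambda>i. - a i)" by (auto simp: a_def fun_eq_iff)
    next
      assume "x = a \<or> x = (\<lambda>i. - a i)"
      then show "x \<in> topspace (nsphere 0)" by (auto simp: a_def nsphere)
    qed
    then show ?thesis by blast
  qed
  have "f a \<in> topspace (nsphere 0)" using cf top continuous_map_image_subset_topspace by blast
  then consider "f a = a" | "f a = (\<lambda>i. - a i)" using top by auto
  then show ?thesis
  proof cases
    case 1
    then have "f u = id u" if "u \<in> topspace (nsphere 0)" for u
      using that odd[of a] top by auto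
    then have "Brouwer_degree2 0 f = Brouwer_degree2 0 id" by (intro Brouwer_degree2_eq)
    then show ?thesis by simp
  next
    case 2
    then have "f u = (\<lambda>x i. if i = 0 then - x i else x i) u" if "u \<in> topspace (nsphere 0)" for u
    proof -
      have "(\<lambda>i. if i = 0 then - u i else u i) = (\<lambda>i. - u i)"
        using that top by (auto simp: a_def)
      then show ?thesis using that odd[of a] top 2 by auto
    qed
    then have "Brouwer_degree2 0 f = Brouwer_degree2 0 (\<lambda>x i. if i = 0 then - x i else x i)"
      by (intro Brouwer_degree2_eq)
    then show ?thesis by (simp add: Brouwer_degree2_reflection)
  qed
qed

text \<open>An odd map preserving an equator has the same degree modulo 2 as its restriction to it.
  Going down from dimension 3 to dimension 0 makes the degree odd; but a map into the 2-sphere is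
  not onto the 3-sphere, so its degree is 0.\<close>

lemma no_odd_map_filtered:
  assumes cf: "continuous_map (nsphere 3) (nsphere 3) f"
    and odd: "\<And>u. u \<in> topspace (nsphere 3) \<Longrightarrow> f (\<lambda>i. - u i) = (\<lambda>i. - f u i)"
    and f3: "f \<in> topspace (nsphere 3) \<rightarrow> topspace (nsphere 2)"
    and f1: "f \<in> topspace (nsphere 1) \<rightarrow> topspace (nsphere 1)"
    and f0: "f \<in> topspace (nsphere 0) \<rightarrow> topspace (nsphere 0)"
  shows False
proof -
  have sub: "nsphere k = subtopology (nsphere 3) (topspace (nsphere k))
     \<and> topspace (nsphere k) \<subseteq> topspace (nsphere 3)" if "k \<le> 3" for k
  proof -
    have "{x. (\<Sum>i\<le>k. (x i)\<^sup>2) = 1 \<and> (\<forall>i>k. x i = 0)}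
        \<subseteq> {x. (\<Sum>i\<le>3. (x i)\<^sup>2) = 1 \<and> (\<forall>i>3. x i = (0::real))}"
    proof (clarify)
      fix x :: "nat \<Rightarrow> real" assume x: "(\<Sum>i\<le>k. (x i)\<^sup>2) = 1" "\<forall>i>k. x i = 0"
      have "(\<Sum>i\<le>3. (x i)\<^sup>2) = (\<Sum>i\<le>k. (x i)\<^sup>2)"
        using that x by (intro sum.mono_neutral_right) auto
      then show "(\<Sum>i\<le>3. (x i)\<^sup>2) = 1 \<and> (\<forall>i>3. x i = 0)" using x that by auto
    qed
    then show ?thesis by (simp add: nsphere subtopology_subtopology inf.absorb2)
  qed
  have restrict: "continuous_map (subtopology (nsphere 3) T) (subtopology (nsphere 3) T) f"
    if "f \<in> T \<rightarrow> T" for T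
    using that cf by (auto simp: continuous_map_in_subtopology intro: continuous_map_from_subtopology)
  have cm: "continuous_map (nsphere k) (nsphere k) f"
    if "k \<le> 3" "f \<in> topspace (nsphere k) \<rightarrow> topspace (nsphere k)" for k
    using restrict[OF that(2)] sub[OF that(1)] by argo
  have f2: "f \<in> topspace (nsphere 2) \<rightarrow> topspace (nsphere 2)"
    using sub[of 2] f3 by auto
  have step: "even (Brouwer_degree2 n f - Brouwer_degree2 (n - Suc 0) f)"
    if "n \<le> 3" "continuous_map (nsphere n) (nsphere n) f"
      "f \<in> topspace (nsphere (n - Suc 0)) \<rightarrow> topspace (nsphere (n - Suc 0))" for n
    using that sub[of n] odd by (intro Borsuk_odd_mapping_degree_step) (auto simp: o_def)
  have "Brouwer_degree2 3 f = 0"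
  proof (rule Brouwer_degree2_nonsurjective[OF cf])
    define z :: "nat \<Rightarrow> real" where "z = (\<lambda>i. if i = 3 then 1 else 0)"
    have z: "z \<in> topspace (nsphere 3)" "z \<notin> topspace (nsphere 2)"
      by (auto simp: z_def nsphere numeral_eq_Suc)
    then have "z \<notin> f ` topspace (nsphere 3)" using f3 by auto
    then show "f ` topspace (nsphere 3) \<noteq> topspace (nsphere 3)" using z(1) by auto
  qed
  moreover have "even (Brouwer_degree2 3 f - Brouwer_degree2 2 f)"
    using step[of 3] f2 cf by simp
  moreover have "even (Brouwer_degree2 2 f - Brouwer_degree2 1 f)"
    using step[of 2] f1 cm[OF _ f2] by simp
  moreover have "even (Brouwer_degree2 1 f - Brouwer_degree2 0 f)"
    using step[of 1] f0 cm[OF _ f1] by simp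
  moreover have "odd (Brouwer_degree2 0 f)"
    using odd sub[of 0] by (intro odd_degree_0 cm f0) auto
  ultimately show False by auto
qed


text \<open>The cone is the image of a plane in R^3 under a differentiable map, hence a null set.
  Its complement supplies the generic direction below.\<close>

lemma negligible_cone_over_curve:
  fixes g :: "real \<Rightarrow> real^3"
  assumes "\<And>t. g differentiable (at t)"
  shows "negligible (range (\<lambda>(t, r). r *\<^sub>R g t))"
proof (rule negligible_differentiable_image_lowdim)
  show "DIM(real \<times> real) < DIM(real^3)" by simp
  have "(\<lambda>(t, r). r *\<^sub>R g t) differentiable (at x)" for x :: "real \<times> real"
  proof -
    have "(\<lambda>z::real \<times> real. g (fst z)) differentiable (at x)"
      using differentiable_chain_at[of fst x g] assms bounded_linear_fst bounded_linear_imp_differentiable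
      by (auto simp: o_def)
    moreover have "(\<lambda>z::real \<times> real. snd z) differentiable (at x)"
      by (simp add: bounded_linear_imp_differentiable bounded_linear_snd)
    ultimately show ?thesis
      by (auto simp: case_prod_unfold intro!: differentiable_scaleR)
  qed
  then show "(\<lambda>(t, r). r *\<^sub>R g t) differentiable_on UNIV"
    by (simp add: differentiable_on_eq_differentiable_at)
qed

text \<open>A generic line through the origin misses the image of the circle, so the coordinates can be
  rescaled to a map of the sphere that preserves the equators of all dimensions, to which the
  parity of the degree applies three times.\<close>

lemma Borsuk_Ulam_S3:
  fixes f :: "real^4 \<Rightarrow> real^3"
  assumes cont: "continuous_on S3 f"
    and odd: "\<And>x. x \<in> S3 \<Longrightarrow> f (- x) = - f x"
    and nz: "\<And>x. x \<in> S3 \<Longrightarrow> f x \<noteq> 0"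
    and diff: "\<And>t. (\<lambda>t. f (vector [cos t, sin t, 0, 0])) differentiable (at t)"
  shows False
proof -
  \<comment> \<open>A curve that is merely continuous could meet every line through the origin;
    differentiability on the great circle rules this out.\<close>
  obtain e where e: "e \<notin> range (\<lambda>(t, r). r *\<^sub>R f (vector [cos t, sin t, 0, 0]))"
  proof -
    have "range (\<lambda>(t, r). r *\<^sub>R f (vector [cos t, sin t, 0, 0])) \<noteq> UNIV"
    proof
      assume "range (\<lambda>(t, r). r *\<^sub>R f (vector [cos t, sin t, 0, 0])) = UNIV"
      with negligible_cone_over_curve[OF diff] show False by simp
    qed
    then show ?thesis using that by blast
  qed
  have e': "e \<noteq> r *\<^sub>R f (vector [cos t, sin t, 0, 0])" for t r
    using e by auto
  define a :: "real^4" where "a = vector [1, 0, 0, 0]"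
  have a_eq: "a = vector [cos 0, sin 0, 0, 0]" by (simp add: a_def)
  have e0: "e \<noteq> 0" using e'[of 0] by auto
  \<comment> \<open>A multiple of the part of \<open>f a\<close> orthogonal to \<open>e\<close>. It
    is nonzero because \<open>a\<close> lies on the great circle, so \<open>f a\<close> is not on
    the line of \<open>e\<close>. Together with \<open>w\<close> this gives an orthogonal basis
    \<open>u\<close>, \<open>w\<close>, \<open>e\<close>.\<close>
  define u where "u = (e \<bullet> e) *\<^sub>R f a - (f a \<bullet> e) *\<^sub>R e"
  have u0: "u \<noteq> 0"
  proof
    assume "u = 0"
    then have *: "(f a \<bullet> e) *\<^sub>R e = (e \<bullet> e) *\<^sub>R f a" by (simp add: u_def)
    have "a \<in> S3" by (simp add: a_def norm_vec_def L2_set_def sum_4)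
    then have "f a \<bullet> e \<noteq> 0" using * nz e0 by auto
    moreover have "(f a \<bullet> e) *\<^sub>R e = (f a \<bullet> e) *\<^sub>R (((e \<bullet> e) / (f a \<bullet> e)) *\<^sub>R f a)"
      using * calculation by simp
    ultimately have "e = ((e \<bullet> e) / (f a \<bullet> e)) *\<^sub>R f a"
      by (simp only: real_vector.scale_cancel_left) blast
    then show False using e' a_eq by metis
  qed
  have ue: "u \<bullet> e = 0" by (simp add: u_def inner_diff_left)
  have "u \<bullet> u = (e \<bullet> e) * (f a \<bullet> u)"
    using ue by (simp add: u_def inner_diff_left inner_commute)
  then have fau: "f a \<bullet> u \<noteq> 0" using u0 by auto
  define w where "w = cross3 e u"
  have w0: "w \<noteq> 0"
    using norm_and_cross_eq_0[of e u] ue u0 e0 by (auto simp: w_def inner_commute)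
  have frame: "v = 0" if "v \<bullet> u = 0" "v \<bullet> w = 0" "v \<bullet> e = 0" for v :: "real^3"
  proof -
    have "cross3 v w = 0" unfolding w_def using Lagrange[of v e u] that by simp
    then show ?thesis using norm_and_cross_eq_0[of v w] that w0 by simp
  qed
  have line: "\<exists>r. e = r *\<^sub>R v" if "v \<bullet> u = 0" "v \<bullet> w = 0" "v \<noteq> 0" for v :: "real^3"
  proof -
    have "(e \<bullet> e) *\<^sub>R v - (v \<bullet> e) *\<^sub>R e = 0"
    proof (rule frame)
      show "((e \<bullet> e) *\<^sub>R v - (v \<bullet> e) *\<^sub>R e) \<bullet> w = 0"
        using that by (simp add: inner_diff_left w_def dot_cross_self)
    qed (use that ue in \<open>simp_all add: inner_diff_left inner_diff_right inner_commute mult.commute\<close>)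
    moreover have ve: "v \<bullet> e \<noteq> 0" using frame that by blast
    ultimately have "(v \<bullet> e) *\<^sub>R e = (v \<bullet> e) *\<^sub>R (((e \<bullet> e) / (v \<bullet> e)) *\<^sub>R v)"
      by simp
    then have "e = ((e \<bullet> e) / (v \<bullet> e)) *\<^sub>R v"
      using ve by (simp only: real_vector.scale_cancel_left) blast
    then show ?thesis by blast
  qed
  define S where "S = {x :: nat \<Rightarrow> real. (\<Sum>i\<le>3. (x i)\<^sup>2) = 1 \<and> (\<forall>i>3. x i = 0)}"
  have nS: "nsphere 3 = top_of_set S"
    by (simp add: nsphere S_def euclidean_product_topology)
  define E where "E = (\<lambda>x::nat \<Rightarrow> real. vector [x 0, x 1, x 2, x 3] :: real^4)"
  have E_S3: "E x \<in> S3" if "x \<in> S" for x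
    using that by (simp add: S_def E_def norm_vec_def L2_set_def sum_4 numeral_eq_Suc)
  have E_minus: "E (\<lambda>i. - x i) = - E x" for x
    by (simp add: E_def vec_eq_iff forall_4)
  have contE: "continuous_on S E"
    unfolding E_def
    by (intro continuous_intros continuous_on_subset[OF continuous_on_product_coordinates subset_UNIV])
  \<comment> \<open>Even weights: on \<open>S\<close>, \<open>c\<close> vanishes exactly on the
    equatorial circle and \<open>d\<close> exactly on the pair of points, so the coordinates of
    \<open>G\<close> drop out one after the other. That \<open>G\<close> has no zero follows from
    the \<open>u\<close> coordinate at the pair of points, from the \<open>u\<close> and
    \<open>w\<close> coordinates on the circle, where \<open>f\<close> avoids the line of
    \<open>e\<close>, and from all three elsewhere.\<close>
  define c where "c = (\<lambda>x::nat \<Rightarrow> real. \<bar>x 2\<bar> + \<bar>x 3\<bar>)"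
  define d where "d = (\<lambda>x::nat \<Rightarrow> real. \<bar>x 1\<bar> + c x)"
  define G where "G = (\<lambda>x (i::nat). if i = 0 then f (E x) \<bullet> u
     else if i = 1 then d x * (f (E x) \<bullet> w) else if i = 2 then c x * (f (E x) \<bullet> e) else 0)"
  define n where "n = (\<lambda>x. sqrt (\<Sum>i\<le>3. (G x i)\<^sup>2))"
  have G0: "\<exists>i\<le>3. G x i \<noteq> 0" if x: "x \<in> S" for x
  proof (rule ccontr)
    assume "\<not> ?thesis"
    then have "G x 0 = 0" "G x 1 = 0" "G x 2 = 0" by auto
    then have g: "f (E x) \<bullet> u = 0" "d x * (f (E x) \<bullet> w) = 0" "c x * (f (E x) \<bullet> e) = 0"
      by (simp_all add: G_def)
    show False
    proof (cases "d x = 0")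
      case True
      then have x0: "x 1 = 0" "x 2 = 0" "x 3 = 0" by (auto simp: d_def c_def)
      then have "(x 0)\<^sup>2 = 1" using x by (simp add: S_def numeral_eq_Suc)
      then have "x 0 = 1 \<or> x 0 = -1" by (simp add: power2_eq_1_iff)
      then have "E x = a \<or> E x = - a" using x0 by (auto simp: E_def a_def vec_eq_iff forall_4)
      moreover have "a \<in> S3" by (simp add: a_def norm_vec_def L2_set_def sum_4)
      ultimately show False using g(1) fau odd[of a] by auto
    next
      case d0: False
      show False
      proof (cases "c x = 0")
        case True
        then have x0: "x 2 = 0" "x 3 = 0" by (auto simp: c_def)
        then have "(x 0)\<^sup>2 + (x 1)\<^sup>2 = 1" using x by (simp add: S_def numeral_eq_Suc)
        then obtain t where "x 0 = cos t" "x 1 = sin t" using sincos_total_2pi by metis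
        then have "E x = vector [cos t, sin t, 0, 0]" using x0 by (simp add: E_def)
        then show False using line[of "f (E x)"] g d0 nz[OF E_S3[OF x]] e' by auto
      next
        case False
        then show False using frame[of "f (E x)"] g d0 nz[OF E_S3[OF x]] by auto
      qed
    qed
  qed
  have npos: "n x > 0" if "x \<in> S" for x
  proof -
    from G0[OF that] obtain i where "i \<le> 3" "G x i \<noteq> 0" by blast
    then have "(\<Sum>i\<le>3. (G x i)\<^sup>2) > 0" by (intro sum_pos2[of _ i]) auto
    then show ?thesis by (simp add: n_def)
  qed
  have G_minus: "G (\<lambda>i. - x i) = (\<lambda>i. - G x i)" if "x \<in> S" for x
    using odd[OF E_S3[OF that]] by (auto simp: G_def E_minus c_def d_def fun_eq_iff)
  define F where "F = (\<lambda>x i. G x i / n x)"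
  have F_minus: "F (\<lambda>i. - x i) = (\<lambda>i. - F x i)" if "x \<in> S" for x
    using G_minus[OF that] by (simp add: F_def n_def)
  have F_norm: "(\<Sum>i\<le>3. (F x i)\<^sup>2) = 1" if "x \<in> S" for x
  proof -
    have "(\<Sum>i\<le>3. (F x i)\<^sup>2) = (\<Sum>i\<le>3. (G x i)\<^sup>2) / (n x)\<^sup>2"
      by (simp add: F_def power_divide sum_divide_distrib)
    also have "(n x)\<^sup>2 = (\<Sum>i\<le>3. (G x i)\<^sup>2)" by (simp add: n_def sum_nonneg)
    finally show ?thesis using npos[OF that] by (auto simp: n_def)
  qed
  have F_top: "F x \<in> topspace (nsphere k)" if "x \<in> S" "k \<le> 3" "\<And>i. i > k \<Longrightarrow> G x i = 0" for x k
  proof -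
    have "(\<Sum>i\<le>3. (F x i)\<^sup>2) = (\<Sum>i\<le>k. (F x i)\<^sup>2)"
      using that by (intro sum.mono_neutral_right) (auto simp: F_def)
    then show ?thesis using F_norm[OF that(1)] that(3) by (simp add: nsphere F_def)
  qed
  have top: "x \<in> S \<and> (\<forall>i>k. x i = 0)" if "x \<in> topspace (nsphere k)" "k \<le> 3" for x k
  proof -
    have x: "(\<Sum>i\<le>k. (x i)\<^sup>2) = 1" "\<forall>i>k. x i = 0" using that(1) by (simp_all add: nsphere)
    have "(\<Sum>i\<le>3. (x i)\<^sup>2) = (\<Sum>i\<le>k. (x i)\<^sup>2)"
      using that(2) x(2) by (intro sum.mono_neutral_right) auto
    then show ?thesis using x that(2) by (auto simp: S_def)
  qed
  show False
  proof (rule no_odd_map_filtered[of F])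
    have cG: "continuous_on S (\<lambda>x. G x i)" for i
    proof -
      have 1: "continuous_on S (\<lambda>x. f (E x))"
        using E_S3 by (intro continuous_on_compose2[OF cont contE]) auto
      show ?thesis unfolding G_def c_def d_def
        by (cases "i = 0"; cases "i = 1"; cases "i = 2")
          (auto intro!: continuous_intros 1 continuous_on_subset[OF continuous_on_product_coordinates subset_UNIV])
    qed
    have cn: "continuous_on S n" unfolding n_def by (intro continuous_intros cG)
    have "continuous_on S F" unfolding F_def
      using npos by (intro continuous_on_coordinatewise_then_product continuous_intros cG cn) force
    moreover have "F \<in> S \<rightarrow> S"
    proof
      fix x assume x: "x \<in> S"
      then have "F x \<in> topspace (nsphere 3)" using F_top[of x 3] by (simp add: G_def)
      then show "F x \<in> S" using nS by simp
    qed
    ultimately show "continuous_map (nsphere 3) (nsphere 3) F" by (simp add: nS)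
    show "F (\<lambda>i. - x i) = (\<lambda>i. - F x i)" if "x \<in> topspace (nsphere 3)" for x
      using F_minus that by (simp add: nS)
    show "F \<in> topspace (nsphere 3) \<rightarrow> topspace (nsphere 2)"
      using F_top[of _ 2] by (auto simp: nS G_def)
    show "F \<in> topspace (nsphere 1) \<rightarrow> topspace (nsphere 1)"
      using F_top[of _ 1] top[of _ 1] by (force simp: G_def c_def)
    show "F \<in> topspace (nsphere 0) \<rightarrow> topspace (nsphere 0)"
      using F_top[of _ 0] top[of _ 0] by (force simp: G_def c_def d_def)
  qed
qed

lemma frame_coords_zero_imp:
  assumes "p \<in> S3" "u \<bullet> p = 0" "frame_coords p u = 0"
  shows "u = 0"
  using frame_coords_inner[OF assms(1,2), of u] assms(3) by simp

section \<open>Parity of the eigenvalue\<close>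

theorem nonvanishing_curl_eigenfield_even:
  assumes V: "curl_eigenfield V lam" and nv: "nonvanishing V"
  shows "\<exists>m::int. m \<noteq> 0 \<and> lam = 2 * of_int m"
proof -
  obtain k :: int where k: "lam = of_int k"
    and anti: "\<And>p. p \<in> S3 \<Longrightarrow> odd k \<Longrightarrow> frame_coords p (V (- p)) = frame_coords p (V p)"
    using curl_eigenfield_integer[OF V] by blast
  have "even k"
  proof (rule ccontr)
    assume odd: "odd k"
    have sm: "smooth_along S3 V" and tan: "\<And>p. p \<in> S3 \<Longrightarrow> V p \<bullet> p = 0"
      using V by (auto simp: curl_eigenfield_def smooth_vector_field_def tangent_S3_def)
    obtain U G D where U: "open U" "S3 \<subseteq> U" and G: "\<And>x. x \<in> S3 \<Longrightarrow> G x = V x"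
      and D: "\<And>x. x \<in> U \<Longrightarrow> (G has_derivative D x) (at x)"
      by (rule smooth_along_C1[OF sm]) blast
    \<comment> \<open>Built from the extension \<open>G\<close> instead of \<open>V\<close>, so that
      it is differentiable on an open set; this yields differentiability along the great
      circle.\<close>
    define f where "f = (\<lambda>x. frame_coords x (G x))"
    have fV: "f x = frame_coords x (V x)" if "x \<in> S3" for x using G that by (simp add: f_def)
    have cframe: "(frame_R has_derivative frame_R) (at x)" "(frame_X1 has_derivative frame_X1) (at x)"
      "(frame_X2 has_derivative frame_X2) (at x)" for x
      by (intro bounded_linear_imp_has_derivative linear_conv_bounded_linear[THEN iffD1] linearI;
          simp add: frame_add frame_scaleR)+
    have df: "f differentiable (at x)" if "x \<in> U" for x
      unfolding f_def frame_coords_def differentiable_def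
      by (rule exI) (rule derivative_intros D[OF that] cframe)+
    show False
    proof (rule Borsuk_Ulam_S3[of f])
      show "continuous_on S3 f"
        using df U by (intro continuous_at_imp_continuous_on ballI differentiable_imp_continuous_within) auto
      show "f (- x) = - f x" if "x \<in> S3" for x
      proof -
        have "f (- x) = - frame_coords x (V (- x))"
          using that by (simp add: fV frame_coords_def frame_minus vec_eq_iff forall_3)
        then show ?thesis using anti[OF that odd] fV[OF that] by simp
      qed
      show "f x \<noteq> 0" if "x \<in> S3" for x
        using frame_coords_zero_imp[OF that tan[OF that]] nv that fV by (auto simp: nonvanishing_def)
      show "(\<lambda>t. f (vector [cos t, sin t, 0, 0])) differentiable (at t)" for t
      proof -
        have "(\<lambda>t. vector [cos t, sin t, 0, 0] :: real^4) differentiable (at t)"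
          unfolding differentiable_def
          by (rule exI) (rule derivative_intros DERIV_cos[THEN has_field_derivative_imp_has_derivative]
             DERIV_sin[THEN has_field_derivative_imp_has_derivative])+
        moreover have "(vector [cos t, sin t, 0, 0] :: real^4) \<in> S3"
          by (simp add: norm_eq_1 inner_4 flip: power2_eq_square)
        ultimately show ?thesis
          using differentiable_chain_at[of "\<lambda>t. vector [cos t, sin t, 0, 0] :: real^4" t f] df U
          by (auto simp: o_def)
      qed
    qed
  qed
  then obtain m where "k = 2 * m" by blast
  moreover have "lam \<noteq> 0" using V by (simp add: curl_eigenfield_def)
  ultimately show ?thesis using k by (intro exI[of _ m]) auto
qed

section \<open>Closure properties of smooth maps\<close>

abbreviation Ck :: "nat \<Rightarrow> 'a::euclidean_space set \<Rightarrow> ('a \<Rightarrow> 'b::real_normed_vector) \<Rightarrow> bool" where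
  "Ck \<equiv> continuously_differentiable_times"

definition smooth_on :: "'a::euclidean_space set \<Rightarrow> ('a \<Rightarrow> 'b::real_normed_vector) \<Rightarrow> bool" where
  "smooth_on U f \<longleftrightarrow> (\<forall>k. Ck k U f)"

lemma Ck_cong:
  assumes "open U" "\<And>x. x \<in> U \<Longrightarrow> f x = g x" "Ck k U f"
  shows "Ck k U g"
  using assms(2,3)
proof (induction k arbitrary: f g)
  case 0
  then show ?case using continuous_on_cong[of U U f g] by auto
next
  case (Suc k)
  have d: "(g has_derivative frechet_derivative f (at x)) (at x)" if "x \<in> U" for x
  proof (rule has_derivative_transform_within_open[OF _ \<open>open U\<close> that])
    show "(f has_derivative frechet_derivative f (at x)) (at x)"
      using Suc.prems(2) that by (simp add: frechet_derivative_works)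
  qed (use Suc.prems(1) in auto)
  have "frechet_derivative f (at x) v = frechet_derivative g (at x) v" if "x \<in> U" for x v
    using frechet_derivative_at[OF d[OF that]] by simp
  then have "Ck k U (\<lambda>x. frechet_derivative g (at x) v)" for v
    using Suc.IH[of "\<lambda>x. frechet_derivative f (at x) v"] Suc.prems(2) by auto
  then show ?case using d by (auto simp: differentiable_def)
qed

text \<open>Admits any explicit derivative in place of \<open>frechet_derivative\<close>, the form
  in which the inductions on the order below proceed.\<close>

lemma Ck_SucI:
  assumes "open U" "\<And>x. x \<in> U \<Longrightarrow> (f has_derivative D x) (at x)" "\<And>v. Ck k U (\<lambda>x. D x v)"
  shows "Ck (Suc k) U f"
proof -
  have "D x v = frechet_derivative f (at x) v" if "x \<in> U" for x v
    using frechet_derivative_at[OF assms(2)[OF that]] by simp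
  then have "Ck k U (\<lambda>x. frechet_derivative f (at x) v)" for v
    using Ck_cong[OF assms(1) _ assms(3)[of v]] by auto
  then show ?thesis using assms(2) by (auto simp: differentiable_def)
qed

lemma Ck_SucD:
  assumes "Ck (Suc k) U f" "x \<in> U"
  shows "(f has_derivative frechet_derivative f (at x)) (at x)"
  using assms by (simp add: frechet_derivative_works)

lemma Ck_Suc_imp: "Ck (Suc k) U f \<Longrightarrow> Ck k U f"
proof (induction k arbitrary: f)
  case 0
  then show ?case
    by (auto intro!: continuous_at_imp_continuous_on differentiable_imp_continuous_within)
next
  case (Suc k)
  then show ?case by (simp del: continuously_differentiable_times.simps(2)
        add: continuously_differentiable_times.simps(2)[of "Suc k" U f]
          continuously_differentiable_times.simps(2)[of k U f])
qed

lemma Ck_subset: "Ck k U f \<Longrightarrow> V \<subseteq> U \<Longrightarrow> Ck k V f"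
  by (induction k arbitrary: f) (auto intro: continuous_on_subset)

lemma Ck_local:
  assumes "\<And>x. x \<in> U \<Longrightarrow> \<exists>W. open W \<and> x \<in> W \<and> Ck k W f"
  shows "Ck k U f"
  using assms
proof (induction k arbitrary: f)
  case 0
  show ?case unfolding continuously_differentiable_times.simps
  proof (rule continuous_at_imp_continuous_on, rule ballI)
    fix x assume "x \<in> U"
    then obtain W where "open W" "x \<in> W" "continuous_on W f" using 0 by auto
    then show "isCont f x" by (simp add: continuous_on_eq_continuous_at)
  qed
next
  case (Suc k)
  have "f differentiable (at x)" if "x \<in> U" for x
    using Suc.prems[OF that] by auto
  moreover have "Ck k U (\<lambda>x. frechet_derivative f (at x) v)" for v
  proof (rule Suc.IH)
    fix x assume "x \<in> U"
    from Suc.prems[OF this] show "\<exists>W. open W \<and> x \<in> W \<and> Ck k W (\<lambda>x. frechet_derivative f (at x) v)"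
      by auto
  qed
  ultimately show ?case by simp
qed

lemma Ck_const: "Ck k U (\<lambda>x. c)"
  by (induction k arbitrary: c) auto

lemma Ck_bounded_linear:
  assumes "open U" "bounded_linear L" "Ck k U f"
  shows "Ck k U (\<lambda>x. L (f x))"
  using assms(3)
proof (induction k arbitrary: f)
  case 0
  then show ?case using bounded_linear.continuous_on[OF assms(2)] by simp
next
  case (Suc k)
  show ?case
  proof (rule Ck_SucI[OF assms(1)])
    show "((\<lambda>x. L (f x)) has_derivative (\<lambda>v. L (frechet_derivative f (at x) v))) (at x)" if "x \<in> U" for x
      by (rule bounded_linear.has_derivative[OF assms(2) Ck_SucD[OF Suc.prems that]])
    show "Ck k U (\<lambda>x. L (frechet_derivative f (at x) v))" for v
      using Suc by simp
  qed
qed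

lemma Ck_id: "open U \<Longrightarrow> Ck k U (\<lambda>x. x)"
proof (cases k)
  case (Suc j)
  assume "open U"
  then show ?thesis unfolding Suc
    by (intro Ck_SucI[of U _ "\<lambda>x v. v"] Ck_const) auto
qed auto

lemma Ck_add:
  assumes "open U" "Ck k U f" "Ck k U g"
  shows "Ck k U (\<lambda>x. f x + g x)"
  using assms(2,3)
proof (induction k arbitrary: f g)
  case (Suc k)
  show ?case
    by (rule Ck_SucI[OF assms(1) has_derivative_add[OF Ck_SucD[OF Suc.prems(1)] Ck_SucD[OF Suc.prems(2)]]])
      (use Suc in auto)
qed (auto intro: continuous_on_add)

lemma Ck_sum:
  assumes "open U" "\<And>i. i \<in> I \<Longrightarrow> Ck k U (f i)"
  shows "Ck k U (\<lambda>x. \<Sum>i\<in>I. f i x)"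
  using assms(2) by (induction I rule: infinite_finite_induct) (auto intro: Ck_const Ck_add[OF assms(1)])

lemma Ck_bilinear:
  assumes "open U" "bounded_bilinear B" "Ck k U f" "Ck k U g"
  shows "Ck k U (\<lambda>x. B (f x) (g x))"
  using assms(3,4)
proof (induction k arbitrary: f g)
  case 0
  then show ?case using bounded_bilinear.continuous_on[OF assms(2)] by simp
next
  case (Suc k)
  show ?case
    by (rule Ck_SucI[OF assms(1) bounded_bilinear.FDERIV[OF assms(2) Ck_SucD[OF Suc.prems(1)] Ck_SucD[OF Suc.prems(2)]]])
      (use Suc Suc.prems[THEN Ck_Suc_imp] in \<open>auto intro!: Ck_add[OF assms(1)] Suc.IH simp del: continuously_differentiable_times.simps(2)\<close>,
       (use Suc.prems in auto)+)
qed

text \<open>In the chain rule the outer derivative is taken in a direction that varies with the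
  point, whereas the recursion allows fixed directions only. Expanding that direction in the basis
  leaves sums of products, to which the induction hypothesis and \<open>Ck_bilinear\<close>
  apply.\<close>

lemma Ck_compose:
  fixes f :: "'a::euclidean_space \<Rightarrow> 'b::euclidean_space" and g :: "'b \<Rightarrow> 'c::real_normed_vector"
  assumes "open U" "open W" "f ` U \<subseteq> W" "Ck k U f" "Ck k W g"
  shows "Ck k U (\<lambda>x. g (f x))"
  using assms(4,5)
proof (induction k arbitrary: g)
  case 0
  then show ?case using assms(3) by (auto intro: continuous_on_compose2)
next
  case (Suc k)
  define Dg where "Dg = (\<lambda>y. frechet_derivative g (at y))"
  define Df where "Df = (\<lambda>x. frechet_derivative f (at x))"
  have f: "(f has_derivative Df x) (at x)" if "x \<in> U" for x
    using Ck_SucD[OF Suc.prems(1) that] by (simp add: Df_def)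
  have g: "(g has_derivative Dg (f x)) (at (f x))" if "x \<in> U" for x
    using Ck_SucD[OF Suc.prems(2)] that assms(3) by (auto simp: Dg_def)
  have "Dg (f x) (Df x v) = (\<Sum>i\<in>Basis. (Df x v \<bullet> i) *\<^sub>R Dg (f x) i)" if "x \<in> U" for x v
  proof -
    interpret linear "Dg (f x)" using g[OF that] by (rule has_derivative_linear)
    have "Dg (f x) (Df x v) = Dg (f x) (\<Sum>i\<in>Basis. (Df x v \<bullet> i) *\<^sub>R i)"
      by (simp add: euclidean_representation)
    then show ?thesis by (simp add: sum scale)
  qed
  then have d: "((\<lambda>x. g (f x)) has_derivative (\<lambda>v. \<Sum>i\<in>Basis. (Df x v \<bullet> i) *\<^sub>R Dg (f x) i)) (at x)"
    if "x \<in> U" for x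
    using has_derivative_compose[OF f[OF that] g[OF that]] that by (simp add: that)
  show ?case
  proof (rule Ck_SucI[OF assms(1) d])
    have "Ck k U (\<lambda>x. Df x v)" for v using Suc.prems(1) by (simp add: Df_def)
    moreover have "Ck k W (\<lambda>y. Dg y i)" for i using Suc.prems(2) by (simp add: Dg_def)
    ultimately show "Ck k U (\<lambda>x. \<Sum>i\<in>Basis. (Df x v \<bullet> i) *\<^sub>R Dg (f x) i)" for v
      using Ck_Suc_imp[OF Suc.prems(1)]
      by (intro Ck_sum Ck_bilinear[OF assms(1) bounded_bilinear_scaleR] assms(1)
          Ck_bounded_linear[OF assms(1) bounded_linear_inner_left] Suc.IH) auto
  qed auto
qed

lemma smooth_on_cong: "open U \<Longrightarrow> (\<And>x. x \<in> U \<Longrightarrow> f x = g x) \<Longrightarrow> smooth_on U f \<Longrightarrow> smooth_on U g"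
  unfolding smooth_on_def using Ck_cong by blast

lemma smooth_on_subset: "smooth_on U f \<Longrightarrow> V \<subseteq> U \<Longrightarrow> smooth_on V f"
  unfolding smooth_on_def using Ck_subset by blast

lemma smooth_on_local:
  "(\<And>x. x \<in> U \<Longrightarrow> \<exists>W. open W \<and> x \<in> W \<and> smooth_on W f) \<Longrightarrow> smooth_on U f"
  unfolding smooth_on_def by (intro allI Ck_local) metis

lemma smooth_on_const: "smooth_on U (\<lambda>x. c)"
  by (simp add: smooth_on_def Ck_const)

lemma smooth_on_bounded_linear:
  "open U \<Longrightarrow> bounded_linear L \<Longrightarrow> smooth_on U f \<Longrightarrow> smooth_on U (\<lambda>x. L (f x))"
  by (simp add: smooth_on_def Ck_bounded_linear)

lemma smooth_on_id: "open U \<Longrightarrow> smooth_on U (\<lambda>x. x)"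
  by (simp add: smooth_on_def Ck_id)

lemma smooth_on_nth: "open U \<Longrightarrow> smooth_on U (\<lambda>x :: real^'n. x $ i)"
  by (rule smooth_on_bounded_linear[OF _ bounded_linear_vec_nth smooth_on_id])

lemma smooth_on_add: "open U \<Longrightarrow> smooth_on U f \<Longrightarrow> smooth_on U g \<Longrightarrow> smooth_on U (\<lambda>x. f x + g x)"
  by (simp add: smooth_on_def Ck_add)

lemma smooth_on_bilinear:
  "open U \<Longrightarrow> bounded_bilinear B \<Longrightarrow> smooth_on U f \<Longrightarrow> smooth_on U g \<Longrightarrow> smooth_on U (\<lambda>x. B (f x) (g x))"
  by (simp add: smooth_on_def Ck_bilinear)

lemma smooth_on_scaleR:
  "open U \<Longrightarrow> smooth_on U f \<Longrightarrow> smooth_on U g \<Longrightarrow> smooth_on U (\<lambda>x. f x *\<^sub>R g x)"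
  by (rule smooth_on_bilinear[OF _ bounded_bilinear_scaleR])

lemma smooth_on_mult:
  fixes f g :: "'a::euclidean_space \<Rightarrow> real"
  shows "open U \<Longrightarrow> smooth_on U f \<Longrightarrow> smooth_on U g \<Longrightarrow> smooth_on U (\<lambda>x. f x * g x)"
  by (rule smooth_on_bilinear[OF _ bounded_bilinear_mult])

lemma smooth_on_uminus: "open U \<Longrightarrow> smooth_on U f \<Longrightarrow> smooth_on U (\<lambda>x. - f x)"
  by (rule smooth_on_bounded_linear[OF _ bounded_linear_minus[OF bounded_linear_ident]])

lemma smooth_on_diff: "open U \<Longrightarrow> smooth_on U f \<Longrightarrow> smooth_on U g \<Longrightarrow> smooth_on U (\<lambda>x. f x - g x)"
  using smooth_on_add[of U f "\<lambda>x. - g x"] by (simp add: smooth_on_uminus)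

lemma smooth_on_power:
  fixes f :: "'a::euclidean_space \<Rightarrow> real"
  shows "open U \<Longrightarrow> smooth_on U f \<Longrightarrow> smooth_on U (\<lambda>x. f x ^ n)"
  by (induction n) (auto intro: smooth_on_const smooth_on_mult)

lemma smooth_on_compose:
  fixes f :: "'a::euclidean_space \<Rightarrow> 'b::euclidean_space" and g :: "'b \<Rightarrow> 'c::real_normed_vector"
  assumes "smooth_on W g" "open U" "open W" "f ` U \<subseteq> W" "smooth_on U f"
  shows "smooth_on U (\<lambda>x. g (f x))"
  using assms by (auto simp: smooth_on_def intro: Ck_compose)

lemma smooth_on_vector_4:
  assumes "open U" "smooth_on U f" "smooth_on U g" "smooth_on U h" "smooth_on U k"
  shows "smooth_on U (\<lambda>x. vector [f x, g x, h x, k x] :: real^4)"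
  unfolding vector_4_axis using assms by (intro smooth_on_add smooth_on_scaleR smooth_on_const)

lemma smooth_on_poly: "smooth_on UNIV (poly p :: real \<Rightarrow> real)"
proof -
  have "Ck k UNIV (poly p)" for k and p :: "real poly"
  proof (induction k arbitrary: p)
    case (Suc k)
    show ?case
    proof (rule Ck_SucI)
      show "(poly p has_derivative (\<lambda>v. poly (pderiv p) x * v)) (at x)" for x
        using poly_DERIV[of p x] by (simp add: has_field_derivative_def)
      show "Ck k UNIV (\<lambda>x. poly (pderiv p) x * v)" for v
        by (intro Ck_bounded_linear[OF _ bounded_linear_mult_left] Suc) auto
    qed auto
  qed (simp add: continuous_at_imp_continuous_on)
  then show ?thesis by (simp add: smooth_on_def)
qed

text \<open>The derivative is minus the square of the function itself, so each order of
  differentiability yields the next.\<close>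

lemma smooth_on_inverse: "smooth_on {x. x \<noteq> 0} (inverse :: real \<Rightarrow> real)"
proof -
  have o: "open {x :: real. x \<noteq> 0}" by (simp add: open_Collect_neq)
  have "Ck k {x. x \<noteq> 0} (inverse :: real \<Rightarrow> real)" for k
  proof (induction k)
    case 0
    show ?case by (auto intro!: continuous_intros)
  next
    case (Suc k)
    show ?case
    proof (rule Ck_SucI[OF o])
      show "(inverse has_derivative (\<lambda>v. (inverse x * inverse x) * - v)) (at x)"
        if "x \<in> {x. x \<noteq> 0}" for x :: real
        using that by (auto intro!: derivative_eq_intros)
      show "Ck k {x. x \<noteq> 0} (\<lambda>x :: real. (inverse x * inverse x) * - v)" for v
        by (intro Ck_bounded_linear[OF o bounded_linear_mult_left] Ck_bilinear[OF o bounded_bilinear_mult] Suc)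
    qed
  qed
  then show ?thesis by (simp add: smooth_on_def)
qed

text \<open>The derivative is half the inverse of the function itself, which again lets the
  induction reproduce.\<close>

lemma smooth_on_sqrt: "smooth_on {0<..} sqrt"
proof -
  have "Ck k {0<..} sqrt" for k
  proof (induction k)
    case 0
    show ?case by (auto intro!: continuous_intros)
  next
    case (Suc k)
    show ?case
    proof (rule Ck_SucI)
      show "(sqrt has_derivative (\<lambda>v. inverse (sqrt x) * (v / 2))) (at x)" if "x \<in> {0<..}" for x :: real
        using that by (auto intro!: derivative_eq_intros simp: field_simps)
      have "Ck k {0<..} (\<lambda>x. inverse (sqrt x))"
        using smooth_on_inverse
        by (intro Ck_compose[of _ "{x. x \<noteq> 0}" sqrt k inverse] Suc)
          (auto simp: smooth_on_def open_Collect_neq)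
      then show "Ck k {0<..} (\<lambda>x. inverse (sqrt x) * (v / 2))" for v
        by (intro Ck_bounded_linear[OF _ bounded_linear_mult_left]) auto
    qed auto
  qed
  then show ?thesis by (simp add: smooth_on_def)
qed

lemma smooth_on_divide:
  fixes f g :: "'a::euclidean_space \<Rightarrow> real"
  assumes "open U" "smooth_on U f" "smooth_on U g" "\<And>x. x \<in> U \<Longrightarrow> g x \<noteq> 0"
  shows "smooth_on U (\<lambda>x. f x / g x)"
proof -
  have "smooth_on U (\<lambda>x. inverse (g x))"
    using assms by (intro smooth_on_compose[OF smooth_on_inverse]) (auto simp: open_Collect_neq)
  then show ?thesis
    using assms by (simp add: divide_inverse smooth_on_mult)
qed

lemma smooth_on_imp_smooth_along:
  "open U \<Longrightarrow> S \<subseteq> U \<Longrightarrow> smooth_on U F \<Longrightarrow> (\<And>x. x \<in> S \<Longrightarrow> F x = f x) \<Longrightarrow> smooth_along S f"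
  unfolding smooth_along_def smooth_on_def by blast

lemma smooth_on_has_derivative:
  assumes "smooth_on U f" "x \<in> U"
  shows "(f has_derivative frechet_derivative f (at x)) (at x)"
  using assms Ck_SucD[of 0 U f x] unfolding smooth_on_def by blast

section \<open>A hypergeometric polynomial\<close>

text \<open>The coefficient (1-n)_j (1+n)_j / ((2)_j j!) of 2F1(1-n, 1+n; 2; t) in binomial form.
  For positive \<open>n\<close> the first binomial vanishes from \<open>j = n\<close> on, so the
  series terminates.\<close>

definition hyper_coeff :: "nat \<Rightarrow> nat \<Rightarrow> real" where
  "hyper_coeff n j = (- 1) ^ j * real ((n - 1) choose j) * real ((n + j) choose (j + 1)) / real n"

lemma hyper_coeff_recurrence:
  assumes "n \<ge> 1"
  shows "(real j + 1) * (real j + 2) * hyper_coeff n (Suc j) = ((real j + 1)\<^sup>2 - (real n)\<^sup>2) * hyper_coeff n j"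
proof -
  have 1: "(real j + 1) * real ((n - 1) choose Suc j) = (real n - 1 - real j) * real ((n - 1) choose j)"
  proof (cases "j \<le> n - 1")
    case True
    have "Suc j * ((n - 1) choose Suc j) = (n - 1 - j) * ((n - 1) choose j)"
      by (metis binomial_absorption binomial_absorb_comp)
    then have "real (Suc j * ((n - 1) choose Suc j)) = real ((n - 1 - j) * ((n - 1) choose j))" by simp
    moreover have "real (n - 1 - j) = real n - 1 - real j" using True assms by simp
    ultimately show ?thesis by (simp only: of_nat_mult of_nat_Suc add.commute[of 1 "real j"])
  qed (simp add: binomial_eq_0)
  have "Suc (n + j) * ((n + j) choose (j + 1)) = (Suc (n + j) choose (j + 2)) * (j + 2)"
    using Suc_times_binomial_eq[of "n + j" "j + 1"] by simp
  then have "real (Suc (n + j) * ((n + j) choose (j + 1))) = real ((Suc (n + j) choose (j + 2)) * (j + 2))" by simp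
  then have 2: "(real j + 2) * real ((n + Suc j) choose (Suc j + 1)) = (real n + real j + 1) * real ((n + j) choose (j + 1))"
    by (simp add: algebra_simps)
  have "(real j + 1) * (real j + 2) * hyper_coeff n (Suc j) =
     - ((- 1) ^ j) * ((real j + 1) * real ((n - 1) choose Suc j)) * ((real j + 2) * real ((n + Suc j) choose (Suc j + 1))) / real n"
    by (simp add: hyper_coeff_def)
  also have "\<dots> = ((real j + 1)\<^sup>2 - (real n)\<^sup>2) * hyper_coeff n j"
    unfolding 1 2 by (simp add: hyper_coeff_def algebra_simps power2_eq_square)
  finally show ?thesis .
qed

text \<open>The value at 1 of the hypergeometric polynomial, by the Chu-Vandermonde identity. Its
  sign enters the Hopf invariant.\<close>

lemma sum_hyper_coeff:
  assumes "n \<ge> 1"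
  shows "(\<Sum>j<n. hyper_coeff n j) = (- 1) ^ (n - 1) / real n"
proof -
  have "real n * (\<Sum>j<n. hyper_coeff n j) = (\<Sum>j<n. (- 1) ^ j * real ((n - 1) choose j) * real ((n + j) choose (j + 1)))"
    using assms by (simp add: hyper_coeff_def sum_distrib_left)
  \<comment> \<open>Upper negation brings \<open>- n\<close> to the top of one binomial and symmetry
    gives the other the lower index \<open>n - Suc j\<close>, so that the two lower indices add up
    to \<open>n\<close>.\<close>
  also have "\<dots> = (\<Sum>j<n. - ((- real n gchoose Suc j) * (real (n - 1) gchoose (n - Suc j))))"
  proof (rule sum.cong)
    fix j assume "j \<in> {..<n}"
    then have j: "j < n" by simp
    have "(- real n gchoose Suc j) = (- 1) ^ Suc j * (real n + real (Suc j) - 1 gchoose Suc j)"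
      by (rule gbinomial_minus)
    also have "real n + real (Suc j) - 1 = real (n + j)" by simp
    finally have "(- real n gchoose Suc j) = (- 1) ^ Suc j * real ((n + j) choose Suc j)"
      by (simp only: binomial_gbinomial)
    moreover have "real (n - 1) gchoose (n - Suc j) = real ((n - 1) choose j)"
      using j binomial_symmetric[of j "n - 1"] by (simp del: of_nat_diff flip: binomial_gbinomial)
    ultimately show "(- 1) ^ j * real ((n - 1) choose j) * real ((n + j) choose (j + 1)) =
        - ((- real n gchoose Suc j) * (real (n - 1) gchoose (n - Suc j)))"
      by simp
  qed simp
  also have "\<dots> = - (\<Sum>k\<in>{1..n}. (- real n gchoose k) * (real (n - 1) gchoose (n - k)))"
    unfolding sum_negf
    by (subst image_Suc_lessThan[symmetric], subst sum.reindex) (auto simp: o_def)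
  \<comment> \<open>The index 0, missing after the shift, contributes nothing, since
    \<open>n\<close> exceeds \<open>n - 1\<close>.\<close>
  also have "(\<Sum>k\<in>{1..n}. (- real n gchoose k) * (real (n - 1) gchoose (n - k))) =
      (\<Sum>k\<le>n. (- real n gchoose k) * (real (n - 1) gchoose (n - k)))"
  proof (rule sum.mono_neutral_left)
    have "real (n - 1) gchoose n = 0"
      using assms by (simp del: of_nat_diff flip: binomial_gbinomial)
    then show "\<forall>k\<in>{..n} - {1..n}. (- real n gchoose k) * (real (n - 1) gchoose (n - k)) = 0"
      by (auto simp: not_less_eq_eq)
  qed auto
  also have "\<dots> = (- real n + real (n - 1)) gchoose n"
    using gbinomial_Vandermonde[of "- real n" "real (n - 1)" n] by (simp only: atMost_atLeast0)
  also have "- real n + real (n - 1) = - 1" using assms by (simp add: of_nat_diff)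
  also have "(- 1 :: real) gchoose n = (- 1) ^ n"
    using gbinomial_minus[of "1::real" n] by (simp flip: binomial_gbinomial)
  also have "- ((- 1) ^ n) = (- 1 :: real) ^ (n - 1)"
    using assms by (cases n) auto
  finally show ?thesis using assms by (simp add: field_simps)
qed

definition hyper_poly :: "nat \<Rightarrow> real poly" where
  "hyper_poly n = (\<Sum>j<n. Polynomial.monom (hyper_coeff n j) j)"

lemma coeff_hyper_poly: "Polynomial.coeff (hyper_poly n) j = hyper_coeff n j"
proof -
  have "hyper_coeff n j = 0" if "\<not> j < n"
    using that by (cases "n = 0") (auto simp: hyper_coeff_def binomial_eq_0)
  then show ?thesis by (simp add: hyper_poly_def coeff_sum)
qed

text \<open>The first equation is the choice of \<open>Q\<close>. Coefficientwise the second is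
  \<open>hyper_coeff_recurrence\<close>, into which only the square of \<open>m\<close> enters;
  therefore both signs of \<open>m\<close> share the same \<open>P\<close>.\<close>

lemma hyper_poly_system:
  fixes m :: int
  assumes m: "m \<noteq> 0"
  defines "P \<equiv> hyper_poly (nat \<bar>m\<bar>)"
  defines "Q \<equiv> Polynomial.smult (1 / of_int m) (P + pCons 0 (pderiv P))"
  shows "Polynomial.smult (of_int m) Q = P + pCons 0 (pderiv P)"
    and "Polynomial.smult (of_int m) P = Q - (pderiv Q - pCons 0 (pderiv Q))"
proof -
  let ?n = "nat \<bar>m\<bar>"
  show "Polynomial.smult (of_int m) Q = P + pCons 0 (pderiv P)"
    using m by (simp add: Q_def)
  have n: "?n \<ge> 1" "(real ?n)\<^sup>2 = (of_int m)\<^sup>2" using m by auto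
  have Q: "Polynomial.coeff Q j = (real j + 1) * hyper_coeff ?n j / of_int m" for j
    by (cases j) (simp_all add: Q_def P_def coeff_hyper_poly coeff_pderiv coeff_pCons algebra_simps add_divide_distrib)
  show "Polynomial.smult (of_int m) P = Q - (pderiv Q - pCons 0 (pderiv Q))"
  proof (rule poly_eqI)
    fix j
    have "Polynomial.coeff (Q - (pderiv Q - pCons 0 (pderiv Q))) j = (real j + 1) * (Polynomial.coeff Q j - Polynomial.coeff Q (Suc j))"
      by (cases j) (simp_all add: coeff_pderiv coeff_pCons algebra_simps)
    also have "\<dots> = ((real j + 1)\<^sup>2 * hyper_coeff ?n j - (real j + 1) * (real j + 2) * hyper_coeff ?n (Suc j)) / of_int m"
      using m by (simp add: Q field_simps power2_eq_square)
    also have "\<dots> = of_int m * hyper_coeff ?n j"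
      unfolding hyper_coeff_recurrence[OF n(1)] n(2) using m by (simp add: field_simps power2_eq_square)
    finally show "Polynomial.coeff (Polynomial.smult (of_int m) P) j = Polynomial.coeff (Q - (pderiv Q - pCons 0 (pderiv Q))) j"
      by (simp add: P_def coeff_hyper_poly)
  qed
qed

text \<open>At a zero of order k of \<open>p\<close> the derivative has order k - 1, and
  multiplication by \<open>g\<close> preserves this, so the sum \<open>r\<close> has order k -
  1.\<close>

lemma order_less_if_first_order:
  fixes p r g :: "real poly"
  assumes "p \<noteq> 0" "poly p t = 0" "poly g t \<noteq> 0" "r = p + g * pderiv p" "r \<noteq> 0"
  shows "Polynomial.order t r < Polynomial.order t p"
proof (rule ccontr)
  assume *: "\<not> Polynomial.order t r < Polynomial.order t p"
  have g: "g \<noteq> 0" using assms(3) by auto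
  have p': "pderiv p \<noteq> 0"
  proof
    assume "pderiv p = 0"
    then obtain c where "p = [:c:]" by (metis pderiv_eq_0_iff degree_eq_zeroE)
    then show False using assms(1,2) by simp
  qed
  have "[:- t, 1:] ^ Polynomial.order t p dvd r" using * assms(5) by (simp add: order_divides)
  moreover have "[:- t, 1:] ^ Polynomial.order t p dvd p" by (rule order_1)
  ultimately have "[:- t, 1:] ^ Polynomial.order t p dvd g * pderiv p" using assms(4) by (metis dvd_add_right_iff)
  then have "Polynomial.order t p \<le> Polynomial.order t (g * pderiv p)" using g p' by (simp add: order_divides)
  also have "\<dots> = Polynomial.order t g + Polynomial.order t (pderiv p)" using g p' by (simp add: order_mult)
  also have "Polynomial.order t g = 0" using assms(3) by (rule order_0I)
  finally show False using order_pderiv[OF assms(1,2)] by simp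
qed

text \<open>Each equation is a first-order operator, regular away from 0 and 1, that takes one
  polynomial to a multiple of the other. At a common root each would therefore have smaller order
  than the other. This stands in for uniqueness of solutions of the linear differential
  system.\<close>

lemma hyper_poly_no_common_root:
  fixes m :: real and P Q :: "real poly"
  assumes m: "m \<noteq> 0" and sys: "Polynomial.smult m Q = P + pCons 0 (pderiv P)"
      "Polynomial.smult m P = Q - (pderiv Q - pCons 0 (pderiv Q))"
    and "P \<noteq> 0" and t: "t \<noteq> 0" "t \<noteq> 1"
  shows "poly P t \<noteq> 0 \<or> poly Q t \<noteq> 0"
proof (rule ccontr)
  assume "\<not> ?thesis"
  then have z: "poly P t = 0" "poly Q t = 0" by auto
  have Q0: "Q \<noteq> 0" using sys(2) m \<open>P \<noteq> 0\<close> by auto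
  have "Polynomial.order t (Polynomial.smult m Q) < Polynomial.order t P"
    by (rule order_less_if_first_order[of P t "[:0, 1:]"]) (use m Q0 z sys \<open>P \<noteq> 0\<close> t in auto)
  moreover have "Polynomial.order t (Polynomial.smult m P) < Polynomial.order t Q"
    by (rule order_less_if_first_order[of Q t "[:- 1, 1:]"]) (use m Q0 z sys \<open>P \<noteq> 0\<close> t in auto)
  ultimately show False using m by (simp add: order_smult)
qed

lemma hyper_poly_root:
  fixes m :: real and P Q :: "real poly"
  assumes m: "m\<^sup>2 \<noteq> 1" and sys: "Polynomial.smult m Q = P + pCons 0 (pderiv P)"
      "Polynomial.smult m P = Q - (pderiv Q - pCons 0 (pderiv Q))"
  shows "\<exists>t. 0 < t \<and> t < 1 \<and> poly P t = 0"
proof -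
  have e1: "m * poly Q t = poly P t + t * poly (pderiv P) t" for t
    using arg_cong[OF sys(1), of "\<lambda>p. poly p t"] by simp
  have e2: "m * poly P t = poly Q t - (1 - t) * poly (pderiv Q) t" for t
    using arg_cong[OF sys(2), of "\<lambda>p. poly p t"] by (simp add: algebra_simps)
  \<comment> \<open>By the first equation this is t^2 (1-t) P'. The formula for its derivative is
    the hypergeometric equation in self-adjoint form, (t^2 (1-t) P')' = (1 - m^2) t P.\<close>
  define K where "K = (\<lambda>t. t * (1 - t) * (m * poly Q t - poly P t))"
  have dK: "(K has_real_derivative (1 - m\<^sup>2) * t * poly P t) (at t)" for t
  proof -
    have "(K has_real_derivative ((1 - t) - t) * (m * poly Q t - poly P t)
       + t * (1 - t) * (m * poly (pderiv Q) t - poly (pderiv P) t)) (at t)"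
      unfolding K_def by (auto intro!: derivative_eq_intros poly_DERIV simp: algebra_simps)
    moreover have "((1 - t) - t) * (m * poly Q t - poly P t)
       + t * (1 - t) * (m * poly (pderiv Q) t - poly (pderiv P) t) = (1 - m\<^sup>2) * t * poly P t"
      using e1[of t] e2[of t] by Groebner_Basis.algebra
    ultimately show ?thesis by simp
  qed
  have "\<exists>z>0. z < 1 \<and> DERIV K z :> 0"
    by (rule Rolle) (use dK in \<open>auto simp: K_def intro!: continuous_intros simp: real_differentiable_def\<close>)
  then obtain z where z: "0 < z" "z < 1" "DERIV K z :> 0" by blast
  then have "(1 - m\<^sup>2) * z * poly P z = 0" using DERIV_unique[OF dK] by blast
  then show ?thesis using z m by auto
qed

lemma hyper_poly_values:
  assumes "n \<ge> 1"
  shows "poly (hyper_poly n) 0 = 1" "poly (hyper_poly n) 1 = (- 1) ^ (n - 1) / real n"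
proof -
  have "poly (hyper_poly n) 0 = Polynomial.coeff (hyper_poly n) 0" by (rule poly_0_coeff_0)
  also have "\<dots> = 1" using assms by (simp only: coeff_hyper_poly) (simp add: hyper_coeff_def)
  finally show "poly (hyper_poly n) 0 = 1" .
  show "poly (hyper_poly n) 1 = (- 1) ^ (n - 1) / real n"
    using sum_hyper_coeff[OF assms] by (simp add: hyper_poly_def poly_sum poly_monom)
qed

section \<open>Torus-invariant curl eigenfields\<close>

lemma contact_form_of_curl_eigenfield:
  assumes V: "curl_eigenfield V lam" and nv: "nonvanishing V"
  shows "contact_form (flat V)"
proof -
  have lam: "lam \<noteq> 0" and tan: "\<And>x. x \<in> S3 \<Longrightarrow> V x \<bullet> x = 0"
    and curl: "\<And>x. x \<in> S3 \<Longrightarrow> curl_S3 V x = lam *\<^sub>R V x" and sm: "smooth_along S3 V"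
    using V by (auto simp: curl_eigenfield_def smooth_vector_field_def tangent_S3_def)
  obtain U F where U: "open U" "S3 \<subseteq> U" "smooth_on U F" "\<And>x. x \<in> S3 \<Longrightarrow> F x = V x"
    using sm unfolding smooth_along_def smooth_on_def by metis
  have "smooth_along S3 (flat V)"
  proof (rule smooth_on_imp_smooth_along[OF U(1,2)])
    show "smooth_on U (\<lambda>x. blinfun_inner_right (F x))"
      by (rule smooth_on_bounded_linear[OF U(1) bounded_linear_blinfun_inner_right U(3)])
  qed (simp add: flat_def U(4))
  moreover have "wedge12 (flat V) (ext_deriv (flat V)) p (frame_R p) (frame_X1 p) (frame_X2 p) \<noteq> 0"
    if p: "p \<in> S3" for p
  proof -
    have D: "(F has_derivative frechet_derivative F (at p)) (at p)"
      using smooth_on_has_derivative[OF U(3)] U(2) p by blast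
    have ed: "ext_deriv (flat V) p u v = lam * vol_S3 p (V p) u v" if "u \<bullet> p = 0" "v \<bullet> p = 0" for u v
      using ext_deriv_flat_eq[OF p that D U(4)] ext_deriv_flat_curl[OF p D U(4) that] curl[OF p]
      by (simp add: vol_S3_scale)
    have "wedge12 (flat V) (ext_deriv (flat V)) p (frame_R p) (frame_X1 p) (frame_X2 p)
      = lam * (frame_coords p (V p) \<bullet> frame_coords p (V p))"
      by (simp add: wedge12_def ed frame_inner vol_S3_frame[OF p] inner_3 frame_coords_def algebra_simps)
    also have "\<dots> = lam * (V p \<bullet> V p)"
      using frame_coords_inner[OF p tan[OF p]] by simp
    finally show ?thesis using lam nv p by (simp add: nonvanishing_def)
  qed
  ultimately show ?thesis by (simp add: contact_form_def)
qed

definition radius1 :: "real^4 \<Rightarrow> real" where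
  "radius1 x = (x$1)\<^sup>2 + (x$2)\<^sup>2"

definition rot1 :: "real^4 \<Rightarrow> real^4" where
  "rot1 x = vector [- x$2, x$1, 0, 0]"

definition rot2 :: "real^4 \<Rightarrow> real^4" where
  "rot2 x = vector [0, 0, - x$4, x$3]"

text \<open>\<open>rot1\<close> and \<open>rot2\<close> are the fields d/da and d/db. Coefficients
  polynomial in |z1|^2 keep the field smooth on all of R^4, including the points where an angle is
  undefined.\<close>

definition torus_field :: "real poly \<Rightarrow> real poly \<Rightarrow> real^4 \<Rightarrow> real^4" where
  "torus_field P Q x = poly P (radius1 x) *\<^sub>R rot1 x + poly Q (radius1 x) *\<^sub>R rot2 x"

lemma S3_coords: "p \<in> S3 \<longleftrightarrow> (p$1)\<^sup>2 + (p$2)\<^sup>2 + (p$3)\<^sup>2 + (p$4)\<^sup>2 = 1"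
  by (simp add: norm_eq_1 inner_4 power2_eq_square)

lemma radius1_S3:
  assumes "p \<in> S3"
  shows "0 \<le> radius1 p" "radius1 p \<le> 1" "1 - radius1 p = (p$3)\<^sup>2 + (p$4)\<^sup>2"
  using assms[unfolded S3_coords] zero_le_power2[of "p$1"] zero_le_power2[of "p$2"]
    zero_le_power2[of "p$3"] zero_le_power2[of "p$4"]
  unfolding radius1_def by linarith+

lemma has_derivative_radius1:
  "(radius1 has_derivative (\<lambda>v. 2 * (x$1 * v$1 + x$2 * v$2))) (at x)"
  unfolding radius1_def
  by (auto intro!: derivative_eq_intros bounded_linear_imp_has_derivative[OF bounded_linear_vec_nth]
      simp: algebra_simps)

lemma bounded_linear_rot: "bounded_linear rot1" "bounded_linear rot2"
  by (intro linear_conv_bounded_linear[THEN iffD1] linearI;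
      simp add: rot1_def rot2_def vec_eq_iff forall_4)+

lemma smooth_on_radius1: "open U \<Longrightarrow> smooth_on U radius1"
  unfolding radius1_def by (intro smooth_on_add smooth_on_power smooth_on_nth)

lemma smooth_on_comp_radius1:
  "smooth_on W g \<Longrightarrow> open W \<Longrightarrow> open U \<Longrightarrow> radius1 ` U \<subseteq> W \<Longrightarrow> smooth_on U (\<lambda>x. g (radius1 x))"
  by (rule smooth_on_compose[OF _ _ _ _ smooth_on_radius1])

lemma smooth_on_torus_field: "smooth_on UNIV (torus_field P Q)"
  unfolding torus_field_def
  by (intro smooth_on_add smooth_on_scaleR smooth_on_comp_radius1[OF smooth_on_poly]
      smooth_on_bounded_linear[OF _ bounded_linear_rot(1) smooth_on_id]
      smooth_on_bounded_linear[OF _ bounded_linear_rot(2) smooth_on_id]) auto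

lemma torus_field_tangent: "torus_field P Q p \<bullet> p = 0"
  by (simp add: torus_field_def rot1_def rot2_def inner_add_left inner_4)

lemma has_derivative_rot_field:
  fixes x :: "real^4"
  assumes "(f has_real_derivative f') (at (radius1 x))" "(g has_real_derivative g') (at (radius1 x))"
  shows "((\<lambda>x. f (radius1 x) *\<^sub>R rot1 x + g (radius1 x) *\<^sub>R rot2 x) has_derivative
     (\<lambda>v. (f' * (2 * (x$1 * v$1 + x$2 * v$2))) *\<^sub>R rot1 x + f (radius1 x) *\<^sub>R rot1 v
        + (g' * (2 * (x$1 * v$1 + x$2 * v$2))) *\<^sub>R rot2 x + g (radius1 x) *\<^sub>R rot2 v)) (at x)"
proof -
  note p = assms[unfolded has_field_derivative_def, THEN has_derivative_compose[OF has_derivative_radius1[of x]]]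
  show ?thesis
    by (rule has_derivative_eq_rhs[OF has_derivative_add[OF
          has_derivative_scaleR[OF p(1) bounded_linear_imp_has_derivative[OF bounded_linear_rot(1)]]
          has_derivative_scaleR[OF p(2) bounded_linear_imp_has_derivative[OF bounded_linear_rot(2)]]]])
      (simp add: fun_eq_iff algebra_simps)
qed

lemma has_derivative_torus_field:
  fixes x :: "real^4"
  shows "(torus_field P Q has_derivative
     (\<lambda>v. (poly (pderiv P) (radius1 x) * (2 * (x$1 * v$1 + x$2 * v$2))) *\<^sub>R rot1 x
        + poly P (radius1 x) *\<^sub>R rot1 v
        + (poly (pderiv Q) (radius1 x) * (2 * (x$1 * v$1 + x$2 * v$2))) *\<^sub>R rot2 x
        + poly Q (radius1 x) *\<^sub>R rot2 v)) (at x)"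
  unfolding torus_field_def by (rule has_derivative_rot_field[OF poly_DERIV poly_DERIV])

lemma torus_field_norm:
  assumes "p \<in> S3"
  shows "torus_field P Q p \<bullet> torus_field P Q p =
    radius1 p * (poly P (radius1 p))\<^sup>2 + (1 - radius1 p) * (poly Q (radius1 p))\<^sup>2"
  unfolding radius1_S3(3)[OF assms]
  by (simp add: torus_field_def rot1_def rot2_def inner_4 power2_eq_square)
    (simp add: radius1_def algebra_simps power2_eq_square)

lemma curl_torus_field:
  assumes sys: "Polynomial.smult m Q = P + pCons 0 (pderiv P)" "Polynomial.smult m P = Q - (pderiv Q - pCons 0 (pderiv Q))"
    and p: "p \<in> S3"
  shows "curl_S3 (torus_field P Q) p = (2 * m) *\<^sub>R torus_field P Q p"
proof -
  define t a b a' b' where "t = radius1 p" and "a = poly P t" and "b = poly Q t"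
    and "a' = poly (pderiv P) t" and "b' = poly (pderiv Q) t"
  note defs = t_def[symmetric] a_def[symmetric] b_def[symmetric] a'_def[symmetric] b'_def[symmetric]
  have "m * b = a + t * a'"
    using arg_cong[OF sys(1), of "\<lambda>p. poly p t"] by (simp add: defs)
  then have e1: "a + ((p$1)\<^sup>2 + (p$2)\<^sup>2) * a' - m * b = 0" by (simp add: t_def radius1_def)
  have "m * a = b - (1 - t) * b'"
    using arg_cong[OF sys(2), of "\<lambda>p. poly p t"] by (simp add: defs algebra_simps)
  then have e2: "b - ((p$3)\<^sup>2 + (p$4)\<^sup>2) * b' - m * a = 0" by (simp add: t_def radius1_S3(3)[OF p])
  \<comment> \<open>Each scalar equation below is a combination of the two differential equations.
    The cofactors \<open>c\<close> and \<open>d\<close> are read off by comparing the terms that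
    contain \<open>m\<close>: they are - 2 times the \<open>b\<close> and \<open>a\<close> parts of
    the frame component on the right, up to the sign already present in \<open>- m * b\<close> and
    \<open>- m * a\<close>.\<close>
  have combine: "x = y" if "x - y = c * (a + ((p$1)\<^sup>2 + (p$2)\<^sup>2) * a' - m * b)
      + d * (b - ((p$3)\<^sup>2 + (p$4)\<^sup>2) * b' - m * a)" for x y c d
    using that unfolding e1 e2 by simp
  let ?\<xi> = "p$1 * p$3 - p$2 * p$4" and ?\<eta> = "p$1 * p$4 + p$2 * p$3"
  note unf = torus_field_def defs inner_4 rot1_def rot2_def frame_R_def frame_X1_def frame_X2_def
    vector_4 vector_add_component vector_scaleR_component power2_eq_square
  show ?thesis
  proof (rule curl_S3_frame[OF p has_derivative_torus_field[of P Q p] refl])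
    show "(2 * m) *\<^sub>R torus_field P Q p \<bullet> p = 0" by (simp add: torus_field_tangent)
  next
    show "((poly (pderiv P) (radius1 p) * (2 * (p $ 1 * frame_X1 p $ 1 + p $ 2 * frame_X1 p $ 2))) *\<^sub>R rot1 p +
       poly P (radius1 p) *\<^sub>R rot1 (frame_X1 p) +
       (poly (pderiv Q) (radius1 p) * (2 * (p $ 1 * frame_X1 p $ 1 + p $ 2 * frame_X1 p $ 2))) *\<^sub>R rot2 p +
       poly Q (radius1 p) *\<^sub>R rot2 (frame_X1 p)) \<bullet> frame_X2 p -
      ((poly (pderiv P) (radius1 p) * (2 * (p $ 1 * frame_X2 p $ 1 + p $ 2 * frame_X2 p $ 2))) *\<^sub>R rot1 p +
       poly P (radius1 p) *\<^sub>R rot1 (frame_X2 p) +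
       (poly (pderiv Q) (radius1 p) * (2 * (p $ 1 * frame_X2 p $ 1 + p $ 2 * frame_X2 p $ 2))) *\<^sub>R rot2 p +
       poly Q (radius1 p) *\<^sub>R rot2 (frame_X2 p)) \<bullet> frame_X1 p = (2 * m) *\<^sub>R torus_field P Q p \<bullet> frame_R p"
      by (rule combine[where c = "2 * ((p$3)\<^sup>2 + (p$4)\<^sup>2)" and d = "2 * ((p$1)\<^sup>2 + (p$2)\<^sup>2)"])
        (simp only: unf, simp add: algebra_simps)
  next
    show "((poly (pderiv P) (radius1 p) * (2 * (p $ 1 * frame_X2 p $ 1 + p $ 2 * frame_X2 p $ 2))) *\<^sub>R rot1 p +
       poly P (radius1 p) *\<^sub>R rot1 (frame_X2 p) +
       (poly (pderiv Q) (radius1 p) * (2 * (p $ 1 * frame_X2 p $ 1 + p $ 2 * frame_X2 p $ 2))) *\<^sub>R rot2 p +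
       poly Q (radius1 p) *\<^sub>R rot2 (frame_X2 p)) \<bullet> frame_R p -
      ((poly (pderiv P) (radius1 p) * (2 * (p $ 1 * frame_R p $ 1 + p $ 2 * frame_R p $ 2))) *\<^sub>R rot1 p +
       poly P (radius1 p) *\<^sub>R rot1 (frame_R p) +
       (poly (pderiv Q) (radius1 p) * (2 * (p $ 1 * frame_R p $ 1 + p $ 2 * frame_R p $ 2))) *\<^sub>R rot2 p +
       poly Q (radius1 p) *\<^sub>R rot2 (frame_R p)) \<bullet> frame_X2 p = (2 * m) *\<^sub>R torus_field P Q p \<bullet> frame_X1 p"
      by (rule combine[where c = "- 2 * ?\<eta>" and d = "2 * ?\<eta>"]) (simp only: unf, simp add: algebra_simps)
  next
    show "((poly (pderiv P) (radius1 p) * (2 * (p $ 1 * frame_R p $ 1 + p $ 2 * frame_R p $ 2))) *\<^sub>R rot1 p +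
       poly P (radius1 p) *\<^sub>R rot1 (frame_R p) +
       (poly (pderiv Q) (radius1 p) * (2 * (p $ 1 * frame_R p $ 1 + p $ 2 * frame_R p $ 2))) *\<^sub>R rot2 p +
       poly Q (radius1 p) *\<^sub>R rot2 (frame_R p)) \<bullet> frame_X1 p -
      ((poly (pderiv P) (radius1 p) * (2 * (p $ 1 * frame_X1 p $ 1 + p $ 2 * frame_X1 p $ 2))) *\<^sub>R rot1 p +
       poly P (radius1 p) *\<^sub>R rot1 (frame_X1 p) +
       (poly (pderiv Q) (radius1 p) * (2 * (p $ 1 * frame_X1 p $ 1 + p $ 2 * frame_X1 p $ 2))) *\<^sub>R rot2 p +
       poly Q (radius1 p) *\<^sub>R rot2 (frame_X1 p)) \<bullet> frame_R p = (2 * m) *\<^sub>R torus_field P Q p \<bullet> frame_X2 p"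
      by (rule combine[where c = "2 * ?\<xi>" and d = "- 2 * ?\<xi>"]) (simp only: unf, simp add: algebra_simps)
  qed
qed

text \<open>The disk normal to the core circle on which the first complex coordinate vanishes; its
  boundary is an orbit of the first rotation that is tangent to the contact planes.\<close>

definition core_disk :: "real \<Rightarrow> real^2 \<Rightarrow> real^4" where
  "core_disk \<tau> w = vector [sqrt \<tau> * w$1, sqrt \<tau> * w$2, sqrt (1 - \<tau> * ((w$1)\<^sup>2 + (w$2)\<^sup>2)), 0]"

lemma overtwisted_core_disk:
  assumes \<tau>: "0 < \<tau>" "\<tau> < 1" and P: "poly P \<tau> = 0" and Q: "poly Q \<tau> \<noteq> 0"
  shows "overtwisted_disk (associated_contact_structure (torus_field P Q)) (core_disk \<tau>)"
proof -
  let ?F = "core_disk \<tau>"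
  let ?g = "\<lambda>w :: real^2. 1 - \<tau> * ((w$1)\<^sup>2 + (w$2)\<^sup>2)"
  \<comment> \<open>The open disk of radius \<open>1 / sqrt \<tau>\<close>, which exceeds 1; on it
    the square root in the third coordinate is smooth.\<close>
  define U where "U = {w. 0 < ?g w}"
  have opU: "open U" unfolding U_def by (intro open_Collect_less continuous_intros)
  have sq: "(w$1)\<^sup>2 + (w$2)\<^sup>2 = (norm w)\<^sup>2" for w :: "real^2"
    by (simp add: norm_vec_def L2_set_def sum_2 real_sqrt_pow2)
  have nw: "\<tau> * ((w$1)\<^sup>2 + (w$2)\<^sup>2) < 1" if "norm w \<le> 1" for w :: "real^2"
  proof -
    have "(norm w)\<^sup>2 \<le> 1" using that by (simp add: power_le_one)
    then have "\<tau> * (norm w)\<^sup>2 \<le> \<tau>" using \<tau> by (simp add: mult_left_le)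
    then show ?thesis using \<tau> unfolding sq by linarith
  qed
  have sub: "cball 0 1 \<subseteq> U" using nw by (auto simp: U_def)
  have smg: "smooth_on U ?g"
    by (intro smooth_on_diff smooth_on_const smooth_on_mult smooth_on_add smooth_on_power smooth_on_nth opU)
  have smsq: "smooth_on U (\<lambda>w. sqrt (?g w))"
    by (rule smooth_on_compose[OF smooth_on_sqrt opU _ _ smg]) (auto simp: U_def)
  have smF: "smooth_on U ?F"
    unfolding core_disk_def
    by (intro smooth_on_vector_4 smooth_on_const smooth_on_mult smooth_on_nth opU smsq)
  define s where "s = (\<lambda>w. sqrt (?g w))"
  have s: "s w > 0" "(s w)\<^sup>2 = ?g w" if "w \<in> U" for w
    using that by (auto simp: s_def U_def)
  define DF where "DF = (\<lambda>w v :: real^2. vector [sqrt \<tau> * v$1, sqrt \<tau> * v$2,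
      - \<tau> * (w$1 * v$1 + w$2 * v$2) / s w, 0] :: real^4)"
  have dF: "(?F has_derivative DF w) (at w)" if w: "w \<in> U" for w
  proof -
    have n: "((\<lambda>w. w$i) has_derivative (\<lambda>v. v$i)) (at w)" for i :: 2
      by (rule bounded_linear_imp_has_derivative[OF bounded_linear_vec_nth])
    have 1: "(?g has_derivative (\<lambda>v. - 2 * \<tau> * (w$1 * v$1 + w$2 * v$2))) (at w)"
      by (auto intro!: derivative_eq_intros n simp: algebra_simps)
    have 2: "(sqrt has_derivative (*) (inverse (s w) / 2)) (at (?g w))"
      using DERIV_real_sqrt[of "?g w"] w by (simp add: U_def s_def has_field_derivative_def)
    have 3: "((\<lambda>w. sqrt (?g w)) has_derivative (\<lambda>v. - \<tau> * (w$1 * v$1 + w$2 * v$2) / s w)) (at w)"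
      by (rule has_derivative_eq_rhs[OF has_derivative_compose[OF 1 2]])
        (use s(1)[OF w] in \<open>simp add: fun_eq_iff field_simps\<close>)
    show ?thesis
      unfolding core_disk_def DF_def
      by (intro has_derivative_vector_4 3 has_derivative_const has_derivative_mult_right n)
  qed
  then have fd: "frechet_derivative ?F (at w) = DF w" if "w \<in> U" for w
    using frechet_derivative_at that by metis
  have FS: "?F w \<in> S3" if "w \<in> U" for w
    unfolding S3_coords core_disk_def vector_4
    using s(2)[OF that, unfolded s_def] \<tau> by (simp add: power_mult_distrib algebra_simps)
  have "range (DF z) = associated_contact_structure (torus_field P Q) (?F z)" if z: "norm z = 1" for z
  proof -
    have zU: "z \<in> U" using sub z by auto
    have r: "radius1 (?F z) = \<tau>"
      using sq[of z] z \<tau> by (simp add: radius1_def core_disk_def power_mult_distrib flip: distrib_left)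
    have F3: "?F z $ 3 = s z" "?F z $ 4 = 0" "?F z $ 1 = sqrt \<tau> * z$1" "?F z $ 2 = sqrt \<tau> * z$2"
      by (simp_all add: core_disk_def s_def)
    \<comment> \<open>On the boundary the field is a nonzero multiple of \<open>rot2\<close>, and as
      the second complex coordinate is a positive real number there, this points along the fourth
      axis. The contact plane is thus tangent to the great 2-sphere on which the fourth coordinate
      vanishes, and the whole disk lies in that sphere.\<close>
    have mem: "u \<in> associated_contact_structure (torus_field P Q) (?F z) \<longleftrightarrow>
        u \<bullet> ?F z = 0 \<and> u$4 = 0" for u
      using s(1)[OF zU] Q
      by (auto simp: associated_contact_structure_def kernel_planes_def tangent_S3_def torus_field_def
          r P inner_4 rot2_def F3)
    show ?thesis
    proof (intro subset_antisym subsetI)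
      fix u assume "u \<in> range (DF z)"
      then obtain v where u: "u = DF z v" by auto
      have st: "sqrt \<tau> * (sqrt \<tau> * x) = \<tau> * x" for x
        using \<tau> by (simp flip: mult.assoc)
      have "DF z v $ 3 * s z = - \<tau> * (z$1 * v$1 + z$2 * v$2)"
        using s(1)[OF zU] by (simp add: DF_def)
      moreover have "DF z v $ 1 = sqrt \<tau> * v$1" "DF z v $ 2 = sqrt \<tau> * v$2" "DF z v $ 4 = 0"
        by (simp_all add: DF_def)
      ultimately have "u \<bullet> ?F z = 0"
        unfolding u inner_4 F3 by (simp add: st algebra_simps)
      then show "u \<in> associated_contact_structure (torus_field P Q) (?F z)"
        unfolding mem by (simp add: u DF_def)
    next
      fix u assume "u \<in> associated_contact_structure (torus_field P Q) (?F z)"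
      then have u: "u \<bullet> ?F z = 0" "u$4 = 0" by (simp_all add: mem)
      then have "u$3 * s z = - sqrt \<tau> * (z$1 * u$1 + z$2 * u$2)"
        by (simp add: inner_4 F3 algebra_simps)
      then have "u$3 = - sqrt \<tau> * (z$1 * u$1 + z$2 * u$2) / s z"
        using s(1)[OF zU] by (simp add: field_simps)
      moreover have "\<tau> / sqrt \<tau> = sqrt \<tau>" using \<tau> by (simp add: real_div_sqrt)
      then have "\<tau> * (z$1 * (u$1 / sqrt \<tau>) + z$2 * (u$2 / sqrt \<tau>)) = sqrt \<tau> * (z$1 * u$1 + z$2 * u$2)"
        by (metis (no_types, opaque_lifting) add_divide_distrib mult.commute times_divide_eq_left times_divide_eq_right)
      ultimately have "u = DF z (vector [u$1 / sqrt \<tau>, u$2 / sqrt \<tau>])"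
        using \<tau> u(2) by (simp add: DF_def vec_eq_iff forall_4)
      then show "u \<in> range (DF z)" by blast
    qed
  qed
  moreover have "inj (DF z)" for z
  proof (rule injI)
    fix v v' assume "DF z v = DF z v'"
    then have "DF z v $ 1 = DF z v' $ 1" "DF z v $ 2 = DF z v' $ 2" by auto
    then show "v = v'" using \<tau> by (simp add: DF_def vec_eq_iff forall_2)
  qed
  moreover have "inj_on ?F (cball 0 1)"
  proof (rule inj_onI)
    fix v v' assume "?F v = ?F v'"
    then have "?F v $ 1 = ?F v' $ 1" "?F v $ 2 = ?F v' $ 2" by auto
    then show "v = v'" using \<tau> by (simp add: core_disk_def vec_eq_iff forall_2)
  qed
  ultimately show ?thesis
    unfolding overtwisted_disk_def
    using opU sub smF FS fd by (auto simp: smooth_on_def subset_iff)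
qed

section \<open>Torus averages of primitives\<close>

definition torus_integral :: "(real \<Rightarrow> real \<Rightarrow> real \<Rightarrow> real) \<Rightarrow> real \<Rightarrow> real" where
  "torus_integral f s = integral {0..2*pi} (\<lambda>a. integral {0..2*pi} (\<lambda>b. f a s b))"

lemma torus_integral_DERIV:
  assumes d: "\<And>a s b. ((\<lambda>s. f a s b) has_real_derivative f' a s b) (at s)"
    and c: "continuous_on UNIV (\<lambda>(a, s, b). f a s b)" "continuous_on UNIV (\<lambda>(a, s, b). f' a s b)"
  shows "(torus_integral f has_real_derivative torus_integral f' s) (at s)"
proof -
  note c' = c[THEN continuous_on_curry3]
  have ci: "continuous_on UNIV (\<lambda>(a, s). integral {0..2*pi} (\<lambda>b. f a s b))"
    "continuous_on UNIV (\<lambda>(a, s). integral {0..2*pi} (\<lambda>b. f' a s b))"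
    by (intro continuous_on_integral_param2 c)+
  have 1: "((\<lambda>s. integral {0..2*pi} (\<lambda>b. f a s b)) has_real_derivative integral {0..2*pi} (\<lambda>b. f' a s b)) (at s)" for a s
    by (rule DERIV_integral_param[OF d]) (unfold case_prod_unfold, (intro continuous_intros c')+)
  have "((\<lambda>s. integral {0..2*pi} (\<lambda>a. integral {0..2*pi} (\<lambda>b. f a s b))) has_real_derivative
      integral {0..2*pi} (\<lambda>a. integral {0..2*pi} (\<lambda>b. f' a s b))) (at s)"
    by (rule DERIV_integral_param[OF 1])
      (unfold case_prod_unfold, (intro continuous_intros ci[THEN continuous_on_curry2])+)
  then show ?thesis by (simp add: torus_integral_def[abs_def])
qed

lemma torus_integral_DERIV_fst:
  assumes d: "\<And>a s b. ((\<lambda>a. f a s b) has_real_derivative f' a s b) (at a)"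
    and c: "continuous_on UNIV (\<lambda>(a, s, b). f a s b)" "continuous_on UNIV (\<lambda>(a, s, b). f' a s b)"
    and per: "\<And>s b. f (2*pi) s b = f 0 s b"
  shows "torus_integral f' s = 0"
proof -
  note c' = c[THEN continuous_on_curry3]
  have 1: "((\<lambda>a. integral {0..2*pi} (\<lambda>b. f a s b)) has_real_derivative integral {0..2*pi} (\<lambda>b. f' a s b)) (at a)" for a
    by (rule DERIV_integral_param[OF d]) (unfold case_prod_unfold, (intro continuous_intros c')+)
  show ?thesis
    unfolding torus_integral_def by (subst integral_DERIV[OF _ 1]) (simp_all add: per[abs_def])
qed

lemma torus_integral_DERIV_snd:
  assumes d: "\<And>a s b. ((\<lambda>b. f a s b) has_real_derivative f' a s b) (at b)"
    and per: "\<And>a s. f a s (2*pi) = f a s 0"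
  shows "torus_integral f' s = 0"
  unfolding torus_integral_def by (subst integral_DERIV[OF _ d]) (simp_all add: per)

lemma torus_integral_add:
  assumes c: "continuous_on UNIV (\<lambda>(a, s, b). f a s b)" "continuous_on UNIV (\<lambda>(a, s, b). g a s b)"
  shows "torus_integral (\<lambda>a s b. f a s b + g a s b) s = torus_integral f s + torus_integral g s"
proof -
  note c' = c[THEN continuous_on_curry3]
  have ci: "continuous_on UNIV (\<lambda>(a, s). integral {0..2*pi} (\<lambda>b. f a s b))"
    "continuous_on UNIV (\<lambda>(a, s). integral {0..2*pi} (\<lambda>b. g a s b))"
    by (intro continuous_on_integral_param2 c)+
  have "integral {0..2*pi} (\<lambda>b. f a s b + g a s b)
      = integral {0..2*pi} (\<lambda>b. f a s b) + integral {0..2*pi} (\<lambda>b. g a s b)" for a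
    by (rule integral_add_cont) (intro continuous_intros c')+
  then show ?thesis
    unfolding torus_integral_def
    by (simp, intro integral_add_cont continuous_intros ci[THEN continuous_on_curry2])
qed

lemma torus_integral_const: "torus_integral (\<lambda>a s b. k s) s = 4 * pi\<^sup>2 * k s"
  by (simp add: torus_integral_def power2_eq_square)

text \<open>Fubini's theorem followed by a swap, because \<open>s\<close> is the middle coordinate
  of the box but has to be integrated last.\<close>

lemma integral_box_torus:
  fixes f :: "real \<Rightarrow> real \<Rightarrow> real \<Rightarrow> real"
  assumes c: "continuous_on UNIV (\<lambda>(a, s, b). f a s b)"
  shows "integral (cbox (0, 0, 0) (2*pi, c, 2*pi)) (\<lambda>(a, s, b). f a s b)
    = integral {0..c} (torus_integral f)"
proof -
  have ci: "continuous_on UNIV (\<lambda>(a, s). integral {0..2*pi} (\<lambda>b. f a s b))"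
    by (rule continuous_on_integral_param2[OF c])
  have "integral (cbox (0, 0, 0) (2*pi, c, 2*pi)) (\<lambda>(a, s, b). f a s b)
     = integral {0..2*pi} (\<lambda>a. integral (cbox (0, 0) (c, 2*pi)) (\<lambda>(s, b). f a s b))"
    using integral_prod_continuous[OF continuous_on_subset[OF c subset_UNIV], of 0 "(0,0)" "2*pi" "(c, 2*pi)"]
    by simp
  also have "\<dots> = integral {0..2*pi} (\<lambda>a. integral {0..c} (\<lambda>s. integral {0..2*pi} (\<lambda>b. f a s b)))"
  proof (rule integral_cong)
    fix a
    have "continuous_on (cbox (0, 0) (c, 2*pi)) (\<lambda>(s, b). f a s b)"
      unfolding case_prod_unfold by (intro continuous_on_curry3[OF c] continuous_intros)
    from integral_prod_continuous[OF this]
    show "integral (cbox (0, 0) (c, 2*pi)) (\<lambda>(s, b). f a s b)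
       = integral {0..c} (\<lambda>s. integral {0..2*pi} (\<lambda>b. f a s b))" by simp
  qed
  also have "\<dots> = integral {0..c} (torus_integral f)"
    using integral_swap_continuous[where f = "\<lambda>a s. integral {0..2*pi} (\<lambda>b. f a s b)",
        OF continuous_on_subset[OF ci subset_UNIV], of 0 "2*pi" 0 c]
    unfolding torus_integral_def[abs_def] box_real .
  finally show ?thesis .
qed

section \<open>Toroidal coordinates\<close>

text \<open>The derivative of \<open>toroidal\<close> in \<open>s\<close>; the derivatives in the
  two angles are \<open>rot1\<close> and \<open>rot2\<close> at the point.\<close>

definition toroidal_s :: "real \<Rightarrow> real \<Rightarrow> real \<Rightarrow> real^4" where
  "toroidal_s a s b = vector [- sin s * cos a, - sin s * sin a, cos s * cos b, cos s * sin b]"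

lemma has_derivative_toroidal:
  "(toroidal has_derivative (\<lambda>(da, ds, db). da *\<^sub>R rot1 (toroidal (a, s, b)) + ds *\<^sub>R toroidal_s a s b
     + db *\<^sub>R rot2 (toroidal (a, s, b)))) (at (a, s, b))"
proof -
  have eq: "toroidal = (\<lambda>q. vector [cos (fst (snd q)) * cos (fst q), cos (fst (snd q)) * sin (fst q),
      sin (fst (snd q)) * cos (snd (snd q)), sin (fst (snd q)) * sin (snd (snd q))])"
    by (simp add: toroidal_def fun_eq_iff)
  have d: "(fst has_derivative fst) (at (a, s, b))"
    "((\<lambda>q. fst (snd q)) has_derivative (\<lambda>q. fst (snd q))) (at (a, s, b))"
    "((\<lambda>q. snd (snd q)) has_derivative (\<lambda>q. snd (snd q))) (at (a, s, b))"
    by (auto intro!: derivative_eq_intros)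
  show ?thesis
    unfolding eq
    by (rule has_derivative_eq_rhs[OF has_derivative_vector_4],
        (rule has_derivative_mult has_derivative_cos has_derivative_sin d)+)
      (simp add: fun_eq_iff vec_eq_iff forall_4 rot1_def rot2_def toroidal_s_def algebra_simps)
qed

lemma frechet_derivative_toroidal:
  "frechet_derivative toroidal (at (a, s, b)) (1, 0, 0) = rot1 (toroidal (a, s, b))"
  "frechet_derivative toroidal (at (a, s, b)) (0, 1, 0) = toroidal_s a s b"
  "frechet_derivative toroidal (at (a, s, b)) (0, 0, 1) = rot2 (toroidal (a, s, b))"
  unfolding frechet_derivative_at[OF has_derivative_toroidal, symmetric] by simp_all

lemma toroidal_vector_derivative:
  "((\<lambda>a. toroidal (a, s, b)) has_vector_derivative rot1 (toroidal (a, s, b))) (at a)"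
  "((\<lambda>s. toroidal (a, s, b)) has_vector_derivative toroidal_s a s b) (at s)"
  "((\<lambda>b. toroidal (a, s, b)) has_vector_derivative rot2 (toroidal (a, s, b))) (at b)"
  "((\<lambda>a. toroidal_s a s b) has_vector_derivative rot1 (toroidal_s a s b)) (at a)"
  "((\<lambda>b. toroidal_s a s b) has_vector_derivative rot2 (toroidal_s a s b)) (at b)"
  "((\<lambda>s. rot1 (toroidal (a, s, b))) has_vector_derivative rot1 (toroidal_s a s b)) (at s)"
  "((\<lambda>s. rot2 (toroidal (a, s, b))) has_vector_derivative rot2 (toroidal_s a s b)) (at s)"
  unfolding has_vector_derivative_def toroidal_def case_prod_conv rot1_def rot2_def toroidal_s_def vector_4
  by ((rule has_derivative_eq_rhs[OF has_derivative_vector_4],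
        (rule derivative_intros has_derivative_cos has_derivative_sin has_derivative_ident)+)
      , simp add: fun_eq_iff vec_eq_iff forall_4 algebra_simps)+

lemma toroidal_S3: "toroidal (a, s, b) \<in> S3"
proof -
  have "(cos s * cos a)\<^sup>2 + (cos s * sin a)\<^sup>2 + (sin s * cos b)\<^sup>2 + (sin s * sin b)\<^sup>2
    = (cos s)\<^sup>2 * ((sin a)\<^sup>2 + (cos a)\<^sup>2) + (sin s)\<^sup>2 * ((sin b)\<^sup>2 + (cos b)\<^sup>2)"
    by (simp only: power_mult_distrib distrib_left)
  then show ?thesis unfolding S3_coords by (simp add: toroidal_def)
qed

lemma toroidal_tangent:
  "rot1 p \<bullet> p = 0" "rot2 p \<bullet> p = 0" "toroidal_s a s b \<bullet> toroidal (a, s, b) = 0"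
proof -
  have "toroidal_s a s b \<bullet> toroidal (a, s, b) =
    sin s * cos s * (((sin b)\<^sup>2 + (cos b)\<^sup>2) - ((sin a)\<^sup>2 + (cos a)\<^sup>2))"
    by (simp only: toroidal_s_def toroidal_def inner_4 case_prod_conv vector_4)
      (simp only: algebra_simps power2_eq_square mult_minus_left)
  then show "toroidal_s a s b \<bullet> toroidal (a, s, b) = 0" by simp
qed (simp_all add: rot1_def rot2_def inner_4)

lemma radius1_toroidal: "radius1 (toroidal (a, s, b)) = (cos s)\<^sup>2"
proof -
  have "radius1 (toroidal (a, s, b)) = (cos s)\<^sup>2 * ((sin a)\<^sup>2 + (cos a)\<^sup>2)"
    by (simp only: radius1_def toroidal_def case_prod_conv vector_4 power_mult_distrib distrib_left)
  then show ?thesis by simp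
qed

definition area12 :: "real^4 \<Rightarrow> real^4 \<Rightarrow> real" where
  "area12 u v = (u$1 * v$2 - u$2 * v$1) - (u$3 * v$4 - u$4 * v$3)"

lemma area12_toroidal:
  "area12 (toroidal_s a s b) (rot2 (toroidal (a, s, b))) = - (sin s * cos s)"
  "area12 (rot2 (toroidal (a, s, b))) (rot1 (toroidal (a, s, b))) = 0"
  "area12 (rot1 (toroidal (a, s, b))) (toroidal_s a s b) = sin s * cos s"
proof -
  have "area12 (toroidal_s a s b) (rot2 (toroidal (a, s, b))) = - (sin s * cos s * ((sin b)\<^sup>2 + (cos b)\<^sup>2))"
    "area12 (rot1 (toroidal (a, s, b))) (toroidal_s a s b) = sin s * cos s * ((sin a)\<^sup>2 + (cos a)\<^sup>2)"
    by (simp only: area12_def toroidal_s_def toroidal_def rot1_def rot2_def case_prod_conv vector_4;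
        simp only: algebra_simps power2_eq_square mult_minus_left mult_minus_right mult_zero_right mult_zero_left; simp)+
  then show "area12 (toroidal_s a s b) (rot2 (toroidal (a, s, b))) = - (sin s * cos s)"
    "area12 (rot1 (toroidal (a, s, b))) (toroidal_s a s b) = sin s * cos s" by simp_all
qed (simp add: area12_def rot1_def rot2_def)

lemma DERIV_blinfun_along_curve:
  fixes A :: "'a::real_normed_vector \<Rightarrow> ('b::real_normed_vector \<Rightarrow>\<^sub>L real)"
  assumes "(c has_vector_derivative c') (at t)" "(A has_derivative D) (at (c t))"
    "(w has_vector_derivative w') (at t)"
  shows "((\<lambda>t. blinfun_apply (A (c t)) (w t)) has_real_derivative
    blinfun_apply (D c') (w t) + blinfun_apply (A (c t)) w') (at t)"
proof -
  interpret linear D using assms(2) by (rule has_derivative_linear)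
  have "((\<lambda>t. A (c t)) has_derivative (\<lambda>h. D (h *\<^sub>R c'))) (at t)"
    using has_derivative_compose[OF assms(1)[unfolded has_vector_derivative_def] assms(2)] .
  from bounded_bilinear.FDERIV[OF bounded_bilinear_blinfun_apply this assms(3)[unfolded has_vector_derivative_def]]
  show ?thesis
    by (auto simp: has_field_derivative_def scale blinfun.scaleR_right blinfun.scaleR_left algebra_simps
        elim!: has_derivative_eq_rhs)
qed

text \<open>Every primitive of a torus-invariant area form has the same torus averages, because the
  averaged components are constrained by their vanishing on the two core circles.\<close>

lemma wedge_primitive_integral:
  fixes F F' :: "real \<Rightarrow> real"
  assumes A: "smooth_along S3 A"
    and ext: "\<And>p u v. p \<in> S3 \<Longrightarrow> u \<bullet> p = 0 \<Longrightarrow> v \<bullet> p = 0 \<Longrightarrow>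
       ext_deriv A p u v = - 2 * F' (radius1 p) * area12 u v"
    and F: "\<And>t. t \<in> {0..1} \<Longrightarrow> (F has_real_derivative F' t) (at t)"
    and cF': "continuous_on {0..1} F'"
  shows "integral_S3 (wedge12 A (ext_deriv A)) = - 4 * pi\<^sup>2 * (F 1 - F 0)\<^sup>2"
proof -
  obtain U G D where U: "open U" "S3 \<subseteq> U" and G: "\<And>x. x \<in> S3 \<Longrightarrow> G x = A x"
    and D: "\<And>x. x \<in> U \<Longrightarrow> (G has_derivative D x) (at x)"
    and contD: "continuous_on {z. fst z \<in> U} (\<lambda>z. D (fst z) (snd z))"
    using smooth_along_C1[OF A] by blast
  let ?X = "\<lambda>a s b. toroidal (a, s, b)"
  have XU: "?X a s b \<in> U" for a s b using toroidal_S3 U by blast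
  have DG: "((\<lambda>t. blinfun_apply (G (c t)) (w t)) has_real_derivative
      blinfun_apply (D (?X a s b) c') (w t) + blinfun_apply (G (?X a s b)) w') (at t)"
    if "(c has_vector_derivative c') (at t)" "c t = ?X a s b" "(w has_vector_derivative w') (at t)"
    for c c' w w' t a s b
    using DERIV_blinfun_along_curve[OF that(1) _ that(3), of G] D[OF XU[of a s b]] unfolding that(2) .
  have contX: "continuous_on B (\<lambda>x. ?X (f x) (g x) (h x))" "continuous_on B (\<lambda>x. toroidal_s (f x) (g x) (h x))"
    if "continuous_on B f" "continuous_on B g" "continuous_on B h"
    for B :: "(real \<times> real \<times> real) set" and f g h
    unfolding toroidal_def toroidal_s_def case_prod_conv by (intro continuous_intros that)+
  have controt: "continuous_on B (\<lambda>x. rot1 (f x))" "continuous_on B (\<lambda>x. rot2 (f x))"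
    if "continuous_on B f" for B :: "(real \<times> real \<times> real) set" and f
    by (intro bounded_linear.continuous_on[OF bounded_linear_rot(1)]
        bounded_linear.continuous_on[OF bounded_linear_rot(2)] that)+
  have contG: "continuous_on B (\<lambda>x. G (f x))" if "continuous_on B f" "f ` B \<subseteq> U"
    for B :: "(real \<times> real \<times> real) set" and f
    by (rule continuous_on_compose2[OF _ that])
      (auto intro!: continuous_at_imp_continuous_on has_derivative_continuous[OF D])
  have contDG: "continuous_on B (\<lambda>x. D (f x) (g x))"
    if "continuous_on B f" "continuous_on B g" "f ` B \<subseteq> U"
    for B :: "(real \<times> real \<times> real) set" and f g
  proof -
    have "continuous_on B (\<lambda>x. (\<lambda>z. D (fst z) (snd z)) (f x, g x))"
      by (rule continuous_on_compose2[OF contD]) (use that in \<open>auto intro!: continuous_intros\<close>)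
    then show ?thesis by simp
  qed
  have img: "(\<lambda>x. ?X (f x) (g x) (h x)) ` B \<subseteq> U" for B :: "(real \<times> real \<times> real) set" and f g h
    using XU by auto
  note cts = continuous_intros contX controt contG contDG img
  define Aa where "Aa = (\<lambda>a s b. blinfun_apply (G (?X a s b)) (rot1 (?X a s b)))"
  define As where "As = (\<lambda>a s b. blinfun_apply (G (?X a s b)) (toroidal_s a s b))"
  define Ab where "Ab = (\<lambda>a s b. blinfun_apply (G (?X a s b)) (rot2 (?X a s b)))"
  define As_a where "As_a = (\<lambda>a s b. blinfun_apply (D (?X a s b) (rot1 (?X a s b))) (toroidal_s a s b)
     + blinfun_apply (G (?X a s b)) (rot1 (toroidal_s a s b)))"
  define As_b where "As_b = (\<lambda>a s b. blinfun_apply (D (?X a s b) (rot2 (?X a s b))) (toroidal_s a s b)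
     + blinfun_apply (G (?X a s b)) (rot2 (toroidal_s a s b)))"
  define Aa_s where "Aa_s = (\<lambda>a s b. blinfun_apply (D (?X a s b) (toroidal_s a s b)) (rot1 (?X a s b))
     + blinfun_apply (G (?X a s b)) (rot1 (toroidal_s a s b)))"
  define Ab_s where "Ab_s = (\<lambda>a s b. blinfun_apply (D (?X a s b) (toroidal_s a s b)) (rot2 (?X a s b))
     + blinfun_apply (G (?X a s b)) (rot2 (toroidal_s a s b)))"
  note defs = Aa_def As_def Ab_def As_a_def As_b_def Aa_s_def Ab_s_def
  have conts: "continuous_on UNIV (\<lambda>(a, s, b). Aa a s b)" "continuous_on UNIV (\<lambda>(a, s, b). As a s b)"
    "continuous_on UNIV (\<lambda>(a, s, b). Ab a s b)" "continuous_on UNIV (\<lambda>(a, s, b). As_a a s b)"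
    "continuous_on UNIV (\<lambda>(a, s, b). As_b a s b)" "continuous_on UNIV (\<lambda>(a, s, b). Aa_s a s b)"
    "continuous_on UNIV (\<lambda>(a, s, b). Ab_s a s b)"
    unfolding defs case_prod_unfold by (intro cts)+
  note tv = toroidal_vector_derivative
  have ders: "((\<lambda>a. As a s b) has_real_derivative As_a a s b) (at a)"
    "((\<lambda>b. As a s b) has_real_derivative As_b a s b) (at b)"
    "((\<lambda>s. Aa a s b) has_real_derivative Aa_s a s b) (at s)"
    "((\<lambda>s. Ab a s b) has_real_derivative Ab_s a s b) (at s)" for a s b
    unfolding defs
    by (rule DG[OF tv(1) refl tv(4)] DG[OF tv(3) refl tv(5)] DG[OF tv(2) refl tv(6)] DG[OF tv(2) refl tv(7)])+
  have ext': "blinfun_apply (D (?X a s b) u) v - blinfun_apply (D (?X a s b) v) u = - 2 * F' ((cos s)\<^sup>2) * area12 u v"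
    if "u \<bullet> ?X a s b = 0" "v \<bullet> ?X a s b = 0" for a s b u v
    using ext_deriv_eq[OF toroidal_S3 that D[OF XU] G] ext[OF toroidal_S3 that] by (simp add: radius1_toroidal)
  \<comment> \<open>Here t = cos^2 s runs backwards from 1 to 0, so \<open>h 0\<close> is
    \<open>F 1\<close> and \<open>h (pi / 2)\<close> is \<open>F 0\<close>.\<close>
  define h where "h = (\<lambda>s. F ((cos s)\<^sup>2))"
  define h' where "h' = (\<lambda>s. - 2 * F' ((cos s)\<^sup>2) * (sin s * cos s))"
  have anti: "area12 u v = - area12 v u" for u v by (simp add: area12_def)
  have eqs: "Aa_s a s b = As_a a s b + - h' s" "Ab_s a s b = As_b a s b + - h' s" for a s b
    using ext'[OF toroidal_tangent(3) toroidal_tangent(1), of a s b]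
      ext'[OF toroidal_tangent(3) toroidal_tangent(2), of a s b]
    by (simp_all add: defs h'_def area12_toroidal anti[of "toroidal_s a s b" "rot1 (?X a s b)"])
  have cos2: "(cos s)\<^sup>2 \<in> {0..1}" for s :: real
    by (simp add: abs_square_le_1)
  have dh: "(h has_real_derivative h' s) (at s)" for s
  proof -
    have "((\<lambda>s. (cos s)\<^sup>2) has_real_derivative - 2 * (sin s * cos s)) (at s)"
      by (auto intro!: derivative_eq_intros)
    from DERIV_chain2[OF F[OF cos2] this] show ?thesis
      by (simp add: h_def h'_def mult_ac)
  qed
  have ch': "continuous_on UNIV h'"
    unfolding h'_def
    by (intro continuous_intros continuous_on_compose2[OF cF', of UNIV "\<lambda>s. (cos s)\<^sup>2"]) (use cos2 in auto)
  have per: "As (2*pi) s b = As 0 s b" "As a s (2*pi) = As a s 0" for a s b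
    by (simp_all add: As_def toroidal_def toroidal_s_def)
  have ck: "continuous_on UNIV (\<lambda>(a :: real, s, b :: real). - h' s)"
    unfolding case_prod_unfold
    by (intro continuous_intros continuous_on_compose2[OF ch']) auto
  \<comment> \<open>The averages of \<open>As_a\<close> and \<open>As_b\<close> vanish by
    periodicity, so the equation for dA alone gives the derivatives in \<open>s\<close> of the
    averages of both angular components, and they coincide.\<close>
  have J': "(torus_integral Aa has_real_derivative 4 * pi\<^sup>2 * (- h' s)) (at s)"
    "(torus_integral Ab has_real_derivative 4 * pi\<^sup>2 * (- h' s)) (at s)" for s
  proof -
    have "torus_integral Aa_s s = torus_integral As_a s + torus_integral (\<lambda>a s b. - h' s) s"
      "torus_integral Ab_s s = torus_integral As_b s + torus_integral (\<lambda>a s b. - h' s) s"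
      using torus_integral_add[OF conts(4) ck] torus_integral_add[OF conts(5) ck]
      by (simp_all add: eqs[abs_def])
    then have "torus_integral Aa_s s = 4 * pi\<^sup>2 * (- h' s)" "torus_integral Ab_s s = 4 * pi\<^sup>2 * (- h' s)"
      unfolding torus_integral_const
      using torus_integral_DERIV_fst[OF ders(1) conts(2) conts(4) per(1)]
        torus_integral_DERIV_snd[OF ders(2) per(2)] by simp_all
    then show "(torus_integral Aa has_real_derivative 4 * pi\<^sup>2 * (- h' s)) (at s)"
      "(torus_integral Ab has_real_derivative 4 * pi\<^sup>2 * (- h' s)) (at s)"
      using torus_integral_DERIV[OF ders(3) conts(1,6), of s] torus_integral_DERIV[OF ders(4) conts(3,7), of s]
      by simp_all
  qed
  have const: "torus_integral Aa s + 4 * pi\<^sup>2 * h s = torus_integral Aa (pi/2) + 4 * pi\<^sup>2 * h (pi/2)"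
    "torus_integral Ab s + 4 * pi\<^sup>2 * h s = torus_integral Ab 0 + 4 * pi\<^sup>2 * h 0" for s
    by (rule DERIV_isconst_all[of "\<lambda>s. torus_integral Aa s + 4 * pi\<^sup>2 * h s"]
        DERIV_isconst_all[of "\<lambda>s. torus_integral Ab s + 4 * pi\<^sup>2 * h s"],
        auto intro!: derivative_eq_intros J' dh)+
  \<comment> \<open>Each rotation field vanishes on one core circle, and so does the corresponding
    component of a form defined there. This fixes the constants of integration left open in
    \<open>const\<close>.\<close>
  have "rot1 (?X a (pi/2) b) = 0" "rot2 (?X a 0 b) = 0" for a b
    by (simp_all add: rot1_def rot2_def toroidal_def vec_eq_iff forall_4)
  then have "torus_integral Aa (pi/2) = 0" "torus_integral Ab 0 = 0"
    by (simp_all add: torus_integral_def Aa_def Ab_def)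
  then have J: "torus_integral Aa s - torus_integral Ab s = 4 * pi\<^sup>2 * (h (pi/2) - h 0)" for s
    using const[of s] by (simp add: algebra_simps)
  have cAb: "continuous_on UNIV (\<lambda>(a, s, b). - Ab a s b)"
    using continuous_on_minus[OF conts(3)] by (simp add: case_prod_unfold)
  have K: "torus_integral (\<lambda>a s b. - h' s * (Aa a s b + - Ab a s b)) s = - h' s * (4 * pi\<^sup>2 * (h (pi/2) - h 0))" for s
  proof -
    have "torus_integral (\<lambda>a s b. - h' s * (Aa a s b + - Ab a s b)) s
        = - h' s * torus_integral (\<lambda>a s b. Aa a s b + - Ab a s b) s"
      unfolding torus_integral_def integral_mult_right ..
    also have "torus_integral (\<lambda>a s b. Aa a s b + - Ab a s b) s
        = torus_integral Aa s + torus_integral (\<lambda>a s b. - Ab a s b) s"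
      by (rule torus_integral_add[OF conts(1) cAb])
    also have "torus_integral (\<lambda>a s b. - Ab a s b) s = - torus_integral Ab s"
      unfolding torus_integral_def integral_neg ..
    finally show ?thesis using J[of s] by simp
  qed
  \<comment> \<open>The component \<open>As\<close> is multiplied by the value of
    \<open>area12\<close> on the two rotation vectors, which is 0. Only the angular components
    remain, with a factor depending on \<open>s\<close> alone, so their averages determine the
    integral.\<close>
  have wedge: "wedge12 A (ext_deriv A) (?X a s b) (rot1 (?X a s b)) (toroidal_s a s b) (rot2 (?X a s b))
      = - h' s * (Aa a s b + - Ab a s b)" for a s b
    unfolding wedge12_def ext[OF toroidal_S3 toroidal_tangent(3) toroidal_tangent(2)]
      ext[OF toroidal_S3 toroidal_tangent(2) toroidal_tangent(1)]
      ext[OF toroidal_S3 toroidal_tangent(1) toroidal_tangent(3)] area12_toroidal radius1_toroidal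
    by (simp add: Aa_def Ab_def h'_def G[OF toroidal_S3] algebra_simps)
  have "integral_S3 (wedge12 A (ext_deriv A))
     = integral (cbox (0, 0, 0) (2*pi, pi/2, 2*pi)) (\<lambda>(a, s, b). - h' s * (Aa a s b + - Ab a s b))"
    unfolding integral_S3_def
    by (intro integral_cong) (auto simp: frechet_derivative_toroidal wedge)
  also have "\<dots> = integral {0..pi/2} (torus_integral (\<lambda>a s b. - h' s * (Aa a s b + - Ab a s b)))"
  proof (rule integral_box_torus)
    show "continuous_on UNIV (\<lambda>(a, s, b). - h' s * (Aa a s b + - Ab a s b))"
      unfolding case_prod_unfold
      by (intro continuous_intros conts[THEN continuous_on_curry3] continuous_on_compose2[OF ch']) auto
  qed
  also have "\<dots> = integral {0..pi/2} (\<lambda>s. - (h' s * (4 * pi\<^sup>2 * (h (pi/2) - h 0))))"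
    unfolding K[abs_def] by simp
  also have "\<dots> = - (h (pi/2) * (4 * pi\<^sup>2 * (h (pi/2) - h 0))) - - (h 0 * (4 * pi\<^sup>2 * (h (pi/2) - h 0)))"
    by (rule integral_DERIV) (auto intro!: DERIV_minus DERIV_cmult_right dh)
  also have "\<dots> = - 4 * pi\<^sup>2 * (F 1 - F 0)\<^sup>2"
    by (simp add: h_def power2_eq_square algebra_simps)
  finally show ?thesis .
qed

section \<open>The Hopf invariant of torus-invariant fields\<close>

lemma smooth_on_DERIV:
  fixes f :: "real \<Rightarrow> real"
  assumes "smooth_on U f"
  shows "t \<in> U \<Longrightarrow> (f has_real_derivative frechet_derivative f (at t) 1) (at t)"
    and "continuous_on U (\<lambda>t. frechet_derivative f (at t) 1)"
proof -
  assume t: "t \<in> U"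
  have d: "(f has_derivative frechet_derivative f (at t)) (at t)"
    by (rule smooth_on_has_derivative[OF assms t])
  interpret linear "frechet_derivative f (at t)" using d by (rule has_derivative_linear)
  have "frechet_derivative f (at t) h = frechet_derivative f (at t) 1 * h" for h
    using scale[of h 1] by simp
  then have "frechet_derivative f (at t) = (*) (frechet_derivative f (at t) 1)" by (rule ext)
  with d show "(f has_real_derivative frechet_derivative f (at t) 1) (at t)"
    unfolding has_field_derivative_def by metis
next
  have "Ck (Suc 0) U f" using assms by (simp only: smooth_on_def)
  then show "continuous_on U (\<lambda>t. frechet_derivative f (at t) 1)" by simp
qed

text \<open>The quotient \<open>F t / l t\<close> is glued to \<open>H\<close> on a neighbourhood
  \<open>W\<close> of the zeros of \<open>l\<close>; smoothness is a local property.\<close>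

lemma smooth_on_removable_quotient:
  fixes F l H :: "real \<Rightarrow> real"
  assumes I: "open I" and W: "open W" "W \<subseteq> I" and sm: "smooth_on I F" "smooth_on I l" "smooth_on W H"
    and eq: "\<And>t. t \<in> W \<Longrightarrow> F t = l t * H t" and nz: "\<And>t. t \<in> I - W \<Longrightarrow> l t \<noteq> 0"
  obtains G where "smooth_on I G" "\<And>t. t \<in> I \<Longrightarrow> F t = l t * G t"
proof
  define G where "G = (\<lambda>t. if t \<in> W then H t else F t / l t)"
  show "F t = l t * G t" if "t \<in> I" for t
    using that eq nz by (auto simp: G_def)
  show "smooth_on I G"
  proof (rule smooth_on_local)
    fix t assume t: "t \<in> I"
    show "\<exists>V. open V \<and> t \<in> V \<and> smooth_on V G"
    proof (cases "t \<in> W")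
      case True
      have "smooth_on W G" by (rule smooth_on_cong[OF W(1) _ sm(3)]) (simp add: G_def)
      then show ?thesis using True W by blast
    next
      case False
      have cl: "continuous_on I l"
        using sm(2)[unfolded smooth_on_def, rule_format, of 0] by simp
      define V where "V = {t \<in> I. l t \<noteq> 0}"
      have V: "open V"
        using continuous_open_preimage[OF cl I, of "- {0}"]
        by (simp add: V_def vimage_def Int_def open_Compl)
      have "smooth_on V G"
      proof (rule smooth_on_cong[OF V])
        show "smooth_on V (\<lambda>t. F t / l t)"
          by (intro smooth_on_divide V smooth_on_subset[OF sm(1)] smooth_on_subset[OF sm(2)])
            (auto simp: V_def)
        show "F t / l t = G t" if "t \<in> V" for t
          using that eq[of t] by (auto simp: G_def V_def)
      qed
      then show ?thesis using V False t nz by (auto simp: V_def)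
    qed
  qed
qed

text \<open>Together with \<open>zeta_im\<close>, the real and imaginary parts of z1 z2, which has
  modulus sqrt(t (1-t)) and argument a + b.\<close>

definition zeta_re :: "real^4 \<Rightarrow> real" where
  "zeta_re x = x$1 * x$3 - x$2 * x$4"

definition zeta_im :: "real^4 \<Rightarrow> real" where
  "zeta_im x = x$1 * x$4 + x$2 * x$3"

lemma zeta_wedge:
  fixes p u v :: "real^4"
  assumes p: "p \<in> S3" and tan: "u \<bullet> p = 0" "v \<bullet> p = 0"
  defines "dt \<equiv> \<lambda>u :: real^4. 2 * (p$1 * u$1 + p$2 * u$2)"
    and "dzr \<equiv> \<lambda>u :: real^4. p$1 * u$3 + u$1 * p$3 - (p$2 * u$4 + u$2 * p$4)"
    and "dzi \<equiv> \<lambda>u :: real^4. p$1 * u$4 + u$1 * p$4 + (p$2 * u$3 + u$2 * p$3)"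
  shows "dzr u * dzi v - dzr v * dzi u = (1 - 2 * radius1 p) * area12 u v"
    and "dt u * (zeta_re p * dzi v - zeta_im p * dzr v) - dt v * (zeta_re p * dzi u - zeta_im p * dzr u)
      = 2 * radius1 p * (1 - radius1 p) * area12 u v"
proof -
  define t1 t2 where "t1 = (p$1)\<^sup>2 + (p$2)\<^sup>2" and "t2 = (p$3)\<^sup>2 + (p$4)\<^sup>2"
  define b1 b2 where "b1 = (\<lambda>u :: real^4. p$1 * u$2 - p$2 * u$1)" and "b2 = (\<lambda>u :: real^4. p$3 * u$4 - p$4 * u$3)"
  define d1 d2 where "d1 = (\<lambda>u :: real^4. p$1 * u$1 + p$2 * u$2)" and "d2 = (\<lambda>u :: real^4. p$3 * u$3 + p$4 * u$4)"
  define A B where "A = u$1 * v$2 - u$2 * v$1" and "B = u$3 * v$4 - u$4 * v$3"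
  have r: "radius1 p = t1" "1 - t1 = t2" "1 - 2 * t1 = t2 - t1"
    using radius1_S3(3)[OF p] by (simp_all add: radius1_def t1_def t2_def)
  have ar: "area12 u v = A - B" by (simp add: area12_def A_def B_def)
  \<comment> \<open>Tangency to the sphere in the form d|z1|^2 = - d|z2|^2, which turns the mixed
    wedges into those of \<open>w1\<close> and \<open>w2\<close>.\<close>
  have d: "d1 u = - d2 u" "d1 v = - d2 v"
    using tan by (simp_all add: d1_def d2_def inner_4 algebra_simps)
  have w1: "d1 u * b1 v - d1 v * b1 u = t1 * A"
    by (simp add: d1_def b1_def t1_def A_def power2_eq_square algebra_simps)
  have w2: "d2 u * b2 v - d2 v * b2 u = t2 * B"
    by (simp add: d2_def b2_def t2_def B_def power2_eq_square algebra_simps)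
  have "dzr u * dzi v - dzr v * dzi u = t2 * A + t1 * B + (d1 u * b2 v - d1 v * b2 u + (d2 u * b1 v - d2 v * b1 u))"
    by (simp add: dzr_def dzi_def d1_def d2_def b1_def b2_def t1_def t2_def A_def B_def power2_eq_square algebra_simps)
  also have "d1 u * b2 v - d1 v * b2 u = - (t2 * B)" unfolding d w2[symmetric] by simp
  also have "d2 u * b1 v - d2 v * b1 u = - (t1 * A)" using d unfolding w1[symmetric] by simp
  finally show "dzr u * dzi v - dzr v * dzi u = (1 - 2 * radius1 p) * area12 u v"
    unfolding r ar by (simp add: algebra_simps)
  have arg: "zeta_re p * dzi u - zeta_im p * dzr u = t2 * b1 u + t1 * b2 u" for u
    by (simp add: zeta_re_def zeta_im_def dzr_def dzi_def b1_def b2_def t1_def t2_def power2_eq_square algebra_simps)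
  have "dt u * (zeta_re p * dzi v - zeta_im p * dzr v) - dt v * (zeta_re p * dzi u - zeta_im p * dzr u)
     = 2 * (t2 * (d1 u * b1 v - d1 v * b1 u) + t1 * (d1 u * b2 v - d1 v * b2 u))"
    unfolding arg dt_def by (simp add: d1_def algebra_simps)
  also have "d1 u * b2 v - d1 v * b2 u = - (t2 * B)" unfolding d w2[symmetric] by simp
  finally show "dt u * (zeta_re p * dzi v - zeta_im p * dzr v) - dt v * (zeta_re p * dzi u - zeta_im p * dzr u)
      = 2 * radius1 p * (1 - radius1 p) * area12 u v"
    unfolding w1 r ar by (simp add: algebra_simps)
qed

lemma pullback_area_torus_map:
  fixes F g :: "real \<Rightarrow> real"
  assumes p: "p \<in> S3" and tan: "u \<bullet> p = 0" "v \<bullet> p = 0"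
    and \<phi>: "\<And>x. x \<in> S3 \<Longrightarrow> \<phi> x = vector [F (radius1 x), g (radius1 x) * zeta_im x, - (g (radius1 x) * zeta_re x)]"
    and d: "(F has_real_derivative F') (at (radius1 p))" "(g has_real_derivative g') (at (radius1 p))"
    and sphere: "(F (radius1 p))\<^sup>2 + (g (radius1 p))\<^sup>2 * (radius1 p * (1 - radius1 p)) = 1"
      "2 * F (radius1 p) * F' + 2 * g (radius1 p) * g' * (radius1 p * (1 - radius1 p))
        + (g (radius1 p))\<^sup>2 * (1 - 2 * radius1 p) = 0"
  shows "pullback_area \<phi> p u v = - 2 * F' * area12 u v"
proof -
  define dt where "dt = (\<lambda>u :: real^4. 2 * (p$1 * u$1 + p$2 * u$2))"
  define dzr where "dzr = (\<lambda>u :: real^4. p$1 * u$3 + u$1 * p$3 - (p$2 * u$4 + u$2 * p$4))"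
  define dzi where "dzi = (\<lambda>u :: real^4. p$1 * u$4 + u$1 * p$4 + (p$2 * u$3 + u$2 * p$3))"
  define t F0 g0 re im where "t = radius1 p" and "F0 = F t" and "g0 = g t" and "re = zeta_re p" and "im = zeta_im p"
  define D where "D = (\<lambda>u. vector [F' * dt u, g0 * dzi u + g' * dt u * im, - (g0 * dzr u + g' * dt u * re)] :: real^3)"
  have nth: "((\<lambda>x. x$i) has_derivative (\<lambda>v. v$i)) (at p)" for i :: 4
    by (rule bounded_linear_imp_has_derivative[OF bounded_linear_vec_nth])
  have 1: "((\<lambda>x. F (radius1 x)) has_derivative (\<lambda>v. F' * dt v)) (at p)"
    "((\<lambda>x. g (radius1 x)) has_derivative (\<lambda>v. g' * dt v)) (at p)"
    unfolding dt_def
    by (rule has_derivative_compose[OF has_derivative_radius1 d(1)[unfolded has_field_derivative_def]]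
        has_derivative_compose[OF has_derivative_radius1 d(2)[unfolded has_field_derivative_def]])+
  have 2: "(zeta_re has_derivative dzr) (at p)" "(zeta_im has_derivative dzi) (at p)"
    unfolding zeta_re_def zeta_im_def dzr_def dzi_def
    by (auto intro!: derivative_eq_intros nth)
  have dD: "((\<lambda>x. vector [F (radius1 x), g (radius1 x) * zeta_im x, - (g (radius1 x) * zeta_re x)] :: real^3)
      has_derivative D) (at p)"
    unfolding D_def g0_def t_def re_def im_def
    by (intro has_derivative_vector_3 has_derivative_mult has_derivative_minus 1 2)
  have deriv: "deriv_S3 \<phi> p w = D w" if "w \<bullet> p = 0" for w
    by (rule deriv_S3_eq[OF p that dD]) (simp only: \<phi>)
  let ?W = "dt u * (re * dzi v - im * dzr v) - dt v * (re * dzi u - im * dzr u)"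
  have "pullback_area \<phi> p u v = area_S2 (vector [F0, g0 * im, - (g0 * re)]) (D u) (D v)"
    unfolding pullback_area_def deriv[OF tan(1)] deriv[OF tan(2)] \<phi>[OF p]
    by (simp add: F0_def g0_def re_def im_def t_def)
  also have "\<dots> = F0 * g0\<^sup>2 * (dzr u * dzi v - dzr v * dzi u) + (F0 * g0 * g' - F' * g0\<^sup>2) * ?W"
    unfolding area_S2_def D_def vector_3 by (simp add: power2_eq_square algebra_simps)
  also have "dzr u * dzi v - dzr v * dzi u = (1 - 2 * t) * area12 u v"
    unfolding dzr_def dzi_def t_def by (rule zeta_wedge(1)[OF p tan])
  also have "?W = 2 * t * (1 - t) * area12 u v"
    unfolding dzr_def dzi_def dt_def t_def re_def im_def by (rule zeta_wedge(2)[OF p tan])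
  \<comment> \<open>Regrouped so that \<open>F0\<close> multiplies the derivative of the equation
    |\<phi>|^2 = 1, which is 0, and \<open>- 2 * F'\<close> multiplies the left-hand side of that
    equation, which is 1.\<close>
  also have "F0 * g0\<^sup>2 * ((1 - 2 * t) * area12 u v) + (F0 * g0 * g' - F' * g0\<^sup>2) * (2 * t * (1 - t) * area12 u v)
     = (F0 * (2 * F0 * F' + 2 * g0 * g' * (t * (1 - t)) + g0\<^sup>2 * (1 - 2 * t))
        - 2 * F' * (F0\<^sup>2 + g0\<^sup>2 * (t * (1 - t)))) * area12 u v"
    by (simp add: power2_eq_square algebra_simps)
  also have "\<dots> = - 2 * F' * area12 u v"
    using sphere by (simp add: F0_def g0_def t_def)
  finally show ?thesis .
qed

lemma ext_deriv_torus_primitive: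
  fixes F Ga Gb :: "real \<Rightarrow> real"
  assumes p: "p \<in> S3" and tan: "u \<bullet> p = 0" "v \<bullet> p = 0"
    and F: "(F has_real_derivative F') (at (radius1 p))"
    and G: "(Ga has_real_derivative ga) (at (radius1 p))" "(Gb has_real_derivative gb) (at (radius1 p))"
    and I: "open I" "radius1 p \<in> I" "\<And>t. t \<in> I \<Longrightarrow> F t - ca = t * Ga t" "\<And>t. t \<in> I \<Longrightarrow> F t - cb = (1 - t) * Gb t"
  shows "ext_deriv (flat (\<lambda>x. (- Ga (radius1 x)) *\<^sub>R rot1 x + (- Gb (radius1 x)) *\<^sub>R rot2 x)) p u v
    = - 2 * F' * area12 u v"
proof -
  define t where "t = radius1 p"
  have "((\<lambda>t. t * Ga t) has_real_derivative Ga t + t * ga) (at t)"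
    using G(1) by (auto intro!: derivative_eq_intros simp: t_def)
  then have "((\<lambda>t. F t - ca) has_real_derivative Ga t + t * ga) (at t)"
    by (rule has_field_derivative_transform_within_open[OF _ I(1)]) (use I in \<open>auto simp: t_def\<close>)
  moreover have "((\<lambda>t. F t - ca) has_real_derivative F') (at t)"
    using F by (auto intro!: derivative_eq_intros simp: t_def)
  ultimately have ga: "Ga t + t * ga = F'" by (rule DERIV_unique)
  have "((\<lambda>t. (1 - t) * Gb t) has_real_derivative - Gb t + (1 - t) * gb) (at t)"
    using G(2) by (auto intro!: derivative_eq_intros simp: t_def)
  then have "((\<lambda>t. F t - cb) has_real_derivative - Gb t + (1 - t) * gb) (at t)"
    by (rule has_field_derivative_transform_within_open[OF _ I(1)]) (use I in \<open>auto simp: t_def\<close>)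
  moreover have "((\<lambda>t. F t - cb) has_real_derivative F') (at t)"
    using F by (auto intro!: derivative_eq_intros simp: t_def)
  ultimately have gb: "- Gb t + (1 - t) * gb = F'" by (rule DERIV_unique)
  define d1 where "d1 = (\<lambda>u :: real^4. p$1 * u$1 + p$2 * u$2)"
  have d1: "d1 w = - (p$3 * w$3 + p$4 * w$4)" if "w \<bullet> p = 0" for w
    using that by (simp add: d1_def inner_4 algebra_simps)
  have "ext_deriv (flat (\<lambda>x. (- Ga (radius1 x)) *\<^sub>R rot1 x + (- Gb (radius1 x)) *\<^sub>R rot2 x)) p u v
     = ((- ga * (2 * d1 u)) *\<^sub>R rot1 p + (- Ga t) *\<^sub>R rot1 u + (- gb * (2 * d1 u)) *\<^sub>R rot2 p + (- Gb t) *\<^sub>R rot2 u) \<bullet> v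
     - ((- ga * (2 * d1 v)) *\<^sub>R rot1 p + (- Ga t) *\<^sub>R rot1 v + (- gb * (2 * d1 v)) *\<^sub>R rot2 p + (- Gb t) *\<^sub>R rot2 v) \<bullet> u"
    unfolding d1_def t_def
    by (rule ext_deriv_flat_eq[OF p tan has_derivative_rot_field[OF DERIV_minus[OF G(1)] DERIV_minus[OF G(2)]] refl])
  also have "\<dots> = - 2 * ga * (d1 u * (rot1 p \<bullet> v) - d1 v * (rot1 p \<bullet> u))
     - 2 * gb * (d1 u * (rot2 p \<bullet> v) - d1 v * (rot2 p \<bullet> u))
     - Ga t * (rot1 u \<bullet> v - rot1 v \<bullet> u) - Gb t * (rot2 u \<bullet> v - rot2 v \<bullet> u)"
    by (simp add: inner_add_left algebra_simps)
  also have "d1 u * (rot1 p \<bullet> v) - d1 v * (rot1 p \<bullet> u) = t * (u$1 * v$2 - u$2 * v$1)"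
    by (simp add: d1_def rot1_def inner_4 t_def radius1_def power2_eq_square algebra_simps)
  also have "d1 u * (rot2 p \<bullet> v) - d1 v * (rot2 p \<bullet> u) = - ((1 - t) * (u$3 * v$4 - u$4 * v$3))"
    unfolding d1[OF tan(1)] d1[OF tan(2)] t_def radius1_S3(3)[OF p]
    by (simp add: rot2_def inner_4 power2_eq_square algebra_simps)
  also have "rot1 u \<bullet> v - rot1 v \<bullet> u = 2 * (u$1 * v$2 - u$2 * v$1)"
    by (simp add: rot1_def inner_4 algebra_simps)
  also have "rot2 u \<bullet> v - rot2 v \<bullet> u = 2 * (u$3 * v$4 - u$4 * v$3)"
    by (simp add: rot2_def inner_4 algebra_simps)
  also have "- 2 * ga * (t * (u$1 * v$2 - u$2 * v$1)) - 2 * gb * (- ((1 - t) * (u$3 * v$4 - u$4 * v$3)))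
      - Ga t * (2 * (u$1 * v$2 - u$2 * v$1)) - Gb t * (2 * (u$3 * v$4 - u$4 * v$3))
    = - 2 * (Ga t + t * ga) * (u$1 * v$2 - u$2 * v$1) + 2 * (- Gb t + (1 - t) * gb) * (u$3 * v$4 - u$4 * v$3)"
    by (simp add: algebra_simps)
  also have "\<dots> = - 2 * F' * area12 u v"
    unfolding ga gb by (simp add: area12_def algebra_simps)
  finally show ?thesis .
qed

lemma frame_coords_torus_field:
  assumes p: "p \<in> S3"
  defines "t \<equiv> radius1 p"
  shows "frame_coords p (torus_field P Q p) = vector [t * poly P t + (1 - t) * poly Q t,
    (poly P t - poly Q t) * zeta_im p, - ((poly P t - poly Q t) * zeta_re p)]"
  unfolding t_def radius1_S3(3)[OF p] frame_coords_def torus_field_def zeta_re_def zeta_im_def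
  by (simp add: vec_eq_iff forall_3 inner_add_left)
    (simp add: inner_4 rot1_def rot2_def frame_R_def frame_X1_def frame_X2_def radius1_def[of p]
      power2_eq_square algebra_simps)

lemma hopf_invariant_torus_field:
  assumes pos: "\<And>t. 0 \<le> t \<Longrightarrow> t \<le> 1 \<Longrightarrow> 0 < t * (poly P t)\<^sup>2 + (1 - t) * (poly Q t)\<^sup>2"
  shows "hopf_invariant (associated_map (torus_field P Q)) = (sgn (poly P 1) * sgn (poly Q 0) - 1) / 2"
proof -
  define n2 where "n2 = (\<lambda>t. t * (poly P t)\<^sup>2 + (1 - t) * (poly Q t)\<^sup>2)"
  define f where "f = (\<lambda>t. t * poly P t + (1 - t) * poly Q t)"
  define n where "n = (\<lambda>t. sqrt (n2 t))"
  define F where "F = (\<lambda>t. f t / n t)"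
  define g where "g = (\<lambda>t. (poly P t - poly Q t) / n t)"
  \<comment> \<open>An open set containing [0, 1], so that the derivatives at both ends are
    two-sided.\<close>
  define I where "I = {t. 0 < n2 t}"
  have smP: "smooth_on U (poly p)" for U and p :: "real poly"
    by (rule smooth_on_subset[OF smooth_on_poly subset_UNIV])
  have oI: "open I" unfolding I_def n2_def by (intro open_Collect_less continuous_intros)
  have I01: "t \<in> I" if "t \<in> {0..1}" for t using pos[of t] that by (simp add: I_def n2_def)
  have n0: "n t > 0" "(n t)\<^sup>2 = n2 t" if "t \<in> I" for t using that by (simp_all add: n_def I_def)
  note sm = smooth_on_add smooth_on_diff smooth_on_mult smooth_on_power smooth_on_const smooth_on_id smP
  have smn2: "smooth_on U n2" and smf: "smooth_on U f" if "open U" for U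
    unfolding n2_def f_def by (intro sm that)+
  have smn: "smooth_on I n"
    unfolding n_def by (rule smooth_on_compose[OF smooth_on_sqrt oI _ _ smn2[OF oI]]) (auto simp: I_def)
  have nz: "n t \<noteq> 0" if "t \<in> I" for t using n0[OF that] by simp
  have smF: "smooth_on I F" unfolding F_def by (intro smooth_on_divide oI smf smn nz)
  have smg: "smooth_on I g" unfolding g_def by (intro smooth_on_divide oI smn nz sm)
  have circle: "(f t)\<^sup>2 + t * (1 - t) * (poly P t - poly Q t)\<^sup>2 = n2 t" for t
    by (simp add: f_def n2_def power2_eq_square algebra_simps)
  have C1: "(F t)\<^sup>2 + (g t)\<^sup>2 * (t * (1 - t)) = 1" if "t \<in> I" for t
  proof -
    have "(F t)\<^sup>2 + (g t)\<^sup>2 * (t * (1 - t)) = ((f t)\<^sup>2 + t * (1 - t) * (poly P t - poly Q t)\<^sup>2) / (n t)\<^sup>2"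
      by (simp add: F_def g_def power_divide add_divide_distrib)
    also have "\<dots> = 1" unfolding circle n0(2)[OF that] using that by (simp add: I_def)
    finally show ?thesis .
  qed
  define F' where "F' = (\<lambda>t. frechet_derivative F (at t) 1)"
  define g' where "g' = (\<lambda>t. frechet_derivative g (at t) 1)"
  have dF: "(F has_real_derivative F' t) (at t)" and dg: "(g has_real_derivative g' t) (at t)" if "t \<in> I" for t
    unfolding F'_def g'_def by (rule smooth_on_DERIV(1)[OF smF that] smooth_on_DERIV(1)[OF smg that])+
  have C2: "2 * F t * F' t + 2 * g t * g' t * (t * (1 - t)) + (g t)\<^sup>2 * (1 - 2 * t) = 0" if t: "t \<in> I" for t
  proof (rule DERIV_unique)
    show "((\<lambda>t. (F t)\<^sup>2 + (g t)\<^sup>2 * (t * (1 - t))) has_real_derivative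
        2 * F t * F' t + 2 * g t * g' t * (t * (1 - t)) + (g t)\<^sup>2 * (1 - 2 * t)) (at t)"
      by (auto intro!: derivative_eq_intros dF[OF t] dg[OF t] simp: power2_eq_square algebra_simps)
    have "((\<lambda>t. 1 :: real) has_real_derivative 0) (at t)" by simp
    then show "((\<lambda>t. (F t)\<^sup>2 + (g t)\<^sup>2 * (t * (1 - t))) has_real_derivative 0) (at t)"
      by (rule has_field_derivative_transform_within_open[OF _ oI t]) (simp add: C1)
  qed
  let ?\<phi> = "associated_map (torus_field P Q)"
  have \<phi>: "?\<phi> x = vector [F (radius1 x), g (radius1 x) * zeta_im x, - (g (radius1 x) * zeta_re x)]"
    if x: "x \<in> S3" for x
  proof -
    have "norm (frame_coords x (torus_field P Q x)) = n (radius1 x)"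
      unfolding norm_eq_sqrt_inner frame_coords_inner[OF x torus_field_tangent] torus_field_norm[OF x]
      by (simp add: n_def n2_def)
    then show ?thesis
      unfolding associated_map_def frame_coords_torus_field[OF x]
      by (simp add: vec_eq_iff forall_3 F_def g_def f_def divide_inverse mult_ac)
  qed
  have radI: "radius1 x \<in> I" if "x \<in> S3" for x using radius1_S3[OF that] by (intro I01) auto
  have pull: "pullback_area ?\<phi> p u v = - 2 * F' (radius1 p) * area12 u v"
    if "p \<in> S3" "u \<bullet> p = 0" "v \<bullet> p = 0" for p u v
    by (rule pullback_area_torus_map[OF that \<phi> dF[OF radI] dg[OF radI] C1[OF radI] C2[OF radI]]) (use that in auto)
  have n01: "n 0 = \<bar>poly Q 0\<bar>" "n 1 = \<bar>poly P 1\<bar>" by (simp_all add: n_def n2_def)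
  have PQ: "poly Q 0 \<noteq> 0" "poly P 1 \<noteq> 0" using pos[of 0] pos[of 1] by auto
  have F01: "F 0 = sgn (poly Q 0)" "F 1 = sgn (poly P 1)"
    by (simp_all add: F_def f_def n01 sgn_real_def abs_if)
  \<comment> \<open>By \<open>circle\<close>, (f - \<sigma> n)(f + \<sigma> n) = - t (1-t) (P -
    Q)^2, which contains the factor \<open>l\<close>. For \<sigma> equal to \<open>F 0\<close> or
    \<open>F 1\<close>, the second factor on the left is twice \<open>f\<close> at the zero of
    \<open>l\<close>, hence nonzero, and can be divided out near that zero.\<close>
  have removable: "\<exists>G. smooth_on I G \<and> (\<forall>t\<in>I. F t - \<sigma> = l t * G t)"
    if \<sigma>: "\<sigma>\<^sup>2 = 1" and l: "\<And>U. open U \<Longrightarrow> smooth_on U l" and k: "\<And>U. open U \<Longrightarrow> smooth_on U k"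
      and lk: "\<And>t. l t * k t = t * (1 - t)" and l0: "\<And>t. t \<in> I \<Longrightarrow> l t = 0 \<Longrightarrow> f t + \<sigma> * n t \<noteq> 0"
    for \<sigma> l k
  proof -
    define W where "W = I \<inter> {t. f t + \<sigma> * n t \<noteq> 0}"
    have oW: "open W"
      unfolding W_def f_def n_def n2_def
      by (intro open_Int oI open_Collect_neq continuous_intros)
    have WI: "W \<subseteq> I" by (auto simp: W_def)
    define H where "H = (\<lambda>t. - (k t * (poly P t - poly Q t)\<^sup>2) / (n t * (f t + \<sigma> * n t)))"
    have smnW: "smooth_on W n" by (rule smooth_on_subset[OF smn WI])
    have smH: "smooth_on W H"
      unfolding H_def
      by (intro smooth_on_divide smooth_on_uminus sm oW k smf smnW) (use nz in \<open>auto simp: W_def\<close>)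
    have eq: "F t - \<sigma> = l t * H t" if t: "t \<in> W" for t
    proof -
      have tI: "t \<in> I" and fn: "f t + \<sigma> * n t \<noteq> 0" using t by (auto simp: W_def)
      have "(f t - \<sigma> * n t) * (f t + \<sigma> * n t) = (f t)\<^sup>2 - \<sigma>\<^sup>2 * (n t)\<^sup>2"
        by (simp add: power2_eq_square algebra_simps)
      also have "\<dots> = - (l t * k t * (poly P t - poly Q t)\<^sup>2)"
        unfolding lk \<sigma> n0(2)[OF tI] circle[symmetric] by simp
      finally have "f t - \<sigma> * n t = - (l t * k t * (poly P t - poly Q t)\<^sup>2) / (f t + \<sigma> * n t)"
        using fn by (simp add: field_simps)
      moreover have "F t - \<sigma> = (f t - \<sigma> * n t) / n t"
        using nz[OF tI] by (simp add: F_def field_simps)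
      ultimately show ?thesis by (simp add: H_def mult_ac)
    qed
    have "smooth_on I (\<lambda>t. F t - \<sigma>)" by (intro smooth_on_diff smF smooth_on_const oI)
    from smooth_on_removable_quotient[OF oI oW WI this l[OF oI] smH eq] show ?thesis
      using l0 by (metis (mono_tags, lifting) DiffE IntI W_def mem_Collect_eq)
  qed
  have two: "x + sgn x * \<bar>x\<bar> = 2 * x" for x :: real by (simp add: sgn_real_def)
  obtain Ga where Ga: "smooth_on I Ga" "\<And>t. t \<in> I \<Longrightarrow> F t - F 0 = t * Ga t"
    using removable[of "F 0" "\<lambda>t. t" "\<lambda>t. 1 - t"] PQ
    by (force simp: F01 n01 f_def two sgn_real_def intro!: smooth_on_id smooth_on_diff smooth_on_const)
  obtain Gb where Gb: "smooth_on I Gb" "\<And>t. t \<in> I \<Longrightarrow> F t - F 1 = (1 - t) * Gb t"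
    using removable[of "F 1" "\<lambda>t. 1 - t" "\<lambda>t. t"] PQ
    by (force simp: F01 n01 f_def two sgn_real_def intro!: smooth_on_id smooth_on_diff smooth_on_const)
  define Y where "Y = (\<lambda>x. (- Ga (radius1 x)) *\<^sub>R rot1 x + (- Gb (radius1 x)) *\<^sub>R rot2 x)"
  have "area_primitive ?\<phi> (flat Y)"
    unfolding area_primitive_def
  proof (intro conjI ballI)
    define U where "U = radius1 -` I"
    have "continuous_on UNIV radius1" unfolding radius1_def by (intro continuous_intros)
    then have oU: "open U" unfolding U_def using oI by (simp add: open_vimage)
    have "smooth_on U Y"
      unfolding Y_def
      by (intro smooth_on_add smooth_on_scaleR smooth_on_uminus oU
          smooth_on_comp_radius1[OF Ga(1) oI] smooth_on_comp_radius1[OF Gb(1) oI]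
          smooth_on_bounded_linear[OF oU bounded_linear_rot(1) smooth_on_id]
          smooth_on_bounded_linear[OF oU bounded_linear_rot(2) smooth_on_id])
        (auto simp: U_def)
    then have "smooth_on U (\<lambda>x. blinfun_inner_right (Y x))"
      by (rule smooth_on_bounded_linear[OF oU bounded_linear_blinfun_inner_right])
    then show "smooth_along S3 (flat Y)"
      by (rule smooth_on_imp_smooth_along[OF oU, rotated]) (auto simp: U_def radI flat_def)
    fix p u v assume *: "p \<in> S3" "u \<in> tangent_S3 p" "v \<in> tangent_S3 p"
    then have tan: "u \<bullet> p = 0" "v \<bullet> p = 0" by (auto simp: tangent_S3_def)
    note pI = radI[OF *(1)]
    have "ext_deriv (flat Y) p u v = - 2 * F' (radius1 p) * area12 u v"
      unfolding Y_def
      by (rule ext_deriv_torus_primitive[OF *(1) tan dF[OF pI] smooth_on_DERIV(1)[OF Ga(1) pI]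
            smooth_on_DERIV(1)[OF Gb(1) pI] oI pI Ga(2) Gb(2)])
    then show "ext_deriv (flat Y) p u v = pullback_area ?\<phi> p u v"
      using pull[OF *(1) tan] by simp
  qed
  moreover have val: "integral_S3 (wedge12 A (ext_deriv A)) = - 4 * pi\<^sup>2 * (F 1 - F 0)\<^sup>2"
    if "area_primitive ?\<phi> A" for A
  proof (rule wedge_primitive_integral)
    show "smooth_along S3 A" using that by (simp add: area_primitive_def)
    show "ext_deriv A p u v = - 2 * F' (radius1 p) * area12 u v"
      if "p \<in> S3" "u \<bullet> p = 0" "v \<bullet> p = 0" for p u v
      using \<open>area_primitive ?\<phi> A\<close> pull[OF that] that by (simp add: area_primitive_def tangent_S3_def)
    show "(F has_real_derivative F' t) (at t)" if "t \<in> {0..1}" for t using dF I01 that by blast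
    show "continuous_on {0..1} F'"
      unfolding F'_def using smooth_on_DERIV(2)[OF smF] I01 by (auto intro: continuous_on_subset)
  qed
  \<comment> \<open>The primitive \<open>flat Y\<close> gives existence, and \<open>val\<close>
    gives uniqueness of the described number.\<close>
  ultimately have "hopf_invariant ?\<phi> = 1 / (16 * pi\<^sup>2) * (- 4 * pi\<^sup>2 * (F 1 - F 0)\<^sup>2)"
    unfolding hopf_invariant_def by (intro the_equality) auto
  also have "\<dots> = - ((F 1 - F 0)\<^sup>2) / 4" by (simp add: field_simps)
  \<comment> \<open>\<open>F 0\<close> and \<open>F 1\<close> are signs, so the square of their
    difference is 2 minus twice their product.\<close>
  also have "\<dots> = (sgn (poly P 1) * sgn (poly Q 0) - 1) / 2"
    using PQ by (auto simp: F01 sgn_real_def)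
  finally show ?thesis .
qed


section \<open>Existence of the overtwisted eigenfields\<close>

lemma overtwisted_eigenfield_exists:
  fixes m :: int
  assumes m: "2 \<le> \<bar>m\<bar>"
  shows "\<exists>V. curl_eigenfield V (2 * real_of_int m) \<and> nonvanishing V \<and>
    overtwisted (associated_contact_structure V) \<and>
    hopf_invariant (associated_map V) = (real_of_int (sgn m) * (- 1) powi (m + 1) - 1) / 2"
proof -
  define n where "n = nat \<bar>m\<bar>"
  define P where "P = hyper_poly n"
  define Q where "Q = Polynomial.smult (1 / of_int m) (P + pCons 0 (pderiv P))"
  have m0: "m \<noteq> 0" and n1: "n \<ge> 1" using m by (auto simp: n_def)
  have sys: "Polynomial.smult (of_int m) Q = P + pCons 0 (pderiv P)"
    "Polynomial.smult (of_int m) P = Q - (pderiv Q - pCons 0 (pderiv Q))"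
    using hyper_poly_system[OF m0] by (simp_all add: P_def Q_def n_def)
  have P01: "poly P 0 = 1" "poly P 1 = (- 1) ^ (n - 1) / real n"
    using hyper_poly_values[OF n1] by (simp_all add: P_def)
  have P0: "P \<noteq> 0" using P01(1) by auto
  have Q0: "poly Q 0 = 1 / of_int m" by (simp add: Q_def P01)
  have rm: "(of_int m :: real) \<noteq> 0" using m0 by simp
  have P1: "poly P 1 \<noteq> 0" using n1 by (simp add: P01)
  \<comment> \<open>This is the squared length of the field as a function of t. At the ends it
    reduces to the squares of \<open>poly Q 0\<close> and \<open>poly P 1\<close>; in between,
    common roots are excluded.\<close>
  have pos: "0 < t * (poly P t)\<^sup>2 + (1 - t) * (poly Q t)\<^sup>2" if t: "0 \<le> t" "t \<le> 1" for t
  proof -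
    consider "t = 0" | "t = 1" | "0 < t" "t < 1" using t by linarith
    then show ?thesis
    proof cases
      case 3
      then have "poly P t \<noteq> 0 \<or> poly Q t \<noteq> 0"
        by (intro hyper_poly_no_common_root[OF rm sys P0]) auto
      then show ?thesis
        using 3 by (auto intro: add_pos_nonneg add_nonneg_pos)
    qed (use P1 Q0 m0 in auto)
  qed
  define V where "V = torus_field P Q"
  have nv: "V p \<noteq> 0" if p: "p \<in> S3" for p
    using torus_field_norm[OF p, of P Q] pos[OF radius1_S3(1,2)[OF p]] by (auto simp: V_def)
  have smV: "smooth_vector_field V"
    unfolding smooth_vector_field_def V_def tangent_S3_def
    using smooth_on_imp_smooth_along[OF _ subset_UNIV smooth_on_torus_field] torus_field_tangent by auto
  have eig: "curl_eigenfield V (2 * real_of_int m)"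
    unfolding curl_eigenfield_def
    using smV nv curl_torus_field[OF sys] m0 unfolding V_def 
    by (intro conjI bexI[of _ "axis 1 1 :: real^4"]) auto
  moreover have nonv: "nonvanishing V" using nv by (simp add: nonvanishing_def)
  moreover have "overtwisted (associated_contact_structure V)"
  proof -
    have "contact_structure (associated_contact_structure V)"
      unfolding contact_structure_def associated_contact_structure_def
      using contact_form_of_curl_eigenfield[OF eig nonv] by blast
    \<comment> \<open>Here the bound 2 is essential: for |m| = 1 the polynomial \<open>P\<close> is
      the constant 1 and has no root.\<close>
    moreover have "(of_int m :: real)\<^sup>2 \<noteq> 1"
      using m by (auto simp: power2_eq_1_iff abs_if)
    then obtain \<tau> where \<tau>: "0 < \<tau>" "\<tau> < 1" "poly P \<tau> = 0"
      using hyper_poly_root[OF _ sys] by blast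
    have "poly Q \<tau> \<noteq> 0" using hyper_poly_no_common_root[OF rm sys P0, of \<tau>] \<tau> by auto
    from overtwisted_core_disk[OF \<tau> this] have "\<exists>F. overtwisted_disk (associated_contact_structure V) F"
      unfolding V_def by blast
    ultimately show ?thesis by (simp add: overtwisted_def)
  qed
  moreover have "hopf_invariant (associated_map V) = (real_of_int (sgn m) * (- 1) powi (m + 1) - 1) / 2"
  proof -
    \<comment> \<open>The sign of P(1) has the exponent \<open>n - 1\<close> with n = |m|, while the
      claimed formula has \<open>m + 1\<close>, possibly negative; the parities agree.\<close>
    have "even (n - 1) \<longleftrightarrow> even (m + 1)"
      using n1 m0 by (simp add: n_def even_nat_iff)
    then have "sgn (poly P 1) = (- 1) powi (m + 1)"
      using n1 by (auto simp: P01 minus_one_power_iff power_int_minus_left sgn_real_def)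
    moreover have "sgn (poly Q 0) = real_of_int (sgn m)"
      using m0 by (auto simp: Q0 sgn_if)
    ultimately show ?thesis
      using hopf_invariant_torus_field[OF pos] by (simp add: V_def mult.commute)
  qed
  ultimately show ?thesis by blast
qed

theorem theorem2:
  shows "(\<forall>V lam. curl_eigenfield V lam \<and> nonvanishing V \<longrightarrow>
            (\<exists>m::int. m \<noteq> 0 \<and> lam = 2 * real_of_int m)) \<and>
         (\<forall>m::int. 2 \<le> \<bar>m\<bar> \<longrightarrow>
            (\<exists>V. curl_eigenfield V (2 * real_of_int m) \<and> nonvanishing V \<and>
                 overtwisted (associated_contact_structure V) \<and>
                 hopf_invariant (associated_map V) =
                   (real_of_int (sgn m) * (- 1) powi (m + 1) - 1) / 2))"
proof (intro conjI allI impI)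
  show "\<exists>m::int. m \<noteq> 0 \<and> lam = 2 * real_of_int m"
    if "curl_eigenfield V lam \<and> nonvanishing V" for V lam
    using that nonvanishing_curl_eigenfield_even by blast
qed (rule overtwisted_eigenfield_exists)

end
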